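(* Let $(\mathbb{G},\Gamma)$ be a finite graph of groups whose underlying graph $\Gamma$ is a finite tree and all of whose vertex groups are finite, and suppose that $(\mathbb{G},\Gamma)$ satisfies the normalizer condition. Then the fundamental group $G=\pi_1(\mathbb{G},\Gamma)$ is subgroup conjugacy separable; that is, for any two finitely generated subgroups $H_1,H_2\leqslant G$ that are not conjugate in $G$, there exists a homomorphism $\phi$ from $G$ to a finite group $\overline{G}$ such that $\phi(H_1)$ is not conjugate to $\phi(H_2)$ in $\overline{G}$.
   Context: A graph of groups $(\mathbb{G},\Gamma)$ consists of a connected graph $\Gamma$ (in the sense of Serre, each edge $e$ having an inverse $\overline{e}$, initial vertex $i(e)$ and terminal vertex $t(e)$), vertex groups $G_v$ ($v\in\Gamma^0$), edge groups $G_e=G_{\overline{e}}$ ($e\in\Gamma^1$), and boundary monomorphisms $\rho_e^i:G_e\to G_{i(e)}$, $\rho_e^t:G_e\to G_{t(e)}$ with $\rho_e^i=\rho_{\overline{e}}^t$. Its fundamental group $\pi_1(\mathbb{G},\Gamma)$ is the usual (Bass–Serre) one; when $\Gamma$ is a tree it is the iterated amalgamated product of the vertex groups along the edge groups. Vertex groups and edge groups embed in $G=\pi_1(\mathbb{G},\Gamma)$, canonically up to conjugacy, and are regarded as subgroups of $G$. Normalizer condition: a finite graph of finite groups $(\mathbb{G},\Gamma)$ with $G=\pi_1(\mathbb{G},\Gamma)$ satisfies the normalizer condition if $|N_G(E):E|<\infty$ for each nontrivial subgroup $E$ of every edge group (viewed as a subgroup of $G$), where $N_G(E)$ is the normalizer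 of $E$ in $G$. *)

theory Defs
  imports
    "HOL-Algebra.Generated_Groups"
    "HOL-Algebra.Group_Action"
    "Graph_Theory.Bidirected_Digraph"
    "Graph_Theory.Arc_Walk"
    "Graph_Theory.Digraph_Component"
begin

section \<open>Trees in the sense of Serre\<close>

text \<open>
  A graph in the sense of Serre is a \<^locale>\<open>bidirected_digraph\<close>: every arc \<open>e\<close> comes with an
  inverse arc \<open>inv_edge e \<noteq> e\<close>. The predicate \<open>tree\<close> of the digraph library cannot be used here,
  because it counts the walk \<open>[e, inv_edge e]\<close> as a cycle. As in Serre, a circuit is a closed walk
  of positive length that visits its vertices only once and does not backtrack.
  \<^const>\<open>connected\<close> includes that the graph is nonempty.
\<close>

definition circuit :: "('v, 'e) pre_digraph \<Rightarrow> ('e \<Rightarrow> 'e) \<Rightarrow> 'e list \<Rightarrow> bool" where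
  "circuit \<Gamma> inv_edge p \<longleftrightarrow>
     pre_digraph.cycle \<Gamma> p \<and> (\<forall>i. Suc i < length p \<longrightarrow> p ! Suc i \<noteq> inv_edge (p ! i))"

definition serre_tree :: "('v, 'e) pre_digraph \<Rightarrow> ('e \<Rightarrow> 'e) \<Rightarrow> bool" where
  "serre_tree \<Gamma> inv_edge \<longleftrightarrow>
     bidirected_digraph \<Gamma> inv_edge \<and> connected \<Gamma> \<and> \<not> (\<exists>p. circuit \<Gamma> inv_edge p)"


section \<open>Graphs of groups\<close>

record ('v, 'e, 'g, 'h) graph_of_groups =
  shape :: "('v, 'e) pre_digraph"
  edge_inv :: "'e \<Rightarrow> 'e"
  vertex_group :: "'v \<Rightarrow> 'g monoid"
  edge_group :: "'e \<Rightarrow> 'h monoid"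
  bd_i :: "'e \<Rightarrow> 'h \<Rightarrow> 'g"
  bd_t :: "'e \<Rightarrow> 'h \<Rightarrow> 'g"

locale graph_of_groups =
  fixes \<G> :: "('v, 'e, 'g, 'h) graph_of_groups"
  assumes bidirected_shape: "bidirected_digraph (shape \<G>) (edge_inv \<G>)"
    and connected_shape: "connected (shape \<G>)"
    and group_vertex: "v \<in> verts (shape \<G>) \<Longrightarrow> group (vertex_group \<G> v)"
    and group_edge: "e \<in> arcs (shape \<G>) \<Longrightarrow> group (edge_group \<G> e)"
    and edge_group_inv: "e \<in> arcs (shape \<G>) \<Longrightarrow> edge_group \<G> (edge_inv \<G> e) = edge_group \<G> e"
    and bd_i_mon: "e \<in> arcs (shape \<G>) \<Longrightarrow>
      bd_i \<G> e \<in> mon (edge_group \<G> e) (vertex_group \<G> (tail (shape \<G>) e))"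
    and bd_t_mon: "e \<in> arcs (shape \<G>) \<Longrightarrow>
      bd_t \<G> e \<in> mon (edge_group \<G> e) (vertex_group \<G> (head (shape \<G>) e))"
    and bd_inv: "e \<in> arcs (shape \<G>) \<Longrightarrow> h \<in> carrier (edge_group \<G> e) \<Longrightarrow>
      bd_i \<G> e h = bd_t \<G> (edge_inv \<G> e) h"


section \<open>The fundamental group\<close>

inductive_set pres_eq :: "'a set \<Rightarrow> ('a list \<times> 'a list) set \<Rightarrow> ('a list \<times> 'a list) set"
  for A R where
  pres_refl: "w \<in> lists A \<Longrightarrow> (w, w) \<in> pres_eq A R"
| pres_sym: "(x, y) \<in> pres_eq A R \<Longrightarrow> (y, x) \<in> pres_eq A R"
| pres_trans: "(x, y) \<in> pres_eq A R \<Longrightarrow> (y, z) \<in> pres_eq A R \<Longrightarrow> (x, z) \<in> pres_eq A R"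
| pres_rel: "(l, r) \<in> R \<Longrightarrow> u @ l @ w \<in> lists A \<Longrightarrow> u @ r @ w \<in> lists A \<Longrightarrow>
    (u @ l @ w, u @ r @ w) \<in> pres_eq A R"

definition pres_monoid :: "'a set \<Rightarrow> ('a list \<times> 'a list) set \<Rightarrow> 'a list set monoid" where
  "pres_monoid A R =
     \<lparr>carrier = lists A // pres_eq A R,
      monoid.mult = (\<lambda>X Y. \<Union>x\<in>X. \<Union>y\<in>Y. pres_eq A R `` {x @ y}),
      monoid.one = pres_eq A R `` {[]}\<rparr>"

datatype ('v, 'e, 'g) letter = Vert 'v 'g | Edge 'e

definition gog_letters :: "('v, 'e, 'g, 'h) graph_of_groups \<Rightarrow> ('v, 'e, 'g) letter set" where
  "gog_letters \<G> =
     {Vert v g |v g. v \<in> verts (shape \<G>) \<and> g \<in> carrier (vertex_group \<G> v)}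
     \<union> Edge ` arcs (shape \<G>)"

text \<open>
  The Bass--Serre relations relative to the set \<open>T\<close> of edges of a maximal subtree: the
  multiplication tables of the vertex groups, \<open>e (inv e) = 1\<close>,
  \<open>e \<rho>\<^sup>t\<^sub>e(h) (inv e) = \<rho>\<^sup>i\<^sub>e(h)\<close>, and \<open>e = 1\<close> for \<open>e \<in> T\<close>. Inverses of all generators are
  themselves generators, so the monoid with this presentation is the group with this presentation.
\<close>

definition gog_relations ::
    "('v, 'e, 'g, 'h) graph_of_groups \<Rightarrow> 'e set
      \<Rightarrow> (('v, 'e, 'g) letter list \<times> ('v, 'e, 'g) letter list) set" where
  "gog_relations \<G> T =
     {([Vert v \<one>\<^bsub>vertex_group \<G> v\<^esub>], []) |v. v \<in> verts (shape \<G>)}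
     \<union> {([Vert v x, Vert v y], [Vert v (x \<otimes>\<^bsub>vertex_group \<G> v\<^esub> y)]) |v x y.
          v \<in> verts (shape \<G>)
          \<and> x \<in> carrier (vertex_group \<G> v) \<and> y \<in> carrier (vertex_group \<G> v)}
     \<union> {([Edge e, Edge (edge_inv \<G> e)], []) |e. e \<in> arcs (shape \<G>)}
     \<union> {([Edge e, Vert (head (shape \<G>) e) (bd_t \<G> e h), Edge (edge_inv \<G> e)],
          [Vert (tail (shape \<G>) e) (bd_i \<G> e h)]) |e h.
          e \<in> arcs (shape \<G>) \<and> h \<in> carrier (edge_group \<G> e)}
     \<union> {([Edge e], []) |e. e \<in> T}"

definition fundamental_group ::
    "('v, 'e, 'g, 'h) graph_of_groups \<Rightarrow> 'e set \<Rightarrow> ('v, 'e, 'g) letter list set monoid" where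
  "fundamental_group \<G> T = pres_monoid (gog_letters \<G>) (gog_relations \<G> T)"

definition vertex_embedding ::
    "('v, 'e, 'g, 'h) graph_of_groups \<Rightarrow> 'e set \<Rightarrow> 'v \<Rightarrow> 'g \<Rightarrow> ('v, 'e, 'g) letter list set" where
  "vertex_embedding \<G> T v g = pres_eq (gog_letters \<G>) (gog_relations \<G> T) `` {[Vert v g]}"

text \<open>
  Using \<open>bd_t\<close> instead of \<open>bd_i\<close> would replace this subgroup by a conjugate
  (by the same subgroup, if \<open>e \<in> T\<close>).
\<close>

definition edge_subgroup ::
    "('v, 'e, 'g, 'h) graph_of_groups \<Rightarrow> 'e set \<Rightarrow> 'e \<Rightarrow> ('v, 'e, 'g) letter list set set" where
  "edge_subgroup \<G> T e =
     (\<lambda>h. vertex_embedding \<G> T (tail (shape \<G>) e) (bd_i \<G> e h)) ` carrier (edge_group \<G> e)"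

definition normalizer_condition :: "('v, 'e, 'g, 'h) graph_of_groups \<Rightarrow> 'e set \<Rightarrow> bool" where
  "normalizer_condition \<G> T \<longleftrightarrow>
     (let G = fundamental_group \<G> T in
      \<forall>e \<in> arcs (shape \<G>). \<forall>E.
        subgroup E G \<and> E \<subseteq> edge_subgroup \<G> T e \<and> E \<noteq> {\<one>\<^bsub>G\<^esub>} \<longrightarrow>
        finite (rcosets\<^bsub>G\<lparr>carrier := normalizer G E\<rparr>\<^esub> E))"


section \<open>Subgroup conjugacy separability\<close>

definition conjugate_subsets :: "('a, 'm) monoid_scheme \<Rightarrow> 'a set \<Rightarrow> 'a set \<Rightarrow> bool" where
  "conjugate_subsets G H K \<longleftrightarrow> (\<exists>g \<in> carrier G. K = g <#\<^bsub>G\<^esub> H #>\<^bsub>G\<^esub> inv\<^bsub>G\<^esub> g)"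

definition fg_subgroup :: "'a set \<Rightarrow> ('a, 'm) monoid_scheme \<Rightarrow> bool" where
  "fg_subgroup H G \<longleftrightarrow>
     subgroup H G \<and> (\<exists>S. finite S \<and> S \<subseteq> carrier G \<and> H = generate G S)"

text \<open>Every finite group is isomorphic to one whose elements are natural numbers.\<close>

definition subgroup_conjugacy_separable :: "('a, 'm) monoid_scheme \<Rightarrow> bool" where
  "subgroup_conjugacy_separable G \<longleftrightarrow>
     (\<forall>H\<^sub>1 H\<^sub>2. fg_subgroup H\<^sub>1 G \<and> fg_subgroup H\<^sub>2 G \<and> \<not> conjugate_subsets G H\<^sub>1 H\<^sub>2 \<longrightarrow>
        (\<exists>(Q :: nat monoid) \<phi>. group Q \<and> finite (carrier Q) \<and> \<phi> \<in> hom G Q \<and>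
           \<not> conjugate_subsets Q (\<phi> ` H\<^sub>1) (\<phi> ` H\<^sub>2)))"

end

theory Submission
  imports Defs
begin

text \<open>
  Let \<open>H\<close> and \<open>K\<close> be finitely generated subgroups. If each lies in a conjugate of the other, then
  separability of finitely generated subgroups and a comparison of orders in finite quotients show
  that they are conjugate. Otherwise suppose that \<open>K\<close> lies in no conjugate of \<open>H\<close>; it suffices to
  find a finite \<open>G\<close>-set in which \<open>H\<close> fixes a point and \<open>K\<close> fixes none.

  In the coset space \<open>X = G/H\<close> only finitely many points have a nontrivial stabilizer in a vertex
  group: an edge of the quotient of the Bass--Serre tree by \<open>H\<close> that is not crossed by the generators
  of \<open>H\<close> separates, the stabilizers beyond it are contained in those before it, and the normalizer
  condition makes centralizers of nontrivial elements of edge groups finite. Hence a large finite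
  piece of \<open>X\<close> can be completed to a finite \<open>G\<close>-set \<open>Y\<close> by free orbits. Twisting \<open>Y\<close>, at the edges
  away from the nonfree points and the generating loops of \<open>H\<close>, by permutations without short
  relations gives the required \<open>G\<close>-set: if all generators of \<open>K\<close> fix a point of it, then their
  paths either stay in a copy of the piece of \<open>X\<close>, so that \<open>K\<close> fixes a point of \<open>X\<close>, or backtrack
  until they are trivial.
\<close>

section \<open>Orienting a finite tree\<close>

text \<open>Finite \<open>G\<close>-sets suit one-sided containment: if the image of
  \<open>K\<close> lay in a conjugate of the image of \<open>H\<close>, then \<open>K\<close> would
  fix a translate of any point fixed by \<open>H\<close>. The obstacle is that a completion
  \<open>Y\<close> of a piece of \<open>X\<close> may acquire common fixed points of
  \<open>K\<close> that do not come from \<open>X\<close>; the second coordinate in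
  \<open>Y \<times> S\<close> is there to destroy these, while leaving the point fixed by
  \<open>H\<close> intact. Because the graph is a tree, every edge letter is trivial in
  \<open>G\<close>. Hence an action of \<open>G\<close> amounts to actions of the vertex groups on
  one set that agree on the edge groups, and compatible choices can be made vertex by vertex,
  starting at the root. The completion, the twist and the walls of the Bass-Serre tree all arise in
  this way. The Bass-Serre tree itself appears only through right cosets of vertex and edge groups,
  on which \<open>G\<close> acts by right translation.\<close>

context bidirected_digraph
begin

text \<open>Taking \<open>arev a\<close> right after \<open>a\<close> would return to the tail of
  \<open>a\<close>, which the walk has already visited.\<close>

lemma distinct_awalk_no_backtracking:
  assumes "awalk u p v" "distinct (awalk_verts u p)"
  shows "successively (\<lambda>a b. b \<noteq> arev a) p"
  using assms
proof (induction p arbitrary: u)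
  case (Cons a p)
  have a: "a \<in> arcs G" "tail G a = u" and p: "awalk (head G a) p v"
    using Cons.prems(1) by (auto simp: awalk_Cons_iff)
  have IH: "successively (\<lambda>a b. b \<noteq> arev a) p"
    using Cons.IH[OF p] Cons.prems(2) by simp
  show ?case
  proof (cases p)
    case (Cons b p')
    have "head G b \<in> set (awalk_verts (head G b) p')"
      using p Cons hd_in_awalk_verts(1) by (auto simp: awalk_Cons_iff)
    then have "head G b \<noteq> u" using \<open>distinct (awalk_verts u (a # p))\<close> Cons a(2) by auto
    then have "b \<noteq> arev a" using a by auto
    then show ?thesis using IH Cons by simp
  qed simp
qed simp

text \<open>An invariant for growing a subtree on the vertex set \<open>W\<close> from the root
  \<open>r\<close>. The decreasing \<open>rank\<close> makes induction along parents well-founded.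
  The simple walks inside \<open>W\<close> serve to close up a circuit in case a new vertex could be
  attached by two different arcs.\<close>

definition oriented :: "'a set \<Rightarrow> 'a \<Rightarrow> ('a \<Rightarrow> 'a) \<Rightarrow> ('a \<Rightarrow> nat) \<Rightarrow> ('a \<Rightarrow> 'b) \<Rightarrow> bool" where
  "oriented W r par rank pe \<longleftrightarrow> W \<subseteq> verts G \<and> r \<in> W \<and>
     (\<forall>v \<in> W. v \<noteq> r \<longrightarrow> par v \<in> W \<and> rank (par v) < rank v \<and>
        pe v \<in> arcs G \<and> tail G (pe v) = par v \<and> head G (pe v) = v) \<and>
     (\<forall>e \<in> arcs G. tail G e \<in> W \<longrightarrow> head G e \<in> W \<longrightarrow>
        (\<exists>v \<in> W. v \<noteq> r \<and> (e = pe v \<or> e = arev (pe v)))) \<and>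
     (\<forall>u \<in> W. \<forall>v \<in> W. \<exists>p. awalk u p v \<and> distinct (awalk_verts u p) \<and> set (awalk_verts u p) \<subseteq> W)"

text \<open>Two arcs from \<open>W\<close> to the new vertex would form a circuit together with a
  simple walk inside \<open>W\<close>, and a loop is a circuit by itself. So \<open>e0\<close> is
  the only new edge up to inversion and can serve as parent edge.\<close>

lemma oriented_extend:
  assumes no_circuit: "\<And>p. \<not> circuit G arev p"
    and ori: "oriented W r par rank pe"
    and e0: "e0 \<in> arcs G" "tail G e0 \<in> W" "head G e0 \<notin> W"
  shows "\<exists>par rank pe. oriented (insert (head G e0) W) r par rank pe"
proof -
  let ?u = "tail G e0" and ?w = "head G e0"
  let ?par = "par(?w := ?u)" and ?rank = "rank(?w := Suc (rank ?u))" and ?pe = "pe(?w := e0)"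
  have W: "W \<subseteq> verts G" "r \<in> W"
    and par: "\<And>v. v \<in> W \<Longrightarrow> v \<noteq> r \<Longrightarrow> par v \<in> W \<and> rank (par v) < rank v \<and>
        pe v \<in> arcs G \<and> tail G (pe v) = par v \<and> head G (pe v) = v"
    and arcs: "\<And>e. e \<in> arcs G \<Longrightarrow> tail G e \<in> W \<Longrightarrow> head G e \<in> W \<Longrightarrow>
        \<exists>v \<in> W. v \<noteq> r \<and> (e = pe v \<or> e = arev (pe v))"
    and walks: "\<And>u v. u \<in> W \<Longrightarrow> v \<in> W \<Longrightarrow>
        \<exists>p. awalk u p v \<and> distinct (awalk_verts u p) \<and> set (awalk_verts u p) \<subseteq> W"
    using ori unfolding oriented_def by blast+
  have wV: "?w \<in> verts G" using e0(1) by simp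
  have to_w: "f = e0" if f: "f \<in> arcs G" "tail G f \<in> W" "head G f = ?w" for f
  proof (rule ccontr)
    assume ne: "f \<noteq> e0"
    obtain p where p: "awalk (tail G f) p ?u" "distinct (awalk_verts (tail G f) p)"
      "set (awalk_verts (tail G f) p) \<subseteq> W"
      using walks[OF f(2) e0(2)] by blast
    \<comment> \<open>Out along \<open>e0\<close> and back along the inverse of \<open>f\<close>. If
      the two arcs have the same tail, \<open>p\<close> is empty, and \<open>f \<noteq> e0\<close>
      alone keeps this closed walk from backtracking.\<close>
    let ?c = "p @ [e0, arev f]"
    have 2: "awalk ?u [e0, arev f] (tail G f)"
      using e0(1) f by (auto simp: awalk_Cons_iff awalk_Nil_iff)
    have walk: "awalk (tail G f) ?c (tail G f)" using p(1) 2 by auto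
    have verts_c: "awalk_verts (tail G f) ?c = awalk_verts (tail G f) p @ [?w, tail G f]"
      using p(1) e0(1) f by (auto simp: awalk_verts_conv)
    obtain vs where vs: "awalk_verts (tail G f) p = tail G f # vs"
      using p(1) by (cases p) (auto simp: awalk_Cons_iff)
    have "distinct (tl (awalk_verts (tail G f) ?c))"
      using verts_c vs p(2,3) e0(3) by auto
    then have "cycle ?c" using walk unfolding cycle_def by blast
    moreover have "successively (\<lambda>a b. b \<noteq> arev a) ?c"
    proof -
      have "e0 \<noteq> arev (last p)" if ne: "p \<noteq> []"
      proof
        assume e: "e0 = arev (last p)"
        have "last p \<in> arcs G" using p(1) last_in_set[OF ne] unfolding awalk_def by blast
        then have "?w = tail G (last p)" using e by simp
        moreover have "tail G (last p) \<in> set (awalk_verts (tail G f) p)"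
          using ne by (auto simp: awalk_verts_conv)
        ultimately show False using p(3) e0(3) by auto
      qed
      moreover have "arev f \<noteq> arev e0" using ne arev_eq_iff by simp
      ultimately show ?thesis
        using distinct_awalk_no_backtracking[OF p(1,2)] by (auto simp: successively_append_iff)
    qed
    then have "\<forall>i. Suc i < length ?c \<longrightarrow> ?c ! Suc i \<noteq> arev (?c ! i)"
      by (simp only: successively_conv_nth)
    ultimately have "circuit G arev ?c" unfolding circuit_def by blast
    then show False using no_circuit by blast
  qed
  have "oriented (insert ?w W) r ?par ?rank ?pe"
    unfolding oriented_def
  proof (intro conjI ballI impI)
    show "insert ?w W \<subseteq> verts G" "r \<in> insert ?w W" using W wV by auto
  next
    fix v assume v: "v \<in> insert ?w W" "v \<noteq> r"
    show "?par v \<in> insert ?w W" "?rank (?par v) < ?rank v" "?pe v \<in> arcs G"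
      "tail G (?pe v) = ?par v" "head G (?pe v) = v"
      using v par[of v] e0 by (cases "v = ?w"; auto)+
  next
    fix e assume e: "e \<in> arcs G" "tail G e \<in> insert ?w W" "head G e \<in> insert ?w W"
    consider "tail G e \<in> W" "head G e \<in> W" | "tail G e \<in> W" "head G e = ?w"
      | "tail G e = ?w" "head G e \<in> W" | "tail G e = ?w" "head G e = ?w"
      using e by blast
    then show "\<exists>v \<in> insert ?w W. v \<noteq> r \<and> (e = ?pe v \<or> e = arev (?pe v))"
    proof cases
      case 1
      then obtain v where "v \<in> W" "v \<noteq> r" "e = pe v \<or> e = arev (pe v)" using arcs[OF e(1)] by blast
      then show ?thesis using e0(3) by (intro bexI[of _ v]) auto
    next
      case 2
      then have "e = e0" using to_w[OF e(1)] by blast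
      then show ?thesis using W(2) e0(3) by (intro bexI[of _ ?w]) auto
    next
      case 3
      then have "arev e = e0" using to_w[of "arev e"] e(1) by simp
      then have "e = arev e0" by auto
      then show ?thesis using W(2) e0(3) by (intro bexI[of _ ?w]) auto
    next
      case 4
      have "cycle [e]"
        using 4 e(1) wV unfolding cycle_def
        by (intro exI[of _ ?w]) (auto simp: awalk_Cons_iff awalk_Nil_iff)
      then have "circuit G arev [e]" by (simp add: circuit_def)
      then show ?thesis using no_circuit by blast
    qed
  next
    fix u v assume uv: "u \<in> insert ?w W" "v \<in> insert ?w W"
    consider "u \<in> W" "v \<in> W" | "u \<in> W" "v = ?w" | "u = ?w" "v \<in> W" | "u = ?w" "v = ?w"
      using uv by blast
    then show "\<exists>p. awalk u p v \<and> distinct (awalk_verts u p) \<and> set (awalk_verts u p) \<subseteq> insert ?w W"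
    proof cases
      case 1
      then show ?thesis using walks by blast
    next
      case 2
      then obtain p where p: "awalk u p ?u" "distinct (awalk_verts u p)" "set (awalk_verts u p) \<subseteq> W"
        using walks[OF _ e0(2)] by blast
      have "awalk ?u [e0] ?w" using e0(1) by (auto simp: awalk_Cons_iff awalk_Nil_iff)
      then have "awalk u (p @ [e0]) ?w" using p(1) by auto
      moreover have "awalk_verts u (p @ [e0]) = awalk_verts u p @ [?w]"
        using p(1) by (auto simp: awalk_verts_conv)
      ultimately show ?thesis using 2 p e0(3) by (intro exI[of _ "p @ [e0]"]) auto
    next
      case 3
      then obtain p where p: "awalk ?u p v" "distinct (awalk_verts ?u p)" "set (awalk_verts ?u p) \<subseteq> W"
        using walks[OF e0(2)] by blast
      have "awalk ?w (arev e0 # p) v" using p(1) e0(1) by (auto simp: awalk_Cons_iff)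
      then show ?thesis using 3 p e0 by (intro exI[of _ "arev e0 # p"]) auto
    next
      case 4
      then show ?thesis using wV by (intro exI[of _ "[]"]) (auto simp: awalk_Nil_iff)
    qed
  qed
  then show ?thesis by blast
qed

lemma serre_tree_oriented:
  assumes tree: "serre_tree G arev" and fin: "finite (verts G)" and r: "r \<in> verts G"
  shows "\<exists>par rank pe. oriented (verts G) r par rank pe"
proof -
  have no_circuit: "\<not> circuit G arev p" for p using tree by (auto simp: serre_tree_def)
  have conn: "r \<rightarrow>\<^sup>*\<^bsub>G\<^esub> v" if "v \<in> verts G" for v
  proof -
    have "r \<rightarrow>\<^sup>*\<^bsub>mk_symmetric G\<^esub> v"
      using tree that r by (auto simp: serre_tree_def connected_def strongly_connected_def)
    then show ?thesis using reachable_mk_symmetric_eq sym_arcs by blast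
  qed
  have "\<exists>par rank pe. oriented {r} r par rank pe"
  proof -
    have "\<not> (tail G e = r \<and> head G e = r)" if e: "e \<in> arcs G" for e
    proof
      assume er: "tail G e = r \<and> head G e = r"
      then have "cycle [e]"
        using e unfolding cycle_def
        by (intro exI[of _ r]) (auto simp: awalk_Cons_iff awalk_Nil_iff r)
      then have "circuit G arev [e]" by (simp add: circuit_def)
      then show False using no_circuit by blast
    qed
    \<comment> \<open>Parent data are constrained only away from the root, so their values here are
      arbitrary.\<close>
    then have "oriented {r} r (\<lambda>v. v) (\<lambda>v. 0) (\<lambda>v. undefined)"
      unfolding oriented_def using r by (auto simp: awalk_Nil_iff intro!: exI[of _ "[]"])
    then show ?thesis by blast
  qed
  moreover have "\<exists>W'. W' \<subseteq> verts G \<and> card W' = Suc (card W) \<and> (\<exists>par rank pe. oriented W' r par rank pe)"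
    if W: "\<exists>par rank pe. oriented W r par rank pe" "W \<noteq> verts G" for W
  proof -
    obtain par rank pe where ori: "oriented W r par rank pe" using W(1) by blast
    then have sub: "W \<subseteq> verts G" "r \<in> W" by (auto simp: oriented_def)
    then obtain v where v: "v \<in> verts G" "v \<notin> W" using W(2) by blast
    have "\<exists>e0 \<in> arcs G. tail G e0 \<in> W \<and> head G e0 \<notin> W"
    proof (rule ccontr)
      assume closed: "\<not> (\<exists>e0 \<in> arcs G. tail G e0 \<in> W \<and> head G e0 \<notin> W)"
      have "v \<in> W" using conn[OF v(1)]
      proof (induction rule: reachable_induct)
        case (step x y)
        then show ?case using closed by (auto simp: arcs_ends_def arc_to_ends_def)
      qed (rule sub(2))
      then show False using v(2) by blast
    qed
    then obtain e0 where e0: "e0 \<in> arcs G" "tail G e0 \<in> W" "head G e0 \<notin> W" by blast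
    have "card (insert (head G e0) W) = Suc (card W)"
      using e0(3) finite_subset[OF sub(1) fin] by simp
    moreover have "insert (head G e0) W \<subseteq> verts G" using sub(1) e0(1) by simp
    ultimately show ?thesis using oriented_extend[OF no_circuit ori e0] by blast
  qed
  \<comment> \<open>\<open>n\<close> counts rounds: as long as vertices are missing, each round
    gains one. For \<open>n = card (verts G)\<close> the second alternative is impossible.\<close>
  ultimately have grow: "\<exists>W \<subseteq> verts G. (W = verts G \<or> card W > n) \<and> (\<exists>par rank pe. oriented W r par rank pe)" for n
  proof (induction n)
    case 0
    then show ?case using r by (intro exI[of _ "{r}"]) auto
  next
    case (Suc n)
    then obtain W where W: "W \<subseteq> verts G" "W = verts G \<or> card W > n"
      "\<exists>par rank pe. oriented W r par rank pe" by blast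
    show ?case
    proof (cases "W = verts G")
      case True
      then show ?thesis using W(3) by blast
    next
      case False
      then obtain W' where "W' \<subseteq> verts G" "card W' = Suc (card W)" "\<exists>par rank pe. oriented W' r par rank pe"
        using Suc.prems(2)[OF W(3)] by blast
      then show ?thesis using W(2) False by (intro exI[of _ W']) auto
    qed
  qed
  obtain W where "W \<subseteq> verts G" "W = verts G \<or> card W > card (verts G)" "\<exists>par rank pe. oriented W r par rank pe"
    using grow[of "card (verts G)"] by blast
  then show ?thesis using card_mono[OF fin] by (metis linorder_not_less)
qed

end

section \<open>Monoid presentations\<close>

lemma pres_eq_lists: "(x, y) \<in> pres_eq A R \<Longrightarrow> x \<in> lists A \<and> y \<in> lists A"
  by (induction rule: pres_eq.induct) auto

lemma equiv_pres_eq: "equiv (lists A) (pres_eq A R)"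
proof (rule equivI)
  show "pres_eq A R \<subseteq> lists A \<times> lists A"
    by (auto dest: pres_eq_lists)
  show "refl_on (lists A) (pres_eq A R)"
    by (simp add: refl_onI pres_refl)
  show "sym (pres_eq A R)"
    by (rule symI) (rule pres_sym)
  show "trans (pres_eq A R)"
    by (rule transI) (rule pres_trans)
qed

lemma pres_eq_append:
  assumes "(x, y) \<in> pres_eq A R" "u \<in> lists A" "w \<in> lists A"
  shows "(u @ x @ w, u @ y @ w) \<in> pres_eq A R"
  using assms
proof (induction rule: pres_eq.induct)
  case (pres_refl v)
  then show ?case by (intro pres_eq.pres_refl) simp
next
  case (pres_sym x y)
  then show ?case by (auto intro: pres_eq.pres_sym)
next
  case (pres_trans x y z)
  then show ?case by (meson pres_eq.pres_trans)
next
  case (pres_rel l r u' w')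
  then show ?case
    using pres_eq.pres_rel[of l r R "u @ u'" "w' @ w" A] by auto
qed

lemma pres_eq_append2:
  assumes "(x, x') \<in> pres_eq A R" "(y, y') \<in> pres_eq A R"
  shows "(x @ y, x' @ y') \<in> pres_eq A R"
proof -
  have "(x @ y, x' @ y) \<in> pres_eq A R"
    using pres_eq_append[OF assms(1), of "[]" y] pres_eq_lists[OF assms(2)] by simp
  moreover have "(x' @ y, x' @ y') \<in> pres_eq A R"
    using pres_eq_append[OF assms(2), of x' "[]"] pres_eq_lists[OF assms(1)] by simp
  ultimately show ?thesis by (rule pres_trans)
qed

lemma pres_class_eq_iff:
  assumes "x \<in> lists A" "y \<in> lists A"
  shows "pres_eq A R `` {x} = pres_eq A R `` {y} \<longleftrightarrow> (x, y) \<in> pres_eq A R"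
  by (rule eq_equiv_class_iff[OF equiv_pres_eq assms])

lemma pres_monoid_carrierE:
  assumes "X \<in> carrier (pres_monoid A R)"
  obtains w where "w \<in> lists A" "X = pres_eq A R `` {w}"
  using assms by (auto simp: pres_monoid_def elim!: quotientE)

lemma pres_class_in_carrier: "w \<in> lists A \<Longrightarrow> pres_eq A R `` {w} \<in> carrier (pres_monoid A R)"
  by (auto simp: pres_monoid_def intro: quotientI)

lemma pres_class_one: "\<one>\<^bsub>pres_monoid A R\<^esub> = pres_eq A R `` {[]}"
  by (simp add: pres_monoid_def)

text \<open>The product of two classes is defined as a union over all representatives; since the
  relation is a congruence, all of them contribute the same class.\<close>

lemma pres_class_mult:
  assumes "x \<in> lists A" "y \<in> lists A"
  shows "pres_eq A R `` {x} \<otimes>\<^bsub>pres_monoid A R\<^esub> pres_eq A R `` {y} = pres_eq A R `` {x @ y}"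
proof -
  have 1: "pres_eq A R `` {x' @ y'} = pres_eq A R `` {x @ y}"
    if "x' \<in> pres_eq A R `` {x}" "y' \<in> pres_eq A R `` {y}" for x' y'
    using equiv_class_eq[OF equiv_pres_eq pres_eq_append2] that by (metis Image_singleton_iff)
  have "x \<in> pres_eq A R `` {x}" "y \<in> pres_eq A R `` {y}"
    using assms pres_refl by (metis Image_singleton_iff)+
  with 1 show ?thesis
    unfolding pres_monoid_def monoid.simps by blast
qed

text \<open>It is enough to cancel single letters from the left: if \<open>v\<close> cancels
  \<open>a\<close> and \<open>w\<close> cancels \<open>x\<close>, then \<open>w @ v\<close> cancels
  \<open>a # x\<close>.\<close>

lemma group_pres_monoid:
  assumes "\<And>a. a \<in> A \<Longrightarrow> \<exists>w \<in> lists A. (w @ [a], []) \<in> pres_eq A R"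
  shows "group (pres_monoid A R)"
proof (rule groupI)
  fix X Y Z assume XYZ: "X \<in> carrier (pres_monoid A R)" "Y \<in> carrier (pres_monoid A R)"
    "Z \<in> carrier (pres_monoid A R)"
  obtain x where x: "x \<in> lists A" "X = pres_eq A R `` {x}"
    using XYZ(1) by (rule pres_monoid_carrierE)
  obtain y where y: "y \<in> lists A" "Y = pres_eq A R `` {y}"
    using XYZ(2) by (rule pres_monoid_carrierE)
  obtain z where z: "z \<in> lists A" "Z = pres_eq A R `` {z}"
    using XYZ(3) by (rule pres_monoid_carrierE)
  show "X \<otimes>\<^bsub>pres_monoid A R\<^esub> Y \<otimes>\<^bsub>pres_monoid A R\<^esub> Z =
    X \<otimes>\<^bsub>pres_monoid A R\<^esub> (Y \<otimes>\<^bsub>pres_monoid A R\<^esub> Z)"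
    using x y z by (simp add: pres_class_mult)
next
  fix X Y assume "X \<in> carrier (pres_monoid A R)" "Y \<in> carrier (pres_monoid A R)"
  then show "X \<otimes>\<^bsub>pres_monoid A R\<^esub> Y \<in> carrier (pres_monoid A R)"
    by (elim pres_monoid_carrierE) (auto simp: pres_class_mult intro!: pres_class_in_carrier)
next
  fix X assume "X \<in> carrier (pres_monoid A R)"
  then show "\<one>\<^bsub>pres_monoid A R\<^esub> \<otimes>\<^bsub>pres_monoid A R\<^esub> X = X"
    by (elim pres_monoid_carrierE) (simp add: pres_class_mult pres_class_one)
next
  show "\<one>\<^bsub>pres_monoid A R\<^esub> \<in> carrier (pres_monoid A R)"
    by (simp add: pres_class_one pres_class_in_carrier)
next
  fix X assume "X \<in> carrier (pres_monoid A R)"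
  then obtain x where x: "x \<in> lists A" "X = pres_eq A R `` {x}"
    by (rule pres_monoid_carrierE)
  have "\<exists>w \<in> lists A. (w @ x, []) \<in> pres_eq A R"
    using x(1)
  proof (induction x)
    case Nil
    then show ?case by (intro bexI[of _ "[]"]) (simp_all add: pres_refl)
  next
    case (Cons a x)
    then obtain w where w: "w \<in> lists A" "(w @ x, []) \<in> pres_eq A R" by auto
    from assms[OF Cons.hyps(1)] obtain v where v: "v \<in> lists A" "(v @ [a], []) \<in> pres_eq A R"
      by blast
    have "(w @ (v @ [a]) @ x, w @ [] @ x) \<in> pres_eq A R"
      using v w Cons.hyps by (intro pres_eq_append) auto
    then have "((w @ v) @ a # x, []) \<in> pres_eq A R" using w(2) by (auto intro: pres_trans)
    then show ?case using v(1) w(1) by (intro bexI[of _ "w @ v"]) auto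
  qed
  then obtain w where w: "w \<in> lists A" "(w @ x, []) \<in> pres_eq A R" by blast
  then have "pres_eq A R `` {w} \<otimes>\<^bsub>pres_monoid A R\<^esub> X = \<one>\<^bsub>pres_monoid A R\<^esub>"
    using x by (simp add: pres_class_mult pres_class_one pres_class_eq_iff)
  then show "\<exists>Y \<in> carrier (pres_monoid A R). Y \<otimes>\<^bsub>pres_monoid A R\<^esub> X = \<one>\<^bsub>pres_monoid A R\<^esub>"
    using pres_class_in_carrier[OF w(1)] by blast
qed


section \<open>Group actions on sets\<close>

text \<open>Only values on \<open>carrier G\<close> and \<open>Y\<close> are constrained, so the
  action of a subgroup is the same formula with the carrier replaced, as in
  \<open>G\<lparr>carrier := A v\<rparr>\<close>.\<close>

definition acts_on :: "('a, 'm) monoid_scheme \<Rightarrow> 'b set \<Rightarrow> ('a \<Rightarrow> 'b \<Rightarrow> 'b) \<Rightarrow> bool" where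
  "acts_on G Y \<phi> \<longleftrightarrow>
     (\<forall>g \<in> carrier G. \<forall>y \<in> Y. \<phi> g y \<in> Y) \<and>
     (\<forall>y \<in> Y. \<phi> \<one>\<^bsub>G\<^esub> y = y) \<and>
     (\<forall>g \<in> carrier G. \<forall>h \<in> carrier G. \<forall>y \<in> Y. \<phi> (g \<otimes>\<^bsub>G\<^esub> h) y = \<phi> g (\<phi> h y))"

lemma acts_onD:
  assumes "acts_on G Y \<phi>"
  shows "g \<in> carrier G \<Longrightarrow> y \<in> Y \<Longrightarrow> \<phi> g y \<in> Y"
    and "y \<in> Y \<Longrightarrow> \<phi> \<one>\<^bsub>G\<^esub> y = y"
    and "g \<in> carrier G \<Longrightarrow> h \<in> carrier G \<Longrightarrow> y \<in> Y \<Longrightarrow> \<phi> (g \<otimes>\<^bsub>G\<^esub> h) y = \<phi> g (\<phi> h y)"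
  using assms by (auto simp: acts_on_def)

lemma (in group) acts_on_inv:
  assumes "acts_on G Y \<phi>" "g \<in> carrier G" "y \<in> Y"
  shows "\<phi> (inv g) (\<phi> g y) = y" and "\<phi> g (\<phi> (inv g) y) = y"
  using acts_onD(2)[OF assms(1,3)] acts_onD(3)[OF assms(1) _ _ assms(3), symmetric] assms(2)
  by simp_all

section \<open>Partial bijections, free words and free actions\<close>

text \<open>\<open>D\<close> and \<open>D'\<close> have complements of equal size in
  \<open>W\<close>, and any bijection between these completes \<open>f\<close>.\<close>

lemma extend_partial_bij:
  assumes "finite W" "D \<subseteq> W" "D' \<subseteq> W" "bij_betw f D D'"
  obtains \<pi> where "\<pi> permutes W" and "\<And>x. x \<in> D \<Longrightarrow> \<pi> x = f x"
proof -
  have fin: "finite D" "finite D'" using assms finite_subset by auto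
  have "card (W - D) = card (W - D')"
    using assms fin bij_betw_same_card[OF assms(4)] by (simp add: card_Diff_subset)
  then obtain h where h: "bij_betw h (W - D) (W - D')"
    using assms(1) by (metis finite_Diff finite_same_card_bij)
  define \<pi> where "\<pi> x = (if x \<in> D then f x else if x \<in> W then h x else x)" for x
  have "bij_betw \<pi> D D'" "bij_betw \<pi> (W - D) (W - D')"
    using assms(2) bij_betw_cong[of D \<pi> f D'] assms(4)
      bij_betw_cong[of "W - D" \<pi> h "W - D'"] h by (auto simp: \<pi>_def)
  then have "bij_betw \<pi> (D \<union> (W - D)) (D' \<union> (W - D'))"
    by (rule bij_betw_combine) auto
  moreover have "D \<union> (W - D) = W" "D' \<union> (W - D') = W" using assms by blast+
  ultimately have "\<pi> permutes W"
    by (intro bij_imp_permutes) (use assms in \<open>auto simp: \<pi>_def\<close>)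
  then show thesis using that by (simp add: \<pi>_def)
qed

lemma not_successivelyE:
  assumes "\<not> successively P w"
  obtains u l m v where "w = u @ l # m # v" "\<not> P l m"
  using assms
proof (induction w arbitrary: thesis)
  case (Cons l w)
  show ?case
  proof (cases "successively P w")
    case True
    then obtain m v where "w = m # v" "\<not> P l m"
      using Cons.prems(2) by (cases w) auto
    then show thesis using Cons.prems(1)[of "[]"] by simp
  next
    case False
    then show thesis using Cons.IH Cons.prems(1) by (metis append_Cons)
  qed
qed simp

text \<open>
  A finite substitute for the free group: multiplication on reduced words of length at most \<open>n\<close>,
  where defined, is a partial bijection, and partial bijections extend to permutations.
\<close>

lemma finite_free_action:
  fixes L :: "'l set" and \<iota> :: "'l \<Rightarrow> 'l"
  assumes fin: "finite L"
    and \<iota>: "\<And>l. l \<in> L \<Longrightarrow> \<iota> l \<in> L \<and> \<iota> (\<iota> l) = l \<and> (pos (\<iota> l) \<longleftrightarrow> \<not> pos l)"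
  shows "\<exists>(S :: ('l list \<Rightarrow> 'l list) set) \<rho>. finite S \<and> S \<noteq> {} \<and>
    (\<forall>l \<in> L. \<forall>s \<in> S. \<rho> l s \<in> S \<and> \<rho> (\<iota> l) (\<rho> l s) = s) \<and>
    (\<forall>w s. set w \<subseteq> L \<longrightarrow> w \<noteq> [] \<longrightarrow> length w \<le> n \<longrightarrow> s \<in> S \<longrightarrow> foldr \<rho> w s = s \<longrightarrow>
      (\<exists>u l v. w = u @ l # \<iota> l # v))"
proof -
  define red where "red = successively (\<lambda>l m. m \<noteq> \<iota> l)"
  define W where "W = {w. set w \<subseteq> L \<and> length w \<le> n \<and> red w}"
  \<comment> \<open>The words that left multiplication by \<open>l\<close> keeps within length
    \<open>n\<close>: the shorter ones, and those whose first letter is cancelled.\<close>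
  define D where "D l = {w \<in> W. length w < n \<or> (w \<noteq> [] \<and> hd w = \<iota> l)}" for l
  define f where "f l w = (if w \<noteq> [] \<and> hd w = \<iota> l then tl w else l # w)" for l w
  have red_Cons: "red (l # w) \<longleftrightarrow> red w \<and> (w = [] \<or> hd w \<noteq> \<iota> l)" for l w
    by (cases w) (auto simp: red_def)
  have "finite W"
    by (rule finite_subset[OF _ finite_lists_length_le[OF fin, of n]]) (auto simp: W_def)
  have f_in: "f l w \<in> D (\<iota> l)" if l: "l \<in> L" and w: "w \<in> D l" for l w
    using \<iota>[OF l] w l by (cases w) (auto simp: f_def D_def W_def red_Cons)
  have f_inv: "f (\<iota> l) (f l w) = w" if l: "l \<in> L" and w: "w \<in> D l" for l w
    using \<iota>[OF l] w l by (cases w) (auto simp: f_def D_def W_def red_Cons)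
  have bij: "bij_betw (f l) (D l) (D (\<iota> l))" if l: "l \<in> L" for l
    using f_in[OF l] f_inv[OF l] f_in[of "\<iota> l"] f_inv[of "\<iota> l"] \<iota>[OF l]
    by (intro bij_betwI[where g = "f (\<iota> l)"]) auto
  have "\<forall>l \<in> L. \<exists>\<pi>. \<pi> permutes W \<and> (\<forall>w \<in> D l. \<pi> w = f l w)"
  proof
    fix l assume l: "l \<in> L"
    have "D l \<subseteq> W" "D (\<iota> l) \<subseteq> W" by (auto simp: D_def)
    then obtain \<pi> where "\<pi> permutes W" "\<And>w. w \<in> D l \<Longrightarrow> \<pi> w = f l w"
      using extend_partial_bij[OF \<open>finite W\<close> _ _ bij[OF l]] by metis
    then show "\<exists>\<pi>. \<pi> permutes W \<and> (\<forall>w \<in> D l. \<pi> w = f l w)" by metis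
  qed
  then obtain \<tau> where \<tau>: "\<And>l. l \<in> L \<Longrightarrow> \<tau> l permutes W"
    "\<And>l w. l \<in> L \<Longrightarrow> w \<in> D l \<Longrightarrow> \<tau> l w = f l w"
    by metis
  \<comment> \<open>The extensions chosen for \<open>l\<close> and \<open>\<iota> l\<close> need not
    be inverse to each other outside \<open>D l\<close>. So one letter of each pair, selected by
    \<open>pos\<close>, keeps its extension, and the other gets the inverse permutation.\<close>
  define \<sigma> where "\<sigma> l = (if pos l then \<tau> l else inv_into UNIV (\<tau> (\<iota> l)))" for l
  have \<sigma>_perm: "\<sigma> l permutes W" if "l \<in> L" for l
    using \<tau>(1) \<iota> that by (auto simp: \<sigma>_def permutes_inv)
  have \<sigma>_inv: "\<sigma> (\<iota> l) (\<sigma> l w) = w" if "l \<in> L" for l w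
    using \<tau>(1)[of l] \<tau>(1)[of "\<iota> l"] \<iota>[OF that] that
    by (auto simp: \<sigma>_def permutes_inverses)
  have \<sigma>_f: "\<sigma> l w = f l w" if l: "l \<in> L" and w: "w \<in> D l" for l w
  proof (cases "pos l")
    case False
    have "\<tau> (\<iota> l) (f l w) = w"
      using \<tau>(2)[of "\<iota> l" "f l w"] f_in[OF l w] f_inv[OF l w] \<iota>[OF l] by simp
    then have "inv_into UNIV (\<tau> (\<iota> l)) w = f l w"
      using \<tau>(1)[of "\<iota> l"] \<iota>[OF l] by (metis permutes_inverses(2))
    then show ?thesis using False by (simp add: \<sigma>_def)
  qed (use \<tau>(2)[OF l w] in \<open>simp add: \<sigma>_def\<close>)
  \<comment> \<open>The letters act by composition on the permutations of \<open>W\<close> rather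
    than on \<open>W\<close> itself: a word that fixes one permutation is then the identity on all
    of \<open>W\<close>, and for a nonempty reduced word this is refuted by applying it to the empty
    word.\<close>
  define S where "S = {\<pi>. \<pi> permutes W}"
  define \<rho> where "\<rho> l s = \<sigma> l \<circ> s" for l and s :: "'l list \<Rightarrow> 'l list"
  have foldr_\<rho>: "foldr \<rho> w s = foldr \<sigma> w \<circ> s" for w s
    by (induction w) (auto simp: \<rho>_def)
  have foldr_\<sigma>: "foldr \<sigma> w [] = w" if "set w \<subseteq> L" "length w \<le> n" "red w" for w
    using that
  proof (induction w)
    case (Cons l w)
    then have "w \<in> D l" by (auto simp: D_def W_def red_Cons)
    then show ?case using Cons \<sigma>_f[of l w] by (auto simp: red_Cons f_def)
  qed simp
  show ?thesis
  proof (intro exI[of _ S] exI[of _ \<rho>] conjI ballI allI impI)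
    show "finite S" unfolding S_def by (rule finite_permutations[OF \<open>finite W\<close>])
    show "S \<noteq> {}" using permutes_id[of W] unfolding S_def by blast
    show "\<rho> l s \<in> S" if "l \<in> L" "s \<in> S" for l s
      using that \<sigma>_perm by (auto simp: S_def \<rho>_def intro: permutes_compose)
    show "\<rho> (\<iota> l) (\<rho> l s) = s" if "l \<in> L" "s \<in> S" for l s
      using \<sigma>_inv[OF that(1)] by (auto simp: \<rho>_def)
    fix w s assume w: "set w \<subseteq> L" "w \<noteq> []" "length w \<le> n" and s: "s \<in> S" "foldr \<rho> w s = s"
    have "foldr \<sigma> w (s (inv_into UNIV s [])) = s (inv_into UNIV s [])"
      using s(2) foldr_\<rho>[of w s] by (metis comp_apply)
    then have "foldr \<sigma> w [] = []"
      using s(1) by (simp add: S_def permutes_inverses)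
    then have "\<not> red w" using foldr_\<sigma> w by metis
    then show "\<exists>u l v. w = u @ l # \<iota> l # v"
      unfolding red_def by (elim not_successivelyE) blast
  qed
qed

lemma (in group) free_orbit:
  assumes \<theta>: "acts_on G X \<theta>" and x: "x \<in> X"
    and free: "\<forall>g \<in> carrier G. \<forall>x \<in> X. \<theta> g x = x \<longrightarrow> g = \<one>"
  shows "inj_on (\<lambda>g. \<theta> g x) (carrier G)"
    and "(\<lambda>g. \<theta> g x) ` carrier G \<subseteq> X"
    and "acts_on G (X - (\<lambda>g. \<theta> g x) ` carrier G) \<theta>"
proof -
  show "inj_on (\<lambda>g. \<theta> g x) (carrier G)"
  proof (rule inj_onI)
    fix g h assume gh: "g \<in> carrier G" "h \<in> carrier G" "\<theta> g x = \<theta> h x"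
    then have "\<theta> (inv h \<otimes> g) x = x"
      using acts_onD(3)[OF \<theta>] acts_on_inv[OF \<theta>] x by simp
    moreover have "inv h \<otimes> g \<in> carrier G" using gh by simp
    ultimately have "inv h \<otimes> g = \<one>" using free x by metis
    then show "g = h" using gh(1,2) inv_equality[of "inv h" g] inv_inv inv_closed by metis
  qed
  show "(\<lambda>g. \<theta> g x) ` carrier G \<subseteq> X" using acts_onD(1)[OF \<theta>] x by auto
  have "\<theta> g y \<notin> (\<lambda>g. \<theta> g x) ` carrier G"
    if gy: "g \<in> carrier G" "y \<in> X" "y \<notin> (\<lambda>g. \<theta> g x) ` carrier G" for g y
  proof
    assume "\<theta> g y \<in> (\<lambda>g. \<theta> g x) ` carrier G"
    then obtain h where h: "h \<in> carrier G" "\<theta> g y = \<theta> h x" by blast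
    then have "y = \<theta> (inv g \<otimes> h) x"
      using gy acts_onD(3)[OF \<theta>] acts_on_inv(1)[OF \<theta> gy(1,2)] x by simp
    moreover have "inv g \<otimes> h \<in> carrier G" using gy h by simp
    ultimately show False using gy(3) by blast
  qed
  then show "acts_on G (X - (\<lambda>g. \<theta> g x) ` carrier G) \<theta>"
    using acts_onD[OF \<theta>] by (simp add: acts_on_def)
qed

text \<open>Every free orbit is a copy of the regular action, so matching one orbit on each side and
  removing both leaves free actions on smaller sets of equal size.\<close>

lemma (in group) free_actions_isomorphic:
  assumes "finite (carrier G)" "finite P" "finite Q" "card P = card Q"
    and "acts_on G P \<phi>" "acts_on G Q \<psi>"
    and "\<forall>g \<in> carrier G. \<forall>x \<in> P. \<phi> g x = x \<longrightarrow> g = \<one>"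
    and "\<forall>g \<in> carrier G. \<forall>x \<in> Q. \<psi> g x = x \<longrightarrow> g = \<one>"
  shows "\<exists>\<beta>. bij_betw \<beta> P Q \<and> (\<forall>g \<in> carrier G. \<forall>x \<in> P. \<beta> (\<phi> g x) = \<psi> g (\<beta> x))"
  using assms(2-)
proof (induction "card P" arbitrary: P Q rule: less_induct)
  case less
  show ?case
  proof (cases "P = {}")
    case True
    then show ?thesis using less.prems(2,3) by (auto intro: bij_betwI)
  next
    case False
    then obtain p where p: "p \<in> P" by blast
    then have "Q \<noteq> {}" using less.prems(1,3) by force
    then obtain q where q: "q \<in> Q" by blast
    let ?O = "(\<lambda>g. \<phi> g p) ` carrier G" and ?O' = "(\<lambda>g. \<psi> g q) ` carrier G"
    note op = free_orbit[OF less.prems(4) p less.prems(6)] and oq = free_orbit[OF less.prems(5) q less.prems(7)]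
    have cards: "card ?O = card (carrier G)" "card ?O' = card (carrier G)"
      using op(1) oq(1) by (simp_all add: card_image)
    have "p \<in> ?O"
      using image_eqI[of p "\<lambda>g. \<phi> g p" \<one> "carrier G"] acts_onD(2)[OF less.prems(4) p] by simp
    then have "P - ?O \<subset> P" using p by blast
    then have lt: "card (P - ?O) < card P" using less.prems(1) by (rule psubset_card_mono[rotated])
    have eq: "card (P - ?O) = card (Q - ?O')"
      using op(2) oq(2) less.prems(1-3) cards assms(1) by (simp add: card_Diff_subset)
    have free: "\<forall>g \<in> carrier G. \<forall>x \<in> P - ?O. \<phi> g x = x \<longrightarrow> g = \<one>"
      "\<forall>g \<in> carrier G. \<forall>x \<in> Q - ?O'. \<psi> g x = x \<longrightarrow> g = \<one>"
      using less.prems(6,7) by (metis DiffD1)+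
    obtain \<beta> where \<beta>: "bij_betw \<beta> (P - ?O) (Q - ?O')"
      "\<And>g x. g \<in> carrier G \<Longrightarrow> x \<in> P - ?O \<Longrightarrow> \<beta> (\<phi> g x) = \<psi> g (\<beta> x)"
      using less.hyps[OF lt finite_Diff[OF less.prems(1)] finite_Diff[OF less.prems(2)] eq op(3) oq(3) free]
      by metis
    \<comment> \<open>On the chosen orbits the base point \<open>p\<close> goes to \<open>q\<close>;
      by freeness the group element that leads from \<open>p\<close> to a given point is
      unique.\<close>
    define \<gamma> where "\<gamma> x = (if x \<in> ?O then \<psi> (inv_into (carrier G) (\<lambda>g. \<phi> g p) x) q else \<beta> x)" for x
    have \<gamma>_orbit: "\<gamma> (\<phi> g p) = \<psi> g q" if "g \<in> carrier G" for g
      using inv_into_f_f[OF op(1) that] that by (simp add: \<gamma>_def)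
    have "bij_betw \<gamma> ?O ?O'"
    proof (rule bij_betwI')
      show "\<gamma> x = \<gamma> y \<longleftrightarrow> x = y" if "x \<in> ?O" "y \<in> ?O" for x y
      proof -
        obtain g h where gh: "g \<in> carrier G" "h \<in> carrier G" "x = \<phi> g p" "y = \<phi> h p"
          using \<open>x \<in> ?O\<close> \<open>y \<in> ?O\<close> by blast
        then show ?thesis
          using \<gamma>_orbit inj_on_eq_iff[OF oq(1) gh(1,2)] inj_on_eq_iff[OF op(1) gh(1,2)] by simp
      qed
      show "\<gamma> x \<in> ?O'" if "x \<in> ?O" for x using that \<gamma>_orbit by auto
      show "\<exists>x \<in> ?O. y = \<gamma> x" if "y \<in> ?O'" for y using that \<gamma>_orbit by auto
    qed
    moreover have "bij_betw \<gamma> (P - ?O) (Q - ?O')"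
      using bij_betw_cong[of "P - ?O" \<gamma> \<beta> "Q - ?O'"] \<beta>(1) by (simp add: \<gamma>_def)
    ultimately have "bij_betw \<gamma> (?O \<union> (P - ?O)) (?O' \<union> (Q - ?O'))"
      by (rule bij_betw_combine) auto
    moreover have "?O \<union> (P - ?O) = P" "?O' \<union> (Q - ?O') = Q" using op(2) oq(2) by blast+
    moreover have "\<gamma> (\<phi> g x) = \<psi> g (\<gamma> x)" if g: "g \<in> carrier G" and x: "x \<in> P" for g x
    proof (cases "x \<in> ?O")
      case True
      then obtain h where h: "h \<in> carrier G" "x = \<phi> h p" by blast
      then have "\<phi> g x = \<phi> (g \<otimes> h) p" "\<psi> g (\<psi> h q) = \<psi> (g \<otimes> h) q"
        using acts_onD(3)[OF less.prems(4)] acts_onD(3)[OF less.prems(5)] g p q by simp_all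
      then show ?thesis using \<gamma>_orbit g h by simp
    next
      case False
      then have "\<phi> g x \<notin> ?O" using acts_onD(1)[OF op(3) g] x by blast
      then show ?thesis using False \<beta>(2)[OF g] x by (simp add: \<gamma>_def)
    qed
    ultimately show ?thesis by metis
  qed
qed

text \<open>The quotient is the full symmetric group of \<open>Y\<close>, its permutations numbered
  by \<open>e\<close> because the target has to be a \<open>nat monoid\<close>. The action
  \<open>\<chi>\<close> is kept so that arbitrary conjugators in \<open>P\<close>, also those
  outside the image of \<open>G\<close>, can be applied to points of \<open>Y\<close>.\<close>

lemma (in group) action_quotient:
  assumes Y: "finite Y" and \<psi>: "acts_on G Y \<psi>"
  shows "\<exists>(P :: nat monoid) \<Phi> \<chi>. group P \<and> finite (carrier P) \<and> \<Phi> \<in> hom G P \<and> acts_on P Y \<chi> \<and>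
    (\<forall>g \<in> carrier G. \<forall>y \<in> Y. \<chi> (\<Phi> g) y = \<psi> g y)"
proof -
  define S where "S = {\<pi>. \<pi> permutes Y}"
  have "finite S" unfolding S_def by (rule finite_permutations[OF Y])
  then obtain e :: "_ \<Rightarrow> nat" where e: "bij_betw e S {0..<card S}"
    using ex_bij_betw_finite_nat by blast
  define d where "d = inv_into S e"
  define P where "P = \<lparr>carrier = {0..<card S}, monoid.mult = (\<lambda>i j. e (d i \<circ> d j)), monoid.one = e id\<rparr>"
  have e_in: "e \<pi> \<in> carrier P" "d (e \<pi>) = \<pi>" if "\<pi> \<in> S" for \<pi>
    using e that bij_betwE[OF e] by (auto simp: d_def P_def bij_betw_def)
  have d_in: "d i \<in> S" "e (d i) = i" if "i \<in> carrier P" for i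
    using e that by (auto simp: d_def P_def bij_betw_def inv_into_into f_inv_into_f)
  have S_id: "id \<in> S" using permutes_id by (simp add: S_def id_def)
  have S_comp: "\<pi> \<circ> \<tau> \<in> S" if "\<pi> \<in> S" "\<tau> \<in> S" for \<pi> \<tau>
    using that permutes_compose by (simp add: S_def)
  have P_mult: "i \<otimes>\<^bsub>P\<^esub> j = e (d i \<circ> d j)" and P_one: "\<one>\<^bsub>P\<^esub> = e id" for i j
    by (simp_all add: P_def)
  have "group P"
  proof (rule groupI)
    fix i assume i: "i \<in> carrier P"
    have "inv_into UNIV (d i) \<in> S" using d_in(1)[OF i] permutes_inv by (simp add: S_def)
    moreover have "inv_into UNIV (d i) \<circ> d i = id"
      using d_in(1)[OF i] permutes_inv_o(2) by (simp add: S_def)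
    ultimately show "\<exists>j \<in> carrier P. j \<otimes>\<^bsub>P\<^esub> i = \<one>\<^bsub>P\<^esub>"
      using e_in by (intro bexI[of _ "e (inv_into UNIV (d i))"]) (simp_all add: P_mult P_one)
  qed (simp_all add: P_mult P_one e_in d_in S_comp S_id comp_assoc)
  define \<Psi> where "\<Psi> g y = (if y \<in> Y then \<psi> g y else y)" for g y
  have \<Psi>_in: "\<Psi> g \<in> S" if g: "g \<in> carrier G" for g
  proof -
    have "bij_betw (\<psi> g) Y Y"
      using acts_onD(1)[OF \<psi>] acts_on_inv[OF \<psi>] g
      by (intro bij_betwI[where g = "\<psi> (inv g)"]) simp_all
    then have "bij_betw (\<Psi> g) Y Y"
      using bij_betw_cong[of Y "\<Psi> g" "\<psi> g" Y] by (simp add: \<Psi>_def)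
    then show ?thesis
      unfolding S_def using bij_imp_permutes[of "\<Psi> g" Y] by (simp add: \<Psi>_def)
  qed
  have \<Psi>_mult: "\<Psi> (g \<otimes> h) = \<Psi> g \<circ> \<Psi> h" if "g \<in> carrier G" "h \<in> carrier G" for g h
    using acts_onD(1,3)[OF \<psi>] that by (simp add: \<Psi>_def fun_eq_iff)
  have "(\<lambda>g. e (\<Psi> g)) \<in> hom G P"
    using \<Psi>_in \<Psi>_mult e_in by (intro homI) (simp_all add: P_mult)
  moreover have "d i y \<in> Y" if "i \<in> carrier P" "y \<in> Y" for i y
    using d_in(1)[OF that(1)] that(2) permutes_in_image[of "d i" Y y] by (simp add: S_def)
  then have "acts_on P Y d"
    using d_in(1) e_in(2) S_id S_comp
    by (simp add: acts_on_def P_mult P_one S_def)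
  moreover have "d (e (\<Psi> g)) y = \<psi> g y" if "g \<in> carrier G" "y \<in> Y" for g y
    using e_in(2)[OF \<Psi>_in[OF that(1)]] that(2) by (simp add: \<Psi>_def)
  moreover have "finite (carrier P)" by (simp add: P_def)
  ultimately show ?thesis using \<open>group P\<close> by blast
qed

section \<open>Cosets and conjugates\<close>

context group
begin

lemma conjugate_image:
  "g <# H #> inv g = (\<lambda>h. g \<otimes> h \<otimes> inv g) ` H"
  unfolding l_coset_def r_coset_def by (rule subset_antisym) auto

lemma mem_conjugate_iff:
  assumes "subgroup H G" "g \<in> carrier G" "x \<in> carrier G"
  shows "x \<in> g <# H #> inv g \<longleftrightarrow> inv g \<otimes> x \<otimes> g \<in> H"
proof
  assume "x \<in> g <# H #> inv g"
  then obtain h where h: "h \<in> H" "x = g \<otimes> h \<otimes> inv g" unfolding conjugate_image by blast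
  then have "h \<in> carrier G" using subgroup.mem_carrier[OF assms(1)] by simp
  then have "inv g \<otimes> x \<otimes> g = h"
    using h(2) assms(2) m_assoc[of "inv g" g h, symmetric] by (simp add: m_assoc)
  then show "inv g \<otimes> x \<otimes> g \<in> H" using h(1) by simp
next
  assume h: "inv g \<otimes> x \<otimes> g \<in> H"
  have "g \<otimes> (inv g \<otimes> x \<otimes> g) \<otimes> inv g = x"
    using assms(2,3) m_assoc[of g "inv g" x, symmetric] by (simp add: m_assoc)
  then show "x \<in> g <# H #> inv g" unfolding conjugate_image using h by (metis image_eqI)
qed

lemma l_coset_eq_self_iff:
  assumes "subgroup H G" "g \<in> carrier G"
  shows "g <# H = H \<longleftrightarrow> g \<in> H"
proof
  assume eq: "g <# H = H"
  have "g \<otimes> \<one> \<in> g <# H"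
    using subgroup.one_closed[OF assms(1)] unfolding l_coset_def by blast
  then show "g \<in> H" using eq assms(2) by simp
qed (rule coset_join3[OF assms(2,1)])

lemma acts_on_cosets:
  assumes "subgroup H G"
  shows "acts_on G ((\<lambda>g. g <# H) ` carrier G) (\<lambda>g S. g <# S)"
proof -
  have H: "H \<subseteq> carrier G" using subgroup.subset[OF assms] .
  show ?thesis
    unfolding acts_on_def
    using H by (auto simp: lcos_m_assoc lcos_mult_one l_coset_subset_G m_assoc)
qed

text \<open>\<open>N\<close> is covered by finitely many finite cosets. Applied to a finite subgroup
  and its normalizer, this turns finite index into finiteness of the normalizer.\<close>

lemma finite_subgroup_of_finite_rcosets:
  assumes "finite H" "\<one> \<in> H" "H \<subseteq> carrier G" "N \<subseteq> carrier G"
    and "finite (rcosets\<^bsub>G\<lparr>carrier := N\<rparr>\<^esub> H)"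
  shows "finite N"
proof -
  let ?R = "rcosets\<^bsub>G\<lparr>carrier := N\<rparr>\<^esub> H"
  have R: "?R = (\<lambda>g. (\<lambda>h. h \<otimes> g) ` H) ` N"
    by (simp add: RCOSETS_def r_coset_def UNION_singleton_eq_range)
  have "finite (\<Union> ?R)"
    using assms(5) by (rule finite_Union) (auto simp: R assms(1))
  moreover have "N \<subseteq> \<Union> ?R"
  proof
    fix g assume g: "g \<in> N"
    then have "\<one> \<otimes> g = g" using assms(4) by (simp add: subsetD)
    then have "g \<in> (\<lambda>h. h \<otimes> g) ` H" using assms(2) by (metis image_eqI)
    then show "g \<in> \<Union> ?R" using g unfolding R by blast
  qed
  ultimately show ?thesis by (rule finite_subset[rotated])
qed

text \<open>What commutes with \<open>c\<close> commutes with every element of the cyclic group that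
  \<open>c\<close> generates. Through this inclusion the normalizer condition yields finite
  centralizers, the form in which it is used.\<close>

lemma centralizer_subset_normalizer:
  assumes "c \<in> carrier G"
  shows "{g \<in> carrier G. g \<otimes> c = c \<otimes> g} \<subseteq> normalizer G (generate G {c})"
proof
  let ?E = "generate G {c}"
  fix g assume "g \<in> {g \<in> carrier G. g \<otimes> c = c \<otimes> g}"
  then have g: "g \<in> carrier G" "g \<otimes> c = c \<otimes> g" by auto
  have EG: "?E \<subseteq> carrier G" using generate_incl[of "{c}"] assms by simp
  have comm: "h \<in> carrier G \<and> g \<otimes> h = h \<otimes> g" if "h \<in> ?E" for h
    using that
  proof (induction rule: generate.induct)
    case one
    then show ?case using g by simp
  next
    case (incl h)
    then show ?case using g assms by simp
  next
    case (inv h)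
    then have "h = c" by simp
    have "inv c \<otimes> (g \<otimes> c) \<otimes> inv c = inv c \<otimes> (c \<otimes> g) \<otimes> inv c" using g(2) by simp
    moreover have "inv c \<otimes> (g \<otimes> c) \<otimes> inv c = inv c \<otimes> g"
      using g(1) assms by (simp add: m_assoc)
    moreover have "inv c \<otimes> (c \<otimes> g) \<otimes> inv c = g \<otimes> inv c"
      using g(1) assms m_assoc[of "inv c" c g, symmetric] by simp
    ultimately show ?case using \<open>h = c\<close> assms by simp
  next
    case (eng h1 h2)
    then have "g \<otimes> (h1 \<otimes> h2) = (h1 \<otimes> g) \<otimes> h2" using g(1) m_assoc[of g h1 h2] by simp
    also have "\<dots> = (h1 \<otimes> h2) \<otimes> g" using eng g(1) by (simp add: m_assoc)
    finally show ?case using eng by simp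
  qed
  have "g \<otimes> h \<otimes> inv g = h" if "h \<in> ?E" for h
    using comm[OF that] g(1) by (simp add: m_assoc)
  then have "(\<lambda>h. g \<otimes> h \<otimes> inv g) ` ?E = (\<lambda>h. h) ` ?E" by (intro image_cong) simp_all
  then have "g <# ?E #> inv g = ?E" by (simp add: conjugate_image)
  then show "g \<in> normalizer G ?E"
    using g(1) EG by (simp add: normalizer_def stabilizer_def)
qed

lemma conjugate_conjugate:
  assumes "H \<subseteq> carrier G" "a \<in> carrier G" "b \<in> carrier G"
  shows "a <# (b <# H #> inv b) #> inv a = (a \<otimes> b) <# H #> inv (a \<otimes> b)"
  unfolding conjugate_image image_image
  using assms by (intro image_cong) (auto simp: m_assoc inv_mult_group subsetD)

lemma conjugate_subsets_sym:
  assumes "conjugate_subsets G H K" "H \<subseteq> carrier G" shows "conjugate_subsets G K H"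
proof -
  obtain g where g: "g \<in> carrier G" "K = g <# H #> inv g"
    using assms(1) unfolding conjugate_subsets_def by blast
  have "inv g <# K #> inv (inv g) = (inv g \<otimes> g) <# H #> inv (inv g \<otimes> g)"
    unfolding g(2) using g(1) assms(2) by (intro conjugate_conjugate) simp_all
  also have "\<dots> = (\<lambda>h. h) ` H"
    unfolding conjugate_image using g(1) assms(2) by (intro image_cong) (auto simp: subsetD)
  finally have "H = inv g <# K #> inv (inv g)" by simp
  then show ?thesis using g(1) unfolding conjugate_subsets_def by (metis inv_closed)
qed

end

section \<open>Rooted trees of groups\<close>

text \<open>
  The elements of the fundamental group are sets of words; extensionality must not be used on them.
\<close>

declare subset_antisym [rule del] equalityCE [rule del]

type_synonym ('v, 'e, 'g) elt = "('v, 'e, 'g) letter list set"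

text \<open>\<open>Inl (x, i)\<close> is the point \<open>x\<close> in the \<open>i\<close>-th copy
  of a piece of the old action; \<open>Inr (g, i)\<close> is the element \<open>g\<close> of the
  \<open>i\<close>-th free orbit added to it.\<close>

type_synonym ('x, 'v, 'e, 'g) piece = "'x \<times> nat + ('v, 'e, 'g) elt \<times> nat"

text \<open>The tree enters through this parent structure: \<open>rank\<close> supports induction
  towards the root, and by \<open>arcs_pe\<close> agreement along the parent edges is agreement
  along all arcs.\<close>

locale rooted_tree_of_groups =
  fixes \<G> :: "('v, 'e, 'g, 'h) graph_of_groups"
    and r :: 'v and par :: "'v \<Rightarrow> 'v" and rank :: "'v \<Rightarrow> nat" and pe :: "'v \<Rightarrow> 'e"
  assumes gog: "graph_of_groups \<G>"
    and root: "r \<in> verts (shape \<G>)"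
    and par: "\<And>v. v \<in> verts (shape \<G>) \<Longrightarrow> v \<noteq> r \<Longrightarrow> par v \<in> verts (shape \<G>) \<and> rank (par v) < rank v"
    and pe: "\<And>v. v \<in> verts (shape \<G>) \<Longrightarrow> v \<noteq> r \<Longrightarrow>
      pe v \<in> arcs (shape \<G>) \<and> tail (shape \<G>) (pe v) = par v \<and> head (shape \<G>) (pe v) = v"
    and arcs_pe: "\<And>e. e \<in> arcs (shape \<G>) \<Longrightarrow>
      \<exists>v \<in> verts (shape \<G>). v \<noteq> r \<and> (e = pe v \<or> e = edge_inv \<G> (pe v))"
    and finite_verts: "finite (verts (shape \<G>))"
    and finite_vertex_group: "\<And>v. v \<in> verts (shape \<G>) \<Longrightarrow> finite (carrier (vertex_group \<G> v))"
begin

abbreviation V :: "'v set" where "V \<equiv> verts (shape \<G>)"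

abbreviation G :: "('v, 'e, 'g) elt monoid" where
  "G \<equiv> fundamental_group \<G> (arcs (shape \<G>))"

abbreviation emb :: "'v \<Rightarrow> 'g \<Rightarrow> ('v, 'e, 'g) elt" where
  "emb \<equiv> vertex_embedding \<G> (arcs (shape \<G>))"

abbreviation mult_G :: "('v, 'e, 'g) elt \<Rightarrow> ('v, 'e, 'g) elt \<Rightarrow> ('v, 'e, 'g) elt" (infixl \<open>\<cdot>\<close> 70) where
  "x \<cdot> y \<equiv> x \<otimes>\<^bsub>G\<^esub> y"

definition A :: "'v \<Rightarrow> ('v, 'e, 'g) elt set" where
  "A v = emb v ` carrier (vertex_group \<G> v)"

definition C :: "'v \<Rightarrow> ('v, 'e, 'g) elt set" where
  "C v = edge_subgroup \<G> (arcs (shape \<G>)) (pe v)"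

abbreviation (input) gens :: "('v, 'e, 'g) letter set" where
  "gens \<equiv> gog_letters \<G>"

abbreviation (input) rels :: "(('v, 'e, 'g) letter list \<times> ('v, 'e, 'g) letter list) set" where
  "rels \<equiv> gog_relations \<G> (arcs (shape \<G>))"

section \<open>Relations between letters, and the vertex and edge subgroups\<close>

lemma Vert_in_gens: "v \<in> V \<Longrightarrow> g \<in> carrier (vertex_group \<G> v) \<Longrightarrow> Vert v g \<in> gens"
  and Edge_in_gens: "e \<in> arcs (shape \<G>) \<Longrightarrow> Edge e \<in> gens"
  by (auto simp: gog_letters_def)

lemma pres_eq_relI: "(x, y) \<in> rels \<Longrightarrow> x \<in> lists gens \<Longrightarrow> y \<in> lists gens \<Longrightarrow> (x, y) \<in> pres_eq gens rels"
  using pres_rel[of x y rels "[]" "[]" gens] by simp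

lemma
  shows group_vertex: "v \<in> V \<Longrightarrow> group (vertex_group \<G> v)"
    and group_edge: "e \<in> arcs (shape \<G>) \<Longrightarrow> group (edge_group \<G> e)"
    and bd_i_mon: "e \<in> arcs (shape \<G>) \<Longrightarrow>
      bd_i \<G> e \<in> mon (edge_group \<G> e) (vertex_group \<G> (tail (shape \<G>) e))"
    and bd_t_mon: "e \<in> arcs (shape \<G>) \<Longrightarrow>
      bd_t \<G> e \<in> mon (edge_group \<G> e) (vertex_group \<G> (head (shape \<G>) e))"
    and edge_inv_arcs: "e \<in> arcs (shape \<G>) \<Longrightarrow> edge_inv \<G> e \<in> arcs (shape \<G>)"
    and bd_i_eq_bd_t_inv: "e \<in> arcs (shape \<G>) \<Longrightarrow> h \<in> carrier (edge_group \<G> e) \<Longrightarrow>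
      bd_i \<G> e h = bd_t \<G> (edge_inv \<G> e) h"
    and edge_group_inv: "e \<in> arcs (shape \<G>) \<Longrightarrow> edge_group \<G> (edge_inv \<G> e) = edge_group \<G> e"
  using gog bidirected_digraph.arev_in_arcs[OF graph_of_groups.bidirected_shape[OF gog]]
  unfolding graph_of_groups_def by blast+

lemma edge_inv_inv: "edge_inv \<G> (edge_inv \<G> e) = e"
  using bidirected_digraph.arev_arev[OF graph_of_groups.bidirected_shape[OF gog]] .

lemma bd_t_eq_bd_i_inv:
  assumes "e \<in> arcs (shape \<G>)" "h \<in> carrier (edge_group \<G> e)"
  shows "bd_i \<G> (edge_inv \<G> e) h = bd_t \<G> e h"
  using bd_i_eq_bd_t_inv[of "edge_inv \<G> e" h] assms edge_inv_arcs edge_group_inv edge_inv_inv by metis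

lemma tail_head_edge_inv:
  assumes "e \<in> arcs (shape \<G>)"
  shows "tail (shape \<G>) (edge_inv \<G> e) = head (shape \<G>) e"
    and "head (shape \<G>) (edge_inv \<G> e) = tail (shape \<G>) e"
  using bidirected_digraph.tail_arev bidirected_digraph.head_arev
    graph_of_groups.bidirected_shape[OF gog] assms by metis+

lemma tail_head_in_V:
  assumes "e \<in> arcs (shape \<G>)"
  shows "tail (shape \<G>) e \<in> V" and "head (shape \<G>) e \<in> V"
  using graph_of_groups.bidirected_shape[OF gog] assms
  unfolding bidirected_digraph_def wf_digraph_def by blast+

lemma bd_in_vertex_group:
  assumes "e \<in> arcs (shape \<G>)" "h \<in> carrier (edge_group \<G> e)"
  shows "bd_i \<G> e h \<in> carrier (vertex_group \<G> (tail (shape \<G>) e))"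
    and "bd_t \<G> e h \<in> carrier (vertex_group \<G> (head (shape \<G>) e))"
  using bd_i_mon[OF assms(1)] bd_t_mon[OF assms(1)] assms(2) by (auto simp: mon_def hom_def)

lemma Edge_trivial:
  assumes "e \<in> arcs (shape \<G>)" shows "([Edge e], []) \<in> pres_eq gens rels"
  using assms by (intro pres_eq_relI) (auto simp: gog_relations_def Edge_in_gens)

lemma Vert_one:
  assumes "v \<in> V" shows "([Vert v \<one>\<^bsub>vertex_group \<G> v\<^esub>], []) \<in> pres_eq gens rels"
proof -
  interpret group "vertex_group \<G> v" by (rule group_vertex[OF assms])
  show ?thesis
    using assms by (intro pres_eq_relI) (auto simp: gog_relations_def Vert_in_gens)
qed

lemma Vert_mult:
  assumes "v \<in> V" "x \<in> carrier (vertex_group \<G> v)" "y \<in> carrier (vertex_group \<G> v)"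
  shows "([Vert v x, Vert v y], [Vert v (x \<otimes>\<^bsub>vertex_group \<G> v\<^esub> y)]) \<in> pres_eq gens rels"
proof -
  interpret group "vertex_group \<G> v" by (rule group_vertex[OF assms(1)])
  show ?thesis
    using assms by (intro pres_eq_relI) (auto simp: gog_relations_def Vert_in_gens)
qed

lemma group_G: "group G"
  unfolding fundamental_group_def
proof (rule group_pres_monoid)
  fix l assume "l \<in> gens"
  then consider v x where "v \<in> V" "x \<in> carrier (vertex_group \<G> v)" "l = Vert v x"
    | e where "e \<in> arcs (shape \<G>)" "l = Edge e"
    by (auto simp: gog_letters_def)
  then show "\<exists>w \<in> lists gens. (w @ [l], []) \<in> pres_eq gens rels"
  proof cases
    case 1
    interpret group "vertex_group \<G> v" by (rule group_vertex[OF 1(1)])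
    have "([Vert v (inv\<^bsub>vertex_group \<G> v\<^esub> x), Vert v x], []) \<in> pres_eq gens rels"
      using Vert_mult[of v "inv\<^bsub>vertex_group \<G> v\<^esub> x" x] Vert_one[of v] 1 by (auto intro: pres_trans)
    then show ?thesis
      using 1 Vert_in_gens by (intro bexI[of _ "[Vert v (inv\<^bsub>vertex_group \<G> v\<^esub> x)]"]) auto
  next
    case 2
    then show ?thesis using Edge_trivial by (intro bexI[of _ "[]"]) auto
  qed
qed

sublocale G: group G
  by (rule group_G)

lemma emb_in_G: "v \<in> V \<Longrightarrow> x \<in> carrier (vertex_group \<G> v) \<Longrightarrow> emb v x \<in> carrier G"
  unfolding fundamental_group_def vertex_embedding_def
  by (rule pres_class_in_carrier) (simp add: Vert_in_gens)

lemma emb_hom: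
  assumes "v \<in> V" shows "emb v \<in> hom (vertex_group \<G> v) G"
proof (rule homI)
  interpret group "vertex_group \<G> v" by (rule group_vertex[OF assms])
  fix x y assume xy: "x \<in> carrier (vertex_group \<G> v)" "y \<in> carrier (vertex_group \<G> v)"
  show "emb v (x \<otimes>\<^bsub>vertex_group \<G> v\<^esub> y) = emb v x \<cdot> emb v y"
    using Vert_mult[OF assms xy] assms xy
    by (simp add: vertex_embedding_def fundamental_group_def pres_class_mult Vert_in_gens
        pres_class_eq_iff pres_sym)
qed (use assms emb_in_G in blast)

lemma A_subgroup:
  assumes "v \<in> V" shows "subgroup (A v) G"
proof -
  interpret h: group_hom "vertex_group \<G> v" G "emb v"
    using emb_hom[OF assms] group_vertex[OF assms] G.group_axioms
    by (simp add: group_hom_def group_hom_axioms_def)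
  show ?thesis unfolding A_def using h.img_is_subgroup by simp
qed

lemma finite_A: "v \<in> V \<Longrightarrow> finite (A v)"
  unfolding A_def using finite_vertex_group by simp

lemma A_in_G: "v \<in> V \<Longrightarrow> a \<in> A v \<Longrightarrow> a \<in> carrier G"
  using A_subgroup subgroup.mem_carrier by metis

text \<open>Since both edge letters are trivial, the conjugation relation degenerates to an
  identification of the two images of \<open>h\<close>. This is why \<open>C v\<close> lies in both
  adjacent vertex groups.\<close>

lemma emb_edge:
  assumes "e \<in> arcs (shape \<G>)" "h \<in> carrier (edge_group \<G> e)"
  shows "emb (tail (shape \<G>) e) (bd_i \<G> e h) = emb (head (shape \<G>) e) (bd_t \<G> e h)"
proof -
  let ?t = "Vert (head (shape \<G>) e) (bd_t \<G> e h)" and ?i = "Vert (tail (shape \<G>) e) (bd_i \<G> e h)"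
  have g: "?t \<in> gens" "?i \<in> gens" "Edge e \<in> gens" "Edge (edge_inv \<G> e) \<in> gens"
    using assms bd_in_vertex_group tail_head_in_V edge_inv_arcs
    by (auto intro!: Vert_in_gens Edge_in_gens)
  have "([Edge e, ?t, Edge (edge_inv \<G> e)], [?i]) \<in> pres_eq gens rels"
    using assms g by (intro pres_eq_relI) (auto simp: gog_relations_def)
  moreover have "([Edge e] @ [?t], [?t]) \<in> pres_eq gens rels"
    using pres_eq_append[OF Edge_trivial[OF assms(1)], of "[]" "[?t]"] g by simp
  then have "([Edge e, ?t, Edge (edge_inv \<G> e)], [?t]) \<in> pres_eq gens rels"
    using pres_eq_append2[OF _ Edge_trivial[OF edge_inv_arcs[OF assms(1)]],
        of "[Edge e] @ [?t]" "[?t]"] by simp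
  ultimately have "([?i], [?t]) \<in> pres_eq gens rels"
    by (meson pres_sym pres_trans)
  then show ?thesis
    using g by (simp add: vertex_embedding_def pres_class_eq_iff)
qed

lemma C_eq:
  assumes "v \<in> V" "v \<noteq> r"
  shows "C v = (\<lambda>h. emb (par v) (bd_i \<G> (pe v) h)) ` carrier (edge_group \<G> (pe v))"
    and "C v = (\<lambda>h. emb v (bd_t \<G> (pe v) h)) ` carrier (edge_group \<G> (pe v))"
proof -
  show "C v = (\<lambda>h. emb (par v) (bd_i \<G> (pe v) h)) ` carrier (edge_group \<G> (pe v))"
    using pe[OF assms] by (simp add: C_def edge_subgroup_def)
  then show "C v = (\<lambda>h. emb v (bd_t \<G> (pe v) h)) ` carrier (edge_group \<G> (pe v))"
    using emb_edge[of "pe v"] pe[OF assms] by auto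
qed

lemma C_subset:
  assumes "v \<in> V" "v \<noteq> r" shows "C v \<subseteq> A (par v)" and "C v \<subseteq> A v"
proof -
  show "C v \<subseteq> A (par v)"
    unfolding C_eq(1)[OF assms] A_def using bd_in_vertex_group(1)[of "pe v"] pe[OF assms] by auto
  show "C v \<subseteq> A v"
    unfolding C_eq(2)[OF assms] A_def using bd_in_vertex_group(2)[of "pe v"] pe[OF assms] by auto
qed

lemma C_subgroup:
  assumes "v \<in> V" "v \<noteq> r" shows "subgroup (C v) G"
proof -
  note p = pe[OF assms]
  have "bd_t \<G> (pe v) \<in> hom (edge_group \<G> (pe v)) (vertex_group \<G> v)"
    using bd_t_mon[of "pe v"] p by (simp add: mon_def)
  then have "(\<lambda>h. emb v (bd_t \<G> (pe v) h)) \<in> hom (edge_group \<G> (pe v)) G"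
    using emb_hom[OF assms(1)] by (simp add: hom_def Pi_iff)
  then interpret h: group_hom "edge_group \<G> (pe v)" G "\<lambda>h. emb v (bd_t \<G> (pe v) h)"
    using group_edge[of "pe v"] p G.group_axioms
    by (simp add: group_hom_def group_hom_axioms_def)
  show ?thesis unfolding C_eq(2)[OF assms] using h.img_is_subgroup by simp
qed

lemma pres_class_Cons:
  assumes "l # w \<in> lists gens"
  shows "pres_eq gens rels `` {l # w} = pres_eq gens rels `` {[l]} \<cdot> pres_eq gens rels `` {w}"
  using assms pres_class_mult[of "[l]" gens w rels] by (simp add: fundamental_group_def)

text \<open>Edge letters represent \<open>1\<close>, so the vertex groups generate \<open>G\<close>,
  even as a monoid.\<close>

lemma G_induct [consumes 1, case_names one mult]:
  assumes "g \<in> carrier G" and "P \<one>\<^bsub>G\<^esub>"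
    and mult: "\<And>v a g. v \<in> V \<Longrightarrow> a \<in> A v \<Longrightarrow> g \<in> carrier G \<Longrightarrow> P g \<Longrightarrow> P (a \<cdot> g)"
  shows "P g"
proof -
  obtain w where w: "w \<in> lists gens" "g = pres_eq gens rels `` {w}"
    using assms(1) unfolding fundamental_group_def by (rule pres_monoid_carrierE)
  have "P (pres_eq gens rels `` {w})"
    using w(1)
  proof (induction w)
    case Nil
    then show ?case using assms(2) by (simp add: fundamental_group_def pres_class_one)
  next
    case (Cons l w)
    have wG: "pres_eq gens rels `` {w} \<in> carrier G"
      unfolding fundamental_group_def using Cons.hyps by (simp add: pres_class_in_carrier)
    from Cons.hyps(1) consider v x where "v \<in> V" "x \<in> carrier (vertex_group \<G> v)" "l = Vert v x"
      | e where "e \<in> arcs (shape \<G>)" "l = Edge e"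
      by (auto simp: gog_letters_def)
    then show ?case
    proof cases
      case 1
      then have "pres_eq gens rels `` {[l]} \<in> A v"
        by (simp add: A_def vertex_embedding_def)
      then show ?thesis
        using mult[OF 1(1) _ wG Cons.IH] Cons.hyps by (subst pres_class_Cons) auto
    next
      case 2
      then have "pres_eq gens rels `` {[l]} = \<one>\<^bsub>G\<^esub>"
        using Edge_trivial[OF 2(1)] Cons.hyps
        by (simp add: fundamental_group_def pres_class_one pres_class_eq_iff)
      then show ?thesis
        using Cons wG by (subst pres_class_Cons) auto
    qed
  qed
  with w show ?thesis by simp
qed

section \<open>Gluing actions of the vertex groups\<close>

primrec letter_action :: "('v \<Rightarrow> ('v, 'e, 'g) elt \<Rightarrow> 'y \<Rightarrow> 'y) \<Rightarrow> ('v, 'e, 'g) letter \<Rightarrow> 'y \<Rightarrow> 'y" where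
  "letter_action \<alpha> (Vert v g) = \<alpha> v (emb v g)"
| "letter_action \<alpha> (Edge e) = id"

text \<open>The universal property of the iterated amalgam, for actions: words act letter by letter,
  and this respects the relations because the vertex actions agree on the edge groups.\<close>

lemma extend_actions:
  fixes \<alpha> :: "'v \<Rightarrow> ('v, 'e, 'g) elt \<Rightarrow> 'y \<Rightarrow> 'y"
  assumes act: "\<And>v. v \<in> V \<Longrightarrow> acts_on (G\<lparr>carrier := A v\<rparr>) Y (\<alpha> v)"
    and agree: "\<And>v c y. v \<in> V \<Longrightarrow> v \<noteq> r \<Longrightarrow> c \<in> C v \<Longrightarrow> y \<in> Y \<Longrightarrow> \<alpha> v c y = \<alpha> (par v) c y"
  shows "\<exists>\<phi>. acts_on G Y \<phi> \<and> (\<forall>v \<in> V. \<forall>a \<in> A v. \<forall>y \<in> Y. \<phi> a y = \<alpha> v a y)"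
proof -
  define wact where "wact = foldr (letter_action \<alpha>)"
  have wact_append: "wact (u @ w) y = wact u (wact w y)" for u w y
    by (simp add: wact_def)
  have Vert_act: "letter_action \<alpha> (Vert v x) y = \<alpha> v (emb v x) y" for v x y by simp
  have letter_in: "letter_action \<alpha> l y \<in> Y" if l: "l \<in> gens" and y: "y \<in> Y" for l y
    using l y acts_onD(1)[OF act] by (fastforce simp: gog_letters_def A_def)
  have wact_in: "wact w y \<in> Y" if "w \<in> lists gens" "y \<in> Y" for w y
    using that by (induction w) (auto simp: wact_def intro: letter_in)
  have edge_agree: "\<alpha> (tail (shape \<G>) e) (emb (tail (shape \<G>) e) (bd_i \<G> e h)) y =
      \<alpha> (head (shape \<G>) e) (emb (head (shape \<G>) e) (bd_t \<G> e h)) y"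
    if e: "e \<in> arcs (shape \<G>)" and h: "h \<in> carrier (edge_group \<G> e)" and y: "y \<in> Y" for e h y
  proof -
    obtain v where v: "v \<in> V" "v \<noteq> r" "e = pe v \<or> e = edge_inv \<G> (pe v)"
      using arcs_pe[OF e] by blast
    note p = pe[OF v(1,2)]
    have h': "h \<in> carrier (edge_group \<G> (pe v))"
      using v(3) h p edge_group_inv by auto
    have "emb v (bd_t \<G> (pe v) h) \<in> C v"
      using h' by (simp add: C_eq(2)[OF v(1,2)])
    then have "\<alpha> v (emb v (bd_t \<G> (pe v) h)) y = \<alpha> (par v) (emb (par v) (bd_i \<G> (pe v) h)) y"
      using agree[OF v(1,2) _ y] emb_edge[of "pe v" h] p h' by simp
    then show ?thesis
      using v(3) p tail_head_edge_inv[of "pe v"] bd_i_eq_bd_t_inv[of "pe v" h]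
        bd_t_eq_bd_i_inv[of "pe v" h] h' by auto
  qed
  have rel: "wact x y = wact x' y" if xx': "(x, x') \<in> rels" and y: "y \<in> Y" for x x' y
  proof -
    from xx' consider
      v where "v \<in> V" "x = [Vert v \<one>\<^bsub>vertex_group \<G> v\<^esub>]" "x' = []"
      | v a b where "v \<in> V" "a \<in> carrier (vertex_group \<G> v)" "b \<in> carrier (vertex_group \<G> v)"
        "x = [Vert v a, Vert v b]" "x' = [Vert v (a \<otimes>\<^bsub>vertex_group \<G> v\<^esub> b)]"
      | e where "x = [Edge e, Edge (edge_inv \<G> e)]" "x' = []"
      | e h where "e \<in> arcs (shape \<G>)" "h \<in> carrier (edge_group \<G> e)"
        "x = [Edge e, Vert (head (shape \<G>) e) (bd_t \<G> e h), Edge (edge_inv \<G> e)]"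
        "x' = [Vert (tail (shape \<G>) e) (bd_i \<G> e h)]"
      | e where "x = [Edge e]" "x' = []"
      unfolding gog_relations_def by blast
    then show ?thesis
    proof cases
      case 1
      interpret group_hom "vertex_group \<G> v" G "emb v"
        using emb_hom[OF 1(1)] group_vertex[OF 1(1)] G.group_axioms
        by (simp add: group_hom_def group_hom_axioms_def)
      show ?thesis using 1 acts_onD(2)[OF act[OF 1(1)] y] by (simp add: wact_def hom_one)
    next
      case 2
      have "emb v (a \<otimes>\<^bsub>vertex_group \<G> v\<^esub> b) = emb v a \<cdot> emb v b"
        using emb_hom[OF 2(1)] 2(2,3) by (auto simp: hom_def)
      then show ?thesis
        using 2 acts_onD(3)[OF act[OF 2(1)] _ _ y, of "emb v a" "emb v b"]
        by (simp add: wact_def A_def)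
    next
      case 4
      then show ?thesis using edge_agree[OF 4(1,2) y] by (simp add: wact_def)
    qed (simp_all add: wact_def)
  qed
  have inv: "\<forall>y \<in> Y. wact x y = wact x' y" if "(x, x') \<in> pres_eq gens rels" for x x'
    using that
  proof (induction rule: pres_eq.induct)
    case (pres_rel l l' u w)
    then show ?case using rel wact_in by (auto simp: wact_append)
  qed auto
  \<comment> \<open>An element of \<open>G\<close> is a class of words; it acts through any
    representative, and by \<open>inv\<close> the choice does not matter on
    \<open>Y\<close>.\<close>
  define \<phi> where "\<phi> X y = wact (SOME w. w \<in> X) y" for X y
  have \<phi>_class: "\<phi> (pres_eq gens rels `` {w}) y = wact w y" if w: "w \<in> lists gens" and y: "y \<in> Y" for w y
  proof -
    have "\<exists>x. x \<in> pres_eq gens rels `` {w}"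
      using w pres_refl by (metis Image_singleton_iff)
    then have "(SOME x. x \<in> pres_eq gens rels `` {w}) \<in> pres_eq gens rels `` {w}"
      by (rule someI_ex)
    then show ?thesis using inv y by (simp add: \<phi>_def)
  qed
  show ?thesis
  proof (intro exI[of _ \<phi>] conjI ballI)
    show "acts_on G Y \<phi>"
      unfolding acts_on_def
    proof (intro conjI ballI)
      fix y assume y: "y \<in> Y"
      show "\<phi> \<one>\<^bsub>G\<^esub> y = y"
        using \<phi>_class[of "[]" y] y by (simp add: fundamental_group_def pres_class_one wact_def)
      fix g assume "g \<in> carrier G"
      then obtain u where u: "u \<in> lists gens" "g = pres_eq gens rels `` {u}"
        unfolding fundamental_group_def by (rule pres_monoid_carrierE)
      show "\<phi> g y \<in> Y"
        using u y \<phi>_class wact_in by simp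
      fix h assume "h \<in> carrier G"
      then obtain w where w: "w \<in> lists gens" "h = pres_eq gens rels `` {w}"
        unfolding fundamental_group_def by (rule pres_monoid_carrierE)
      have "g \<cdot> h = pres_eq gens rels `` {u @ w}"
        unfolding u(2) w(2) fundamental_group_def by (rule pres_class_mult[OF u(1) w(1)])
      then show "\<phi> (g \<cdot> h) y = \<phi> g (\<phi> h y)"
        using u w y \<phi>_class wact_in wact_append by (metis append_in_lists_conv)
    qed
    fix v a y assume v: "v \<in> V" "a \<in> A v" and y: "y \<in> Y"
    then obtain x where "x \<in> carrier (vertex_group \<G> v)" "a = pres_eq gens rels `` {[Vert v x]}"
      by (auto simp: A_def vertex_embedding_def)
    then show "\<phi> a y = \<alpha> v a y"
      using v y \<phi>_class[of "[Vert v x]" y] Vert_in_gens by (simp add: wact_def vertex_embedding_def)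
  qed
qed

end

section \<open>Paths in the tree of groups and twisted actions\<close>

context rooted_tree_of_groups
begin

section \<open>Adjacent vertices and their edge groups\<close>

definition adj :: "'v \<Rightarrow> 'v \<Rightarrow> bool" where
  "adj v w \<longleftrightarrow> v \<in> V \<and> w \<in> V \<and> (v \<noteq> r \<and> par v = w \<or> w \<noteq> r \<and> par w = v)"

text \<open>The group is found at the child. As \<open>rank\<close> excludes that two vertices are
  parents of each other, this is symmetric in adjacent \<open>v\<close> and
  \<open>w\<close>.\<close>

definition E :: "'v \<Rightarrow> 'v \<Rightarrow> ('v, 'e, 'g) elt set" where
  "E v w = (if v \<noteq> r \<and> par v = w then C v else C w)"

lemma adj_in_V: "adj v w \<Longrightarrow> v \<in> V" "adj v w \<Longrightarrow> w \<in> V"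
  by (auto simp: adj_def)

lemma adj_sym: "adj v w \<longleftrightarrow> adj w v"
  by (auto simp: adj_def)

lemma adj_par: "v \<in> V \<Longrightarrow> v \<noteq> r \<Longrightarrow> adj v (par v)" "v \<in> V \<Longrightarrow> v \<noteq> r \<Longrightarrow> adj (par v) v"
  using par by (auto simp: adj_def)

lemma adj_oriented:
  assumes "adj v w" shows "(v \<noteq> r \<and> par v = w) \<longleftrightarrow> \<not> (w \<noteq> r \<and> par w = v)"
  using assms par unfolding adj_def by (metis less_asym')

lemma E_sym: "adj v w \<Longrightarrow> E v w = E w v"
  using adj_oriented by (auto simp: E_def)

lemma E_par: "v \<in> V \<Longrightarrow> v \<noteq> r \<Longrightarrow> E v (par v) = C v" "v \<in> V \<Longrightarrow> v \<noteq> r \<Longrightarrow> E (par v) v = C v"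
  using E_sym adj_par by (auto simp: E_def)

lemma E_subset: "adj v w \<Longrightarrow> E v w \<subseteq> A v" "adj v w \<Longrightarrow> E v w \<subseteq> A w"
proof -
  assume vw: "adj v w"
  then consider "v \<in> V" "v \<noteq> r" "w = par v" | "w \<in> V" "w \<noteq> r" "v = par w"
    unfolding adj_def by blast
  then have "E v w \<subseteq> A v \<and> E v w \<subseteq> A w"
    by cases (simp_all add: E_par C_subset)
  then show "E v w \<subseteq> A v" "E v w \<subseteq> A w" by blast+
qed

lemma E_subgroup: "adj v w \<Longrightarrow> subgroup (E v w) G"
  using C_subgroup unfolding adj_def E_def by auto

lemma E_in_G: "adj v w \<Longrightarrow> c \<in> E v w \<Longrightarrow> c \<in> carrier G"
  using E_subgroup subgroup.mem_carrier by metis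

section \<open>Paths, their values and their crossings\<close>

primrec ev :: "('v \<times> ('v, 'e, 'g) elt) list \<Rightarrow> ('v, 'e, 'g) elt" where
  "ev [] = \<one>\<^bsub>G\<^esub>"
| "ev (x # q) = snd x \<cdot> ev q"

text \<open>Paths start at the root and are recorded with their last step first.\<close>

fun path :: "('v \<times> ('v, 'e, 'g) elt) list \<Rightarrow> bool" where
  "path [] \<longleftrightarrow> False"
| "path [(v, a)] \<longleftrightarrow> v = r \<and> a \<in> A r"
| "path ((w, a) # (v, b) # q) \<longleftrightarrow> adj v w \<and> a \<in> A w \<and> path ((v, b) # q)"

text \<open>An entry \<open>(v, w, g)\<close> records the step from \<open>v\<close> to
  \<open>w\<close> taken when the product so far is \<open>g\<close>. In the Bass-Serre tree, with
  right cosets of the vertex groups as vertices, it is the edge given by the right coset of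
  \<open>E v w\<close> that contains \<open>g\<close>.\<close>

fun crossings :: "('v \<times> ('v, 'e, 'g) elt) list \<Rightarrow> ('v \<times> 'v \<times> ('v, 'e, 'g) elt) list" where
  "crossings ((w, a) # (v, b) # q) = (v, w, ev ((v, b) # q)) # crossings ((v, b) # q)"
| "crossings _ = []"

lemma path_Cons_iff:
  "path ((w, a) # q) \<longleftrightarrow> a \<in> A w \<and> (if q = [] then w = r else adj (fst (hd q)) w \<and> path q)"
  by (cases q) auto

lemma crossings_Cons:
  "q \<noteq> [] \<Longrightarrow> crossings ((w, a) # q) = (fst (hd q), w, ev q) # crossings q"
  by (cases q) auto

lemma path_induct [consumes 1, case_names start step]:
  assumes "path q"
    and "\<And>a. a \<in> A r \<Longrightarrow> P [(r, a)]"
    and "\<And>w a q. path q \<Longrightarrow> adj (fst (hd q)) w \<Longrightarrow> a \<in> A w \<Longrightarrow> P q \<Longrightarrow> P ((w, a) # q)"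
  shows "P q"
  using assms(1)
proof (induction q)
  case (Cons x q)
  then show ?case using assms(2,3) by (cases x) (auto simp: path_Cons_iff split: if_splits)
qed simp

lemma path_in:
  assumes "path q"
  shows path_hd_in_V: "fst (hd q) \<in> V" and path_hd_in_A: "snd (hd q) \<in> A (fst (hd q))"
    and path_ne: "q \<noteq> []" and path_ev_in_G: "ev q \<in> carrier G"
proof -
  have "fst (hd q) \<in> V \<and> snd (hd q) \<in> A (fst (hd q)) \<and> q \<noteq> [] \<and> ev q \<in> carrier G"
    using assms
  proof (induction rule: path_induct)
    case (start a)
    then show ?case using A_in_G[OF root start] root by simp
  next
    case (step w a q)
    then show ?case using A_in_G[of w a] adj_in_V by simp
  qed
  then show "fst (hd q) \<in> V" "snd (hd q) \<in> A (fst (hd q))" "q \<noteq> []" "ev q \<in> carrier G"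
    by simp_all
qed

lemma path_crossings:
  assumes "path q" "(v, w, g) \<in> set (crossings q)"
  shows "adj v w" and "g \<in> carrier G"
  using assms
  by (induction rule: path_induct) (auto simp: crossings_Cons path_ne path_ev_in_G)

text \<open>A further letter from the current vertex group is absorbed into the last step, so the
  path neither grows nor crosses anything new.\<close>

lemma path_extend:
  assumes "path q" "a \<in> A (fst (hd q))"
  shows "\<exists>q'. path q' \<and> fst (hd q') = fst (hd q) \<and> ev q' = a \<cdot> ev q \<and>
    length q' = length q \<and> crossings q' = crossings q"
proof -
  obtain v b q0 where q: "q = (v, b) # q0" using path_ne[OF assms(1)] by (cases q) auto
  have b: "b \<in> A v" "v \<in> V" using path_in[OF assms(1)] q by auto
  have "a \<cdot> b \<in> A v"
    using subgroup.m_closed[OF A_subgroup] b assms(2) q by simp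
  moreover have "ev q0 \<in> carrier G"
    using assms(1) q by (cases "q0 = []") (auto simp: path_Cons_iff intro: path_ev_in_G)
  moreover have "a \<in> carrier G" "b \<in> carrier G" using b assms(2) q A_in_G by auto
  ultimately show ?thesis
    using assms(1) q
    by (intro exI[of _ "(v, a \<cdot> b) # q0"])
      (auto simp: path_Cons_iff G.m_assoc crossings_Cons split: if_splits; cases q0; simp)
qed

lemma A_one: "v \<in> V \<Longrightarrow> \<one>\<^bsub>G\<^esub> \<in> A v"
  using subgroup.one_closed[OF A_subgroup] .

lemma path_cross:
  assumes "path q" "adj (fst (hd q)) w"
  shows "path ((w, \<one>\<^bsub>G\<^esub>) # q)" and "ev ((w, \<one>\<^bsub>G\<^esub>) # q) = ev q"
  using assms adj_in_V[OF assms(2)] by (auto simp: path_Cons_iff path_ne A_one path_ev_in_G)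

lemma path_to_root:
  assumes "path q" shows "\<exists>q'. path q' \<and> fst (hd q') = r \<and> ev q' = ev q"
  using assms
proof (induction "rank (fst (hd q))" arbitrary: q rule: less_induct)
  case less
  show ?case
  proof (cases "fst (hd q) = r")
    case False
    let ?w = "par (fst (hd q))"
    have "rank ?w < rank (fst (hd q))" "adj (fst (hd q)) ?w"
      using par path_hd_in_V[OF less.prems] False adj_par by auto
    then show ?thesis
      using less.hyps[of "(?w, \<one>\<^bsub>G\<^esub>) # q"] path_cross[OF less.prems] by auto
  qed (use less.prems in blast)
qed

lemma path_from_root:
  assumes "path q" "fst (hd q) = r" "v \<in> V"
  shows "\<exists>q'. path q' \<and> fst (hd q') = v \<and> ev q' = ev q"
  using assms(3)
proof (induction "rank v" arbitrary: v rule: less_induct)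
  case less
  show ?case
  proof (cases "v = r")
    case False
    then obtain q' where q': "path q'" "fst (hd q') = par v" "ev q' = ev q"
      using less.hyps[of "par v"] par less.prems by blast
    then have "path ((v, \<one>\<^bsub>G\<^esub>) # q')" "ev ((v, \<one>\<^bsub>G\<^esub>) # q') = ev q'"
      using path_cross[OF q'(1), of v] adj_par(2)[OF less.prems False] by auto
    then show ?thesis using q'(3) by (intro exI[of _ "(v, \<one>\<^bsub>G\<^esub>) # q'"]) simp
  qed (use assms in blast)
qed

text \<open>Steps with the letter \<open>1\<close> change the vertex but not the value. So a path
  can be led over the root to the vertex group that contains the next letter, and finally to
  \<open>v\<close>.\<close>

lemma path_exists:
  assumes "g \<in> carrier G" "v \<in> V"
  obtains q where "path q" "fst (hd q) = v" "ev q = g"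
proof -
  have "\<forall>v \<in> V. \<exists>q. path q \<and> fst (hd q) = v \<and> ev q = g"
    using assms(1)
  proof (induction rule: G_induct)
    case one
    have "path [(r, \<one>\<^bsub>G\<^esub>)]" by (simp add: A_one root)
    then show ?case using path_from_root[of "[(r, \<one>\<^bsub>G\<^esub>)]"] by simp
  next
    case (mult w a g)
    then obtain q where "path q" "fst (hd q) = w" "ev q = g" by blast
    then obtain q' where "path q'" "ev q' = a \<cdot> g"
      using path_extend[of q a] mult(2) by metis
    then show ?case using path_to_root path_from_root by metis
  qed
  then show thesis using that assms(2) by blast
qed

section \<open>Twisted actions\<close>

lemma tree_recursion:
  fixes z :: 'z
  shows "\<exists>f. f r = z \<and> (\<forall>v \<in> V. v \<noteq> r \<longrightarrow> f v = F v (f (par v)))"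
proof -
  \<comment> \<open>The number is fuel: \<open>fn n v\<close> has its final value once
    \<open>n\<close> exceeds \<open>rank v\<close>. The rank is known to drop only inside
    \<open>V\<close>, hence the restriction of \<open>stable\<close> to \<open>V\<close>.\<close>
  define fn where "fn = rec_nat (\<lambda>v. z) (\<lambda>_ f v. if v = r then z else F v (f (par v)))"
  have fn_Suc: "fn (Suc n) v = (if v = r then z else F v (fn n (par v)))" for n v
    by (simp add: fn_def)
  have stable: "fn m v = fn n v" if "v \<in> V" "rank v < m" "rank v < n" for m n v
    using that
  proof (induction m arbitrary: n v)
    case (Suc m)
    then obtain n' where "n = Suc n'" by (cases n) auto
    then show ?case
      using Suc.IH[of "par v" n'] Suc.prems par[of v] by (cases "v = r") (simp_all add: fn_Suc)
  qed simp
  have "fn (Suc (rank v)) v = F v (fn (Suc (rank (par v))) (par v))" if "v \<in> V" "v \<noteq> r" for v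
    using that par[OF that] stable[of "par v" "rank v" "Suc (rank (par v))"] by (simp add: fn_Suc)
  then show ?thesis
    by (intro exI[of _ "\<lambda>v. fn (Suc (rank v)) v"]) (simp add: fn_Suc)
qed

text \<open>\<open>\<psi>\<close> acts on \<open>Y \<times> S\<close> over the action
  \<open>\<phi>\<close> on \<open>Y\<close>. \<open>\<theta> v y\<close> is the coordinate that
  \<open>v\<close> uses on the fibre over \<open>y\<close>: read in the coordinate of
  \<open>v\<close>, elements of \<open>A v\<close> move only the base, and passing to an adjacent
  \<open>w\<close> changes the coordinate by \<open>\<sigma> v w y\<close>. At the root the
  coordinate is the identity.\<close>

definition is_twist :: "'y set \<Rightarrow> (('v, 'e, 'g) elt \<Rightarrow> 'y \<Rightarrow> 'y) \<Rightarrow> 's set \<Rightarrow>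
    ('v \<Rightarrow> 'v \<Rightarrow> 'y \<Rightarrow> 's \<Rightarrow> 's) \<Rightarrow> (('v, 'e, 'g) elt \<Rightarrow> 'y \<times> 's \<Rightarrow> 'y \<times> 's) \<Rightarrow>
    ('v \<Rightarrow> 'y \<Rightarrow> 's \<Rightarrow> 's) \<Rightarrow> bool" where
  "is_twist Y \<phi> S \<sigma> \<psi> \<theta> \<longleftrightarrow>
     acts_on G (Y \<times> S) \<psi> \<and>
     (\<forall>v \<in> V. \<forall>y \<in> Y. bij_betw (\<theta> v y) S S) \<and>
     (\<forall>y s. \<theta> r y s = s) \<and>
     (\<forall>v w. adj v w \<longrightarrow> (\<forall>y \<in> Y. \<forall>s \<in> S. \<theta> w y s = \<sigma> v w y (\<theta> v y s))) \<and>
     (\<forall>g \<in> carrier G. \<forall>y \<in> Y. \<forall>s \<in> S. fst (\<psi> g (y, s)) = \<phi> g y) \<and>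
     (\<forall>v \<in> V. \<forall>a \<in> A v. \<forall>y \<in> Y. \<forall>s \<in> S. \<theta> v (\<phi> a y) (snd (\<psi> a (y, s))) = \<theta> v y s)"

text \<open>In a tree the coordinates are obtained by composing the maps \<open>\<sigma>\<close>
  outward from the root. Each \<open>A v\<close> is made to act on the base alone, in the coordinate
  at \<open>v\<close>. The definitions at \<open>v\<close> and \<open>par v\<close> agree on
  \<open>C v\<close> because by \<open>\<sigma>_E\<close> the change of coordinate is constant along
  orbits of the edge group.\<close>

lemma twist_exists:
  fixes \<sigma> :: "'v \<Rightarrow> 'v \<Rightarrow> 'y \<Rightarrow> 's \<Rightarrow> 's"
  assumes \<phi>: "acts_on G Y \<phi>"
    and \<sigma>_in: "\<And>v w y s. adj v w \<Longrightarrow> y \<in> Y \<Longrightarrow> s \<in> S \<Longrightarrow> \<sigma> v w y s \<in> S"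
    and \<sigma>_inv: "\<And>v w y s. adj v w \<Longrightarrow> y \<in> Y \<Longrightarrow> s \<in> S \<Longrightarrow> \<sigma> w v y (\<sigma> v w y s) = s"
    and \<sigma>_E: "\<And>v w y c. adj v w \<Longrightarrow> y \<in> Y \<Longrightarrow> c \<in> E v w \<Longrightarrow> \<sigma> v w (\<phi> c y) = \<sigma> v w y"
  shows "\<exists>\<psi> \<theta>. is_twist Y \<phi> S \<sigma> \<psi> \<theta>"
proof -
  obtain \<theta> where \<theta>_rec: "\<theta> r = (\<lambda>y s. s)"
    "\<And>v. v \<in> V \<Longrightarrow> v \<noteq> r \<Longrightarrow> \<theta> v = (\<lambda>y s. \<sigma> (par v) v y (\<theta> (par v) y s))"
    using tree_recursion[of "\<lambda>y s. s" "\<lambda>v \<theta> y s. \<sigma> (par v) v y (\<theta> y s)"] by blast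
  have \<theta>_r: "\<theta> r y s = s" for y s by (simp add: \<theta>_rec)
  have \<theta>_par: "\<theta> v y s = \<sigma> (par v) v y (\<theta> (par v) y s)" if "v \<in> V" "v \<noteq> r" for v y s
    using fun_cong[OF fun_cong[OF \<theta>_rec(2)[OF that]]] .
  have \<sigma>_bij: "bij_betw (\<sigma> v w y) S S" if "adj v w" "y \<in> Y" for v w y
    using that \<sigma>_in \<sigma>_inv adj_sym by (intro bij_betwI[where g = "\<sigma> w v y"]) auto
  have \<theta>_bij: "bij_betw (\<theta> v y) S S" if "v \<in> V" "y \<in> Y" for v y
    using that(1)
  proof (induction "rank v" arbitrary: v rule: less_induct)
    case less
    show ?case
    proof (cases "v = r")
      case True
      then show ?thesis using \<theta>_r by (auto intro!: bij_betwI[where g = "\<lambda>s. s"])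
    next
      case False
      then have "bij_betw (\<sigma> (par v) v y \<circ> \<theta> (par v) y) S S"
        using less par \<sigma>_bij[OF adj_par(2)] that(2) by (intro bij_betw_trans) blast+
      moreover have "\<theta> v y = \<sigma> (par v) v y \<circ> \<theta> (par v) y"
        using \<theta>_par less.prems False by auto
      ultimately show ?thesis by simp
    qed
  qed
  have \<theta>_in: "\<theta> v y s \<in> S" if "v \<in> V" "y \<in> Y" "s \<in> S" for v y s
    using \<theta>_bij that bij_betwE by metis
  have \<theta>_adj: "\<theta> w y s = \<sigma> v w y (\<theta> v y s)" if vw: "adj v w" and y: "y \<in> Y" and s: "s \<in> S" for v w y s
  proof (cases "w \<noteq> r \<and> par w = v")
    case False
    then have v: "v \<noteq> r" "par v = w" "v \<in> V" using vw by (auto simp: adj_def)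
    then have "\<theta> v y s = \<sigma> w v y (\<theta> w y s)" using \<theta>_par by metis
    then show ?thesis
      using \<sigma>_inv[of w v y "\<theta> w y s"] vw adj_sym y \<theta>_in s adj_in_V by metis
  qed (use \<theta>_par vw adj_in_V in metis)
  define \<theta>i where "\<theta>i v y = inv_into S (\<theta> v y)" for v y
  have \<theta>i_in: "\<theta>i v y s \<in> S" and \<theta>_\<theta>i: "\<theta> v y (\<theta>i v y s) = s" and \<theta>i_\<theta>: "\<theta>i v y (\<theta> v y s) = s"
    if "v \<in> V" "y \<in> Y" "s \<in> S" for v y s
    using \<theta>_bij[OF that(1,2)] that(3)
    by (auto simp: \<theta>i_def bij_betw_def inv_into_into f_inv_into_f)
  define \<alpha> where "\<alpha> v a ys = (\<phi> a (fst ys), \<theta>i v (\<phi> a (fst ys)) (\<theta> v (fst ys) (snd ys)))" for v a ys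
  have \<phi>_in: "\<phi> g y \<in> Y" if "g \<in> carrier G" "y \<in> Y" for g y using acts_onD(1)[OF \<phi>] that .
  have \<alpha>_act: "acts_on (G\<lparr>carrier := A v\<rparr>) (Y \<times> S) (\<alpha> v)" if v: "v \<in> V" for v
    unfolding acts_on_def
    using v acts_onD[OF \<phi>] A_in_G[OF v] by (auto simp: \<alpha>_def \<theta>i_in \<theta>_in \<theta>_\<theta>i \<theta>i_\<theta>)
  have \<alpha>_agree: "\<alpha> v c ys = \<alpha> (par v) c ys" if v: "v \<in> V" "v \<noteq> r" and c: "c \<in> C v" and ys: "ys \<in> Y \<times> S"
    for v c ys
  proof -
    obtain y s where ys': "ys = (y, s)" "y \<in> Y" "s \<in> S" using ys by auto
    let ?p = "par v"
    have p: "?p \<in> V" "adj ?p v" using par v adj_par by auto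
    have c': "c \<in> E ?p v" "c \<in> carrier G"
      using c E_par[OF v] E_in_G[OF p(2)] by auto
    define t where "t = \<theta>i ?p (\<phi> c y) (\<theta> ?p y s)"
    have t: "t \<in> S" "\<theta> ?p (\<phi> c y) t = \<theta> ?p y s"
      using p ys' \<phi>_in[OF c'(2)] by (auto simp: t_def \<theta>i_in \<theta>_in \<theta>_\<theta>i)
    have "\<theta> v (\<phi> c y) t = \<theta> v y s"
      using \<theta>_par[OF v] t(2) \<sigma>_E[OF p(2) ys'(2) c'(1)] by simp
    then have "\<theta>i v (\<phi> c y) (\<theta> v y s) = t"
      using \<theta>i_\<theta>[OF v(1) \<phi>_in[OF c'(2) ys'(2)] t(1)] by simp
    then show ?thesis by (simp add: \<alpha>_def ys' t_def)
  qed
  obtain \<psi> where \<psi>: "acts_on G (Y \<times> S) \<psi>"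
    "\<And>v a ys. v \<in> V \<Longrightarrow> a \<in> A v \<Longrightarrow> ys \<in> Y \<times> S \<Longrightarrow> \<psi> a ys = \<alpha> v a ys"
    using extend_actions[of "Y \<times> S" \<alpha>] \<alpha>_act \<alpha>_agree by blast
  have fst_\<psi>: "fst (\<psi> g (y, s)) = \<phi> g y" if "g \<in> carrier G" "y \<in> Y" "s \<in> S" for g y s
    using that(1)
  proof (induction rule: G_induct)
    case one
    then show ?case using acts_onD(2)[OF \<psi>(1)] acts_onD(2)[OF \<phi>] that by simp
  next
    case (mult v a g)
    have "\<psi> (a \<cdot> g) (y, s) = \<psi> a (\<psi> g (y, s))" "\<psi> g (y, s) \<in> Y \<times> S"
      using acts_onD(1,3)[OF \<psi>(1)] mult A_in_G that by auto
    moreover have "\<phi> (a \<cdot> g) y = \<phi> a (\<phi> g y)"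
      using acts_onD(3)[OF \<phi>] mult A_in_G that by auto
    ultimately show ?case using \<psi>(2)[OF mult(1,2)] mult(4) by (simp add: \<alpha>_def)
  qed
  have "\<theta> v (\<phi> a y) (snd (\<psi> a (y, s))) = \<theta> v y s"
    if "v \<in> V" "a \<in> A v" "y \<in> Y" "s \<in> S" for v a y s
    using that \<psi>(2)[OF that(1,2), of "(y, s)"] \<phi>_in[OF A_in_G[OF that(1,2)] that(3)]
    by (simp add: \<alpha>_def \<theta>_\<theta>i \<theta>_in)
  then have "is_twist Y \<phi> S \<sigma> \<psi> \<theta>"
    unfolding is_twist_def using \<psi>(1) \<theta>_bij \<theta>_r \<theta>_adj fst_\<psi> by simp
  then show ?thesis by blast
qed

lemma is_twistD:
  assumes "is_twist Y \<phi> S \<sigma> \<psi> \<theta>"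
  shows "acts_on G (Y \<times> S) \<psi>"
    and "v \<in> V \<Longrightarrow> y \<in> Y \<Longrightarrow> bij_betw (\<theta> v y) S S"
    and "\<theta> r y s = s"
    and "adj v w \<Longrightarrow> y \<in> Y \<Longrightarrow> s \<in> S \<Longrightarrow> \<theta> w y s = \<sigma> v w y (\<theta> v y s)"
    and "g \<in> carrier G \<Longrightarrow> y \<in> Y \<Longrightarrow> s \<in> S \<Longrightarrow> fst (\<psi> g (y, s)) = \<phi> g y"
    and "v \<in> V \<Longrightarrow> a \<in> A v \<Longrightarrow> y \<in> Y \<Longrightarrow> s \<in> S \<Longrightarrow> \<theta> v (\<phi> a y) (snd (\<psi> a (y, s))) = \<theta> v y s"
  using assms by (simp_all add: is_twist_def)

text \<open>Letters from vertex groups do not move the fibre in the current coordinate; only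
  crossings do, each by its own \<open>\<sigma>\<close>.\<close>

lemma twisted_path:
  assumes \<phi>: "acts_on G Y \<phi>" and tw: "is_twist Y \<phi> S \<sigma> \<psi> \<theta>"
    and q: "path q" and ys: "y \<in> Y" "s \<in> S"
  shows "\<theta> (fst (hd q)) (\<phi> (ev q) y) (snd (\<psi> (ev q) (y, s))) =
    foldr (\<lambda>(v, w, g). \<sigma> v w (\<phi> g y)) (crossings q) s"
  using q
proof (induction rule: path_induct)
  case (start a)
  then show ?case using is_twistD(6)[OF tw root start ys] is_twistD(3)[OF tw] A_in_G[OF root start] by simp
next
  case (step w a q)
  let ?v = "fst (hd q)"
  have w: "w \<in> V" using adj_in_V step by blast
  have a: "a \<in> carrier G" using A_in_G w step by blast
  have g: "ev q \<in> carrier G" "q \<noteq> []" using path_in[OF step(1)] by auto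
  have in_YS: "\<psi> (ev q) (y, s) \<in> Y \<times> S" using acts_onD(1)[OF is_twistD(1)[OF tw] g(1)] ys by simp
  then obtain s' where s': "\<psi> (ev q) (y, s) = (\<phi> (ev q) y, s')" "s' \<in> S"
    using is_twistD(5)[OF tw g(1) ys] by (metis mem_Sigma_iff prod.collapse)
  have y': "\<phi> (ev q) y \<in> Y" using acts_onD(1)[OF \<phi> g(1) ys(1)] .
  have "\<psi> (a \<cdot> ev q) (y, s) = \<psi> a (\<phi> (ev q) y, s')"
    using acts_onD(3)[OF is_twistD(1)[OF tw] a g(1), of "(y, s)"] ys s' by simp
  moreover have "\<phi> (a \<cdot> ev q) y = \<phi> a (\<phi> (ev q) y)"
    using acts_onD(3)[OF \<phi> a g(1) ys(1)] .
  ultimately have "\<theta> w (\<phi> (a \<cdot> ev q) y) (snd (\<psi> (a \<cdot> ev q) (y, s))) = \<theta> w (\<phi> (ev q) y) s'"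
    using is_twistD(6)[OF tw w step(3) y' s'(2)] by simp
  also have "\<dots> = \<sigma> ?v w (\<phi> (ev q) y) (\<theta> ?v (\<phi> (ev q) y) s')"
    using is_twistD(4)[OF tw step(2) y' s'(2)] .
  finally show ?case using step(4) s' g(2) by (simp add: crossings_Cons)
qed

section \<open>Walls of the Bass-Serre tree\<close>

lemma acts_on_translations: "acts_on G (carrier G) (\<lambda>g h. g \<cdot> h)"
  by (simp add: acts_on_def G.m_assoc)

text \<open>\<open>f w g\<close> tells on which side of an edge the vertex represented by the right
  coset of \<open>A w\<close> through \<open>g\<close> lies; the first clause makes this well
  defined. The only edge across which the side changes is the coset \<open>E u v\<close>
  itself.\<close>

definition is_wall :: "'v \<Rightarrow> 'v \<Rightarrow> ('v \<Rightarrow> ('v, 'e, 'g) elt \<Rightarrow> bool) \<Rightarrow> bool" where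
  "is_wall u v f \<longleftrightarrow>
     (\<forall>w \<in> V. \<forall>a \<in> A w. \<forall>g \<in> carrier G. f w (a \<cdot> g) = f w g) \<and>
     (\<forall>w x. adj w x \<longrightarrow> (\<forall>g \<in> carrier G. f x g \<noteq> f w g \<longleftrightarrow> {w, x} = {u, v} \<and> g \<in> E u v))"

lemma is_wallD:
  assumes "is_wall u v f"
  shows "w \<in> V \<Longrightarrow> a \<in> A w \<Longrightarrow> g \<in> carrier G \<Longrightarrow> f w (a \<cdot> g) = f w g"
    and "adj w x \<Longrightarrow> g \<in> carrier G \<Longrightarrow> f x g \<noteq> f w g \<longleftrightarrow> {w, x} = {u, v} \<and> g \<in> E u v"
  using assms unfolding is_wall_def by simp_all

text \<open>
  Every edge of the Bass--Serre tree separates it: a wall is obtained by twisting the regular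
  action by \<open>Not\<close> at one edge.
\<close>

lemma wall_exists:
  assumes "adj u v"
  shows "\<exists>f. is_wall u v f"
proof -
  define \<sigma> where "\<sigma> w x g = (if {w, x} = {u, v} \<and> g \<in> E u v then Not else id)" for w x g
  have \<sigma>_E: "\<sigma> w x (c \<cdot> g) = \<sigma> w x g"
    if wx: "adj w x" and g: "g \<in> carrier G" and c: "c \<in> E w x" for w x g c
  proof (cases "{w, x} = {u, v}")
    case True
    then have "E w x = E u v" using E_sym[OF assms] by (auto simp: doubleton_eq_iff)
    then have "c \<cdot> g \<in> E u v \<longleftrightarrow> g \<in> E u v"
      using subgroup.m_closed[OF E_subgroup[OF assms]] subgroup.m_inv_closed[OF E_subgroup[OF assms]]
        c g E_in_G[OF wx c] G.inv_solve_left by (metis G.l_inv G.l_one G.inv_closed G.m_assoc)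
    then show ?thesis by (simp add: \<sigma>_def)
  qed (auto simp: \<sigma>_def)
  have \<sigma>_inv: "\<sigma> x w g (\<sigma> w x g s) = s" for w x g s
    by (simp add: \<sigma>_def insert_commute)
  obtain \<psi> \<theta> where tw: "is_twist (carrier G) (\<lambda>g h. g \<cdot> h) (UNIV :: bool set) \<sigma> \<psi> \<theta>"
    using twist_exists[of "carrier G" "\<lambda>g h. g \<cdot> h" UNIV \<sigma>, OF acts_on_translations UNIV_I \<sigma>_inv \<sigma>_E]
    by blast
  \<comment> \<open>The orbit of \<open>(1, False)\<close>, with its fibre read in the coordinate at
    \<open>w\<close>. As \<open>A w\<close> does not move this coordinate, \<open>f w\<close>
    depends only on the right coset of \<open>A w\<close>.\<close>
  define f where "f w g = \<theta> w g (snd (\<psi> g (\<one>\<^bsub>G\<^esub>, False)))" for w g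
  have "f w (a \<cdot> g) = f w g" if wag: "w \<in> V" "a \<in> A w" "g \<in> carrier G" for w a g
  proof -
    have "\<psi> g (\<one>\<^bsub>G\<^esub>, False) = (g, snd (\<psi> g (\<one>\<^bsub>G\<^esub>, False)))"
      using is_twistD(5)[OF tw wag(3), of "\<one>\<^bsub>G\<^esub>" False] wag(3) by (simp add: prod_eq_iff)
    then have "\<psi> (a \<cdot> g) (\<one>\<^bsub>G\<^esub>, False) = \<psi> a (g, snd (\<psi> g (\<one>\<^bsub>G\<^esub>, False)))"
      using acts_onD(3)[OF is_twistD(1)[OF tw] A_in_G[OF wag(1,2)] wag(3), of "(\<one>\<^bsub>G\<^esub>, False)"] by simp
    then show ?thesis
      using is_twistD(6)[OF tw wag UNIV_I] by (simp add: f_def)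
  qed
  moreover have "f x g \<noteq> f w g \<longleftrightarrow> {w, x} = {u, v} \<and> g \<in> E u v"
    if "adj w x" "g \<in> carrier G" for w x g
    using is_twistD(4)[OF tw, of w x g] that by (simp add: f_def \<sigma>_def)
  ultimately have "is_wall u v f" unfolding is_wall_def by blast
  then show ?thesis by blast
qed

end

section \<open>Points with nontrivial stabilizers\<close>

context rooted_tree_of_groups
begin

text \<open>Translated by \<open>\<gamma>\<close> on the right, the path leads from the root vertex
  at \<open>\<gamma>\<close> to the vertex at \<open>ev q \<cdot> \<gamma>\<close>. If none of its
  translated crossings is the wall, it stays on one side.\<close>

lemma wall_path:
  assumes wall: "is_wall u v f" and "path q" "\<gamma> \<in> carrier G"
    and "\<forall>(w, x, g) \<in> set (crossings q). {w, x} = {u, v} \<longrightarrow> g \<cdot> \<gamma> \<notin> E u v"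
  shows "f (fst (hd q)) (ev q \<cdot> \<gamma>) = f r \<gamma>"
  using assms(2,4)
proof (induction rule: path_induct)
  case (start a)
  then show ?case using is_wallD(1)[OF wall root start(1) assms(3)] A_in_G[OF root start(1)] by simp
next
  case (step w a q)
  have g: "ev q \<in> carrier G" "q \<noteq> []" using path_in[OF step(1)] by auto
  have w: "w \<in> V" "a \<in> carrier G" using adj_in_V step A_in_G by blast+
  have "f w (a \<cdot> ev q \<cdot> \<gamma>) = f w (ev q \<cdot> \<gamma>)"
    using is_wallD(1)[OF wall w(1) step(3), of "ev q \<cdot> \<gamma>"] w g assms(3) by (simp add: G.m_assoc)
  also have "\<dots> = f (fst (hd q)) (ev q \<cdot> \<gamma>)"
    using is_wallD(2)[OF wall step(2), of "ev q \<cdot> \<gamma>"] step(5) g assms(3) by (auto simp: crossings_Cons)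
  also have "\<dots> = f r \<gamma>" using step(4,5) g by (simp add: crossings_Cons)
  finally show ?case by simp
qed

text \<open>Cut the path just before the crossing. If the end is to be \<open>w\<close>, a step with
  letter \<open>1\<close> takes the place of the crossing step, so the length bound still
  holds.\<close>

lemma crossing_subpaths:
  assumes "path q" "(v, w, g) \<in> set (crossings q)" "u \<in> {v, w}"
  shows "\<exists>q'. path q' \<and> fst (hd q') = u \<and> ev q' = g \<and> length q' \<le> length q"
  using assms(1,2)
proof (induction rule: path_induct)
  case (step x a q)
  have q: "q \<noteq> []" using path_ne[OF step(1)] .
  show ?case
  proof (cases "(v, w, g) \<in> set (crossings q)")
    case True
    then show ?thesis using step.IH by fastforce
  next
    case False
    then have "v = fst (hd q)" "w = x" "g = ev q"
      using step.prems q by (auto simp: crossings_Cons)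
    then show ?thesis
      using assms(3) step(1) path_cross[OF step(1,2)]
      by (cases "u = v") (auto intro: exI[of _ q] exI[of _ "(x, \<one>\<^bsub>G\<^esub>) # q"])
  qed
qed simp

definition edge_elts where
  "edge_elts = (\<Union>v \<in> V. \<Union>w \<in> {w \<in> V. adj v w}. E v w)"

lemma edge_elts: "adj v w \<Longrightarrow> c \<in> E v w \<Longrightarrow> c \<in> edge_elts" "edge_elts \<subseteq> carrier G"
  using adj_in_V E_in_G unfolding edge_elts_def by blast+

lemma finite_edge_elts: "finite edge_elts"
proof -
  have "edge_elts \<subseteq> (\<Union>v \<in> V. A v)"
    using E_subset(1) unfolding edge_elts_def by blast
  then show ?thesis
    by (rule finite_subset) (simp add: finite_verts finite_A)
qed

definition centralizers_finite :: bool where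
  "centralizers_finite \<longleftrightarrow>
     (\<forall>c \<in> edge_elts. c \<noteq> \<one>\<^bsub>G\<^esub> \<longrightarrow> finite {g \<in> carrier G. g \<cdot> c = c \<cdot> g})"

end

text \<open>The coset space of \<open>H\<close> with the coset \<open>H\<close> as base point,
  described abstractly; \<open>Q\<close> consists of loops at the root that represent finitely many
  generators of \<open>H\<close>.\<close>

locale pointed_action = rooted_tree_of_groups \<G> r par rank pe
  for \<G> :: "('v, 'e, 'g, 'h) graph_of_groups" and r par rank pe +
  fixes X :: "'x set" and \<phi> :: "('v, 'e, 'g) elt \<Rightarrow> 'x \<Rightarrow> 'x" and x0 :: 'x
    and Q :: "('v \<times> ('v, 'e, 'g) elt) list set"
  assumes \<phi>: "acts_on G X \<phi>"
    and x0: "x0 \<in> X"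
    and transitive: "\<And>x. x \<in> X \<Longrightarrow> \<exists>g \<in> carrier G. x = \<phi> g x0"
    and finite_Q: "finite Q"
    and Q_loops: "\<And>q. q \<in> Q \<Longrightarrow> path q \<and> fst (hd q) = r \<and> \<phi> (ev q) x0 = x0"
    and stabilizer: "\<And>g. g \<in> carrier G \<Longrightarrow> \<phi> g x0 = x0 \<Longrightarrow> g \<in> generate G (ev ` Q)"
begin

lemma \<phi>_in: "g \<in> carrier G \<Longrightarrow> x \<in> X \<Longrightarrow> \<phi> g x \<in> X"
  by (rule acts_onD(1)[OF \<phi>])

lemma \<phi>_mult: "g \<in> carrier G \<Longrightarrow> h \<in> carrier G \<Longrightarrow> x \<in> X \<Longrightarrow> \<phi> (g \<cdot> h) x = \<phi> g (\<phi> h x)"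
  by (rule acts_onD(3)[OF \<phi>])

lemma \<phi>_one: "x \<in> X \<Longrightarrow> \<phi> \<one>\<^bsub>G\<^esub> x = x"
  by (rule acts_onD(2)[OF \<phi>])

lemmas \<phi>_inv = G.acts_on_inv[OF \<phi>]

text \<open>The edges of the quotient graph between \<open>v\<close> and \<open>w\<close> are the
  \<open>E v w\<close>-orbits on \<open>X\<close>. The inner ones are those that a generating loop
  passes, in either direction.\<close>

definition inner where
  "inner v w x \<longleftrightarrow> (\<exists>q \<in> Q. \<exists>(v', w', g) \<in> set (crossings q). {v', w'} = {v, w} \<and>
     (\<exists>c \<in> E v w. \<phi> g x0 = \<phi> c x))"

text \<open>
  If an edge of the quotient graph is crossed by no generating loop, then it separates, and its
  stabilizer is the stabilizer of the endpoint on the far side.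
\<close>

lemma far_stabilizer:
  assumes vw: "adj v w" and q0: "path q0" "fst (hd q0) = v" "p = \<phi> (ev q0) x0"
    and avoid: "\<forall>(v', w', g) \<in> set (crossings q0). {v', w'} = {v, w} \<longrightarrow> \<not> (\<exists>c \<in> E v w. \<phi> g x0 = \<phi> c p)"
    and outer: "\<not> inner v w p"
    and a: "a \<in> A w" "\<phi> a p = p"
  shows "a \<in> E v w"
proof (rule ccontr)
  assume aE: "a \<notin> E v w"
  obtain f where wall: "is_wall v w f"
    using wall_exists[OF vw] by blast
  let ?g0 = "ev q0"
  have g0: "?g0 \<in> carrier G" using path_ev_in_G[OF q0(1)] .
  have aG: "a \<in> carrier G" and wV: "w \<in> V" using A_in_G a adj_in_V vw by blast+
  have p: "p \<in> X" using q0(3) \<phi>_in g0 x0 by simp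
  \<comment> \<open>Projection to \<open>X\<close>: if \<open>\<gamma>\<close> takes
    \<open>p\<close> to \<open>x0\<close>, then \<open>g \<cdot> \<gamma> \<in> E v w\<close> puts
    \<open>\<phi> g x0\<close> into the \<open>E v w\<close>-orbit of \<open>p\<close>, which
    \<open>av\<close> forbids.\<close>
  have no_cross: "\<forall>(v', w', g) \<in> set (crossings q). {v', w'} = {v, w} \<longrightarrow> g \<cdot> \<gamma> \<notin> E v w"
    if q: "path q" and \<gamma>: "\<gamma> \<in> carrier G" "\<phi> \<gamma> p = x0"
      and av: "\<forall>(v', w', g) \<in> set (crossings q). {v', w'} = {v, w} \<longrightarrow> \<not> (\<exists>c \<in> E v w. \<phi> g x0 = \<phi> c p)"
    for q \<gamma>
  proof (clarify)
    fix v' w' g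
    assume g: "(v', w', g) \<in> set (crossings q)" "{v', w'} = {v, w}" "g \<cdot> \<gamma> \<in> E v w"
    have "\<phi> (g \<cdot> \<gamma>) p = \<phi> g x0"
      using \<phi>_mult path_crossings(2)[OF q g(1)] \<gamma> p by simp
    then show False using av g by fastforce
  qed
  have loop: "f r (ev q \<cdot> \<gamma>) = f r \<gamma>" if "q \<in> Q" "\<gamma> \<in> carrier G" "\<phi> \<gamma> p = x0" for q \<gamma>
  proof -
    have q: "path q" "fst (hd q) = r" using Q_loops[OF that(1)] by auto
    have "\<forall>(v', w', g) \<in> set (crossings q). {v', w'} = {v, w} \<longrightarrow> \<not> (\<exists>c \<in> E v w. \<phi> g x0 = \<phi> c p)"
      using outer that(1) unfolding inner_def by blast
    from wall_path[OF wall q(1) that(2) no_cross[OF q(1) that(2,3) this]] q(2)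
    show ?thesis by simp
  qed
  \<comment> \<open>By \<open>outer\<close> no generating loop crosses the wall from such a
    \<open>\<gamma>\<close>. So left multiplication by the stabilizer of \<open>x0\<close> does not
    change the side on which the root vertex at \<open>\<gamma>\<close> lies.\<close>
  have generated: "\<forall>\<gamma> \<in> carrier G. \<phi> \<gamma> p = x0 \<longrightarrow> \<phi> h x0 = x0 \<and> f r (h \<cdot> \<gamma>) = f r \<gamma>"
    if "h \<in> generate G (ev ` Q)" for h
    using that
  proof (induction rule: generate.induct)
    case one
    then show ?case using \<phi>_one x0 by simp
  next
    case (incl h)
    then show ?case using loop Q_loops by auto
  next
    case (inv h)
    then obtain q where q: "q \<in> Q" "h = ev q" by blast
    have h: "h \<in> carrier G" "\<phi> h x0 = x0" using Q_loops[OF q(1)] path_ev_in_G q by auto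
    have fix': "\<phi> (inv\<^bsub>G\<^esub> h) x0 = x0" using \<phi>_inv(1)[OF h(1) x0] h(2) by simp
    show ?case
    proof (intro ballI impI conjI fix')
      fix \<gamma> assume \<gamma>: "\<gamma> \<in> carrier G" "\<phi> \<gamma> p = x0"
      have "\<phi> (inv\<^bsub>G\<^esub> h \<cdot> \<gamma>) p = x0" using \<phi>_mult h(1) \<gamma> p fix' by simp
      then have "f r (h \<cdot> (inv\<^bsub>G\<^esub> h \<cdot> \<gamma>)) = f r (inv\<^bsub>G\<^esub> h \<cdot> \<gamma>)"
        using loop[OF q(1)] q(2) h(1) \<gamma> by simp
      then show "f r (inv\<^bsub>G\<^esub> h \<cdot> \<gamma>) = f r \<gamma>"
        using h(1) \<gamma> by (simp add: G.m_assoc[symmetric])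
    qed
  next
    case (eng h1 h2)
    have sub: "ev ` Q \<subseteq> carrier G" using Q_loops path_ev_in_G by auto
    have h: "h1 \<in> carrier G" "h2 \<in> carrier G" using eng(1,2) G.generate_in_carrier[OF sub] by auto
    have g: "inv\<^bsub>G\<^esub> ?g0 \<in> carrier G" "\<phi> (inv\<^bsub>G\<^esub> ?g0) p = x0"
      using g0 \<phi>_inv(1)[OF g0 x0] q0(3) by auto
    then have "\<phi> h1 x0 = x0" "\<phi> h2 x0 = x0" using eng(3,4) by blast+
    then show ?case
      using eng(3,4) h p \<phi>_mult x0 by (auto simp: G.m_assoc)
  qed
  \<comment> \<open>\<open>?h\<close> is \<open>a\<close> conjugated into the stabilizer of
    \<open>x0\<close>. It follows that \<open>1\<close> and \<open>a\<close> are on the same side at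
    \<open>v\<close>, while at \<open>w\<close> they represent the same vertex. But the edge at
    \<open>1\<close> is the wall and the edge at \<open>a\<close> is not, because \<open>a\<close>
    is outside \<open>E v w\<close>.\<close>
  let ?\<gamma> = "inv\<^bsub>G\<^esub> ?g0" and ?h = "inv\<^bsub>G\<^esub> ?g0 \<cdot> a \<cdot> ?g0"
  have \<gamma>: "?\<gamma> \<in> carrier G" "\<phi> ?\<gamma> p = x0" using g0 \<phi>_inv(1)[OF g0 x0] q0(3) by auto
  have hG: "?h \<in> carrier G" using g0 aG by simp
  have h_fix: "\<phi> ?h x0 = x0" using \<phi>_mult g0 aG x0 q0(3) a(2) \<gamma> p by simp
  have h\<gamma>: "?h \<cdot> ?\<gamma> \<in> carrier G" "\<phi> (?h \<cdot> ?\<gamma>) p = x0"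
    using hG \<gamma> \<phi>_mult[OF hG \<gamma>(1) p] h_fix by auto
  have "f v (?g0 \<cdot> ?\<gamma>) = f r ?\<gamma>" "f v (?g0 \<cdot> (?h \<cdot> ?\<gamma>)) = f r (?h \<cdot> ?\<gamma>)"
    using wall_path[OF wall q0(1) \<gamma>(1) no_cross[OF q0(1) \<gamma> avoid]]
      wall_path[OF wall q0(1) h\<gamma>(1) no_cross[OF q0(1) h\<gamma> avoid]] q0(2) by simp_all
  moreover have "f r (?h \<cdot> ?\<gamma>) = f r ?\<gamma>"
    using generated[OF stabilizer[OF hG h_fix]] \<gamma> by blast
  moreover have "?g0 \<cdot> ?\<gamma> = \<one>\<^bsub>G\<^esub>" "?g0 \<cdot> (?h \<cdot> ?\<gamma>) = a"
    using g0 aG G.m_assoc[of ?g0 ?\<gamma> a, symmetric] by (simp_all add: G.m_assoc)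
  ultimately have "f v a = f v \<one>\<^bsub>G\<^esub>" by simp
  moreover have "f w a = f w \<one>\<^bsub>G\<^esub>" using is_wallD(1)[OF wall wV a(1) G.one_closed] aG by simp
  moreover have "f w \<one>\<^bsub>G\<^esub> \<noteq> f v \<one>\<^bsub>G\<^esub>"
    using is_wallD(2)[OF wall vw G.one_closed] subgroup.one_closed[OF E_subgroup[OF vw]] by simp
  moreover have "f w a = f v a" using is_wallD(2)[OF wall vw aG] aE by blast
  ultimately show False by simp
qed

section \<open>The finite core and the points controlled by it\<close>

definition core0 where
  "core0 = insert x0 {\<phi> g x0 | q v w g. q \<in> Q \<and> (v, w, g) \<in> set (crossings q)}"

text \<open>The endpoint of an inner edge is an edge element applied to a point of
  \<open>core0\<close>, which explains the factor \<open>c\<close>. The factor \<open>a\<close>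
  makes the set invariant under \<open>A v\<close>.\<close>

definition core where
  "core v = {\<phi> (a \<cdot> c) b | a c b. a \<in> A v \<and> c \<in> insert \<one>\<^bsub>G\<^esub> edge_elts \<and> b \<in> core0}"

lemma core0_subset: "core0 \<subseteq> X"
proof
  fix x assume "x \<in> core0"
  then consider "x = x0" | q v w g where "q \<in> Q" "(v, w, g) \<in> set (crossings q)" "x = \<phi> g x0"
    unfolding core0_def by blast
  then show "x \<in> X"
  proof cases
    case 2
    then have "g \<in> carrier G" using path_crossings(2) Q_loops by metis
    then show ?thesis using 2 \<phi>_in x0 by simp
  qed (use x0 in simp)
qed

lemma finite_core: "v \<in> V \<Longrightarrow> finite (core v)" and core_subset: "v \<in> V \<Longrightarrow> core v \<subseteq> X"
proof -
  assume v: "v \<in> V"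
  have "core0 \<subseteq> insert x0 ((\<lambda>(v, w, g). \<phi> g x0) ` (\<Union>q \<in> Q. set (crossings q)))"
    by (force simp: core0_def)
  then have "finite core0" by (rule finite_subset) (simp add: finite_Q)
  moreover note finite_edge_elts
  moreover have "core v \<subseteq> (\<lambda>(a, c, b). \<phi> (a \<cdot> c) b) ` (A v \<times> insert \<one>\<^bsub>G\<^esub> edge_elts \<times> core0)"
    by (force simp: core_def)
  ultimately show "finite (core v)" using finite_A[OF v] by (meson finite_SigmaI finite_imageI
        finite_insert finite_subset)
  have "\<phi> (a \<cdot> c) b \<in> X" if "a \<in> A v" "c \<in> insert \<one>\<^bsub>G\<^esub> edge_elts" "b \<in> core0" for a c b
  proof -
    have "a \<in> carrier G" "c \<in> carrier G" "b \<in> X"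
      using that A_in_G[OF v] edge_elts(2) core0_subset by auto
    then show ?thesis using \<phi>_in by simp
  qed
  then show "core v \<subseteq> X"
    unfolding core_def by (simp only: subset_iff mem_Collect_eq) metis
qed

lemma core_invariant:
  assumes "v \<in> V" "a \<in> A v" "x \<in> core v" shows "\<phi> a x \<in> core v"
proof -
  obtain a' c b where x: "a' \<in> A v" "c \<in> insert \<one>\<^bsub>G\<^esub> edge_elts" "b \<in> core0" "x = \<phi> (a' \<cdot> c) b"
    using assms(3) unfolding core_def by blast
  have b: "b \<in> X" using x(3) core0_subset by blast
  have G: "a \<in> carrier G" "a' \<in> carrier G" "c \<in> carrier G"
    using assms A_in_G x edge_elts(2) by auto
  have "\<phi> a x = \<phi> ((a \<cdot> a') \<cdot> c) b"
    using \<phi>_mult[of a "a' \<cdot> c" b] G b x(4) by (simp add: G.m_assoc)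
  moreover have "a \<cdot> a' \<in> A v" using subgroup.m_closed[OF A_subgroup] assms x by simp
  ultimately show ?thesis using x(2,3) unfolding core_def by blast
qed

text \<open>Outside the core, a nontrivial stabilizer element \<open>c\<close> of \<open>x\<close>
  has to be conjugate to an edge element \<open>e\<close> by some \<open>g\<close> that carries a
  core point to \<open>x\<close>. For given \<open>c\<close> and \<open>e\<close> these
  \<open>g\<close> lie in one coset of the centralizer of \<open>e\<close>; this is how finite
  centralizers bound the number of such \<open>x\<close>.\<close>

definition controlled where
  "controlled v x \<longleftrightarrow> x \<in> core v \<or>
     (\<forall>c \<in> A v. c \<noteq> \<one>\<^bsub>G\<^esub> \<longrightarrow> \<phi> c x = x \<longrightarrow>
       (\<exists>b \<in> (\<Union>v \<in> V. core v). \<exists>g \<in> carrier G. \<exists>e \<in> edge_elts. x = \<phi> g b \<and> e \<noteq> \<one>\<^bsub>G\<^esub> \<and>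
          c \<cdot> g = g \<cdot> e))"

lemma controlled_act:
  assumes v: "v \<in> V" and a: "a \<in> A v" and x: "x \<in> X" "controlled v x"
  shows "controlled v (\<phi> a x)"
proof (cases "x \<in> core v")
  case True
  then show ?thesis using core_invariant[OF v a] by (simp add: controlled_def)
next
  case False
  have aG: "a \<in> carrier G" using A_in_G[OF v a] .
  have "\<exists>b \<in> (\<Union>v \<in> V. core v). \<exists>g \<in> carrier G. \<exists>e \<in> edge_elts. \<phi> a x = \<phi> g b \<and> e \<noteq> \<one>\<^bsub>G\<^esub> \<and>
      c \<cdot> g = g \<cdot> e"
    if c: "c \<in> A v" "c \<noteq> \<one>\<^bsub>G\<^esub>" "\<phi> c (\<phi> a x) = \<phi> a x" for c
  proof -
    have cG: "c \<in> carrier G" using A_in_G[OF v c(1)] .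
    let ?c = "inv\<^bsub>G\<^esub> a \<cdot> (c \<cdot> a)"
    have c1: "?c \<in> A v" using a c v A_subgroup by (simp add: subgroup.m_closed subgroup.m_inv_closed)
    have c2: "?c \<noteq> \<one>\<^bsub>G\<^esub>"
    proof
      assume "?c = \<one>\<^bsub>G\<^esub>"
      then have "c \<cdot> a = a" using G.inv_solve_left[of "\<one>\<^bsub>G\<^esub>" a "c \<cdot> a"] aG cG by simp
      then show False using c(2) aG cG by simp
    qed
    have c3: "\<phi> ?c x = x"
      using \<phi>_mult \<phi>_in \<phi>_inv(1) aG cG x c(3) by simp
    have "\<exists>b \<in> (\<Union>v \<in> V. core v). \<exists>g \<in> carrier G. \<exists>e \<in> edge_elts. x = \<phi> g b \<and> e \<noteq> \<one>\<^bsub>G\<^esub> \<and>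
        ?c \<cdot> g = g \<cdot> e"
      using disjE[OF x(2)[unfolded controlled_def]] False c1 c2 c3 by blast
    then obtain b g e where b: "b \<in> (\<Union>v \<in> V. core v)" "g \<in> carrier G" "e \<in> edge_elts"
      "x = \<phi> g b" "e \<noteq> \<one>\<^bsub>G\<^esub>" "?c \<cdot> g = g \<cdot> e"
      by blast
    have bX: "b \<in> X" using b(1) core_subset by blast
    have eG: "e \<in> carrier G" using b(3) edge_elts(2) by blast
    have "a \<cdot> (?c \<cdot> g) = c \<cdot> (a \<cdot> g)"
      using aG cG b(2) G.m_assoc G.r_inv G.l_one G.inv_closed G.m_closed by metis
    then have "c \<cdot> (a \<cdot> g) = (a \<cdot> g) \<cdot> e"
      using b(6) aG b(2) eG by (simp add: G.m_assoc)
    moreover have "\<phi> a x = \<phi> (a \<cdot> g) b" using \<phi>_mult aG b(2,4) bX by simp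
    ultimately show ?thesis using b aG by (intro bexI[of _ b] bexI[of _ "a \<cdot> g"] bexI[of _ e]) auto
  qed
  then show ?thesis unfolding controlled_def by blast
qed

text \<open>Induction on the length, for a path as short as possible with its final vertex and
  point. If the last edge is inner, its endpoint lies in the core. Otherwise minimality keeps the
  path from crossing this edge earlier, \<open>far_stabilizer\<close> puts the stabilizer at the far
  end into the edge group, and control is inherited from the near end.\<close>

lemma controlled_path:
  assumes "path q" shows "controlled (fst (hd q)) (\<phi> (ev q) x0)"
  using assms
proof (induction "length q" arbitrary: q rule: less_induct)
  case less
  let ?x = "\<phi> (ev q) x0" and ?v = "fst (hd q)"
  have vV: "?v \<in> V" and gG: "ev q \<in> carrier G" using path_in[OF less.prems] by auto
  show ?case
  proof (cases "\<exists>q'. path q' \<and> fst (hd q') = ?v \<and> \<phi> (ev q') x0 = ?x \<and> length q' < length q")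
    case True
    then show ?thesis using less.hyps by metis
  next
    case shortest: False
    obtain v a q0 where q: "q = (v, a) # q0" using path_ne[OF less.prems] by (cases q) auto
    show ?thesis
    proof (cases "q0 = []")
      case True
      then have a: "v = r" "a \<in> A r" using less.prems q by auto
      have "x0 \<in> core0" by (simp add: core0_def)
      then have "\<phi> (a \<cdot> \<one>\<^bsub>G\<^esub>) x0 \<in> core r" using a(2) unfolding core_def by blast
      then show ?thesis using a True q by (simp add: controlled_def)
    next
      case False
      let ?u = "fst (hd q0)" and ?y = "\<phi> (ev q0) x0"
      have q0: "path q0" "adj ?u v" "a \<in> A v" using less.prems q False by (auto simp: path_Cons_iff)
      have v: "v \<in> V" "?u \<in> V" using adj_in_V[OF q0(2)] by auto
      have g0: "ev q0 \<in> carrier G" using path_ev_in_G[OF q0(1)] .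
      have y: "?y \<in> X" using \<phi>_in g0 x0 .
      have aG: "a \<in> carrier G" using A_in_G v q0 by simp
      have IH: "controlled ?u ?y" using less.hyps[of q0] q q0 by simp
      have x_eq: "?x = \<phi> a ?y" using \<phi>_mult aG g0 x0 q by simp
      have "controlled v ?y"
      proof (cases "inner ?u v ?y")
        case True
        then obtain q1 v' w' g c where g: "q1 \<in> Q" "(v', w', g) \<in> set (crossings q1)"
          "c \<in> E ?u v" "\<phi> g x0 = \<phi> c ?y"
          unfolding inner_def by blast
        have c: "c \<in> carrier G" "inv\<^bsub>G\<^esub> c \<in> E ?u v" "\<phi> g x0 \<in> core0"
          using E_in_G[OF q0(2) g(3)] subgroup.m_inv_closed[OF E_subgroup[OF q0(2)] g(3)] g(1,2)
          by (auto simp: core0_def)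
        have "?y = \<phi> (inv\<^bsub>G\<^esub> c) (\<phi> g x0)" using \<phi>_inv(1)[OF c(1) y] g(4) by simp
        then have "?y = \<phi> (\<one>\<^bsub>G\<^esub> \<cdot> inv\<^bsub>G\<^esub> c) (\<phi> g x0)" using c by simp
        then have "?y \<in> core v"
          using A_one[OF v(1)] edge_elts(1)[OF q0(2) c(2)] c(3) unfolding core_def by blast
        then show ?thesis by (simp add: controlled_def)
      next
        case outer: False
        \<comment> \<open>At an earlier crossing of the same edge the path could be cut off at
          \<open>v\<close> and corrected by a letter built from \<open>c\<close> and
          \<open>a\<close>, reaching the same point by a shorter path.\<close>
        have avoid: "\<forall>(v', w', g) \<in> set (crossings q0). {v', w'} = {?u, v} \<longrightarrow>
            \<not> (\<exists>c \<in> E ?u v. \<phi> g x0 = \<phi> c ?y)"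
        proof (clarify)
          fix v' w' g c
          assume g: "(v', w', g) \<in> set (crossings q0)" "{v', w'} = {?u, v}"
            and c: "c \<in> E ?u v" "\<phi> g x0 = \<phi> c ?y"
          have "v \<in> {v', w'}" unfolding g(2) by simp
          then obtain q1 where q1: "path q1" "fst (hd q1) = v" "ev q1 = g" "length q1 \<le> length q0"
            using crossing_subpaths[OF q0(1) g(1)] by blast
          have cA: "inv\<^bsub>G\<^esub> c \<in> A v"
            using E_subset(2)[OF q0(2)] subgroup.m_inv_closed[OF E_subgroup[OF q0(2)] c(1)] by blast
          have cG: "c \<in> carrier G" "g \<in> carrier G"
            using E_in_G[OF q0(2) c(1)] path_crossings(2)[OF q0(1) g(1)] by auto
          have "a \<cdot> inv\<^bsub>G\<^esub> c \<in> A v"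
            using subgroup.m_closed[OF A_subgroup[OF v(1)] q0(3) cA] .
          then obtain q2 where q2: "path q2" "fst (hd q2) = v" "ev q2 = a \<cdot> inv\<^bsub>G\<^esub> c \<cdot> g"
            "length q2 = length q1"
            using path_extend[OF q1(1), of "a \<cdot> inv\<^bsub>G\<^esub> c"] q1(2,3) by auto
          have "\<phi> (ev q2) x0 = \<phi> a (\<phi> (inv\<^bsub>G\<^esub> c) (\<phi> g x0))"
            using \<phi>_mult \<phi>_in aG cG x0 q2(3) by simp
          also have "\<dots> = ?x" using c(2) \<phi>_inv(1)[OF cG(1) y] x_eq by simp
          finally have "\<phi> (ev q2) x0 = ?x" .
          moreover have "length q2 < length q" "fst (hd q2) = ?v" using q2 q1(4) q by simp_all
          ultimately show False using shortest q2(1) by blast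
        qed
        have "\<exists>b \<in> (\<Union>v \<in> V. core v). \<exists>g \<in> carrier G. \<exists>e \<in> edge_elts. ?y = \<phi> g b \<and> e \<noteq> \<one>\<^bsub>G\<^esub> \<and>
            c \<cdot> g = g \<cdot> e"
          if c: "c \<in> A v" "c \<noteq> \<one>\<^bsub>G\<^esub>" "\<phi> c ?y = ?y" for c
        proof -
          have cE: "c \<in> E ?u v"
            using far_stabilizer[OF q0(2,1) refl refl avoid outer c(1,3)] .
          then have cu: "c \<in> A ?u" using E_subset(1)[OF q0(2)] by blast
          show ?thesis
          proof (cases "?y \<in> core ?u")
            case True
            \<comment> \<open>At a core point of the previous vertex take the point itself as
              \<open>b\<close>, with \<open>g = 1\<close> and \<open>e = c\<close>.\<close>
            have "c \<in> carrier G" using E_in_G[OF q0(2) cE] .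
            then show ?thesis
              using True v(2) edge_elts(1)[OF q0(2) cE] c(2) \<phi>_one[OF y]
              by (intro bexI[of _ ?y] bexI[of _ "\<one>\<^bsub>G\<^esub>"] bexI[of _ c]) auto
          next
            case False
            then show ?thesis using IH cu c unfolding controlled_def by blast
          qed
        qed
        then show ?thesis unfolding controlled_def by blast
      qed
      then show ?thesis using controlled_act[OF v(1) q0(3) y] x_eq q by simp
    qed
  qed
qed

text \<open>For each \<open>c\<close> and \<open>e\<close> the solutions \<open>g\<close> of
  \<open>c g = g e\<close> fill at most one left coset of the centralizer of \<open>e\<close>. With
  finitely many choices for \<open>c\<close>, \<open>e\<close> and the core point, only finitely
  many nonfree points are controlled.\<close>

lemma finite_nonfree:
  assumes "centralizers_finite"
  shows "finite {x \<in> X. \<exists>v \<in> V. \<exists>a \<in> A v. a \<noteq> \<one>\<^bsub>G\<^esub> \<and> \<phi> a x = x}"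
proof -
  let ?B = "\<Union>v \<in> V. core v" and ?A = "\<Union>v \<in> V. A v" and ?E = "edge_elts - {\<one>\<^bsub>G\<^esub>}"
  let ?T = "\<lambda>c e. {g \<in> carrier G. c \<cdot> g = g \<cdot> e}"
  have fin: "finite ?B" "finite ?A" using finite_verts finite_core finite_A by auto
  have finE: "finite ?E" using finite_edge_elts by (rule finite_Diff)
  have finT: "finite (?T c e)" if c: "c \<in> ?A" and e: "e \<in> ?E" for c e
  proof (cases "?T c e = {}")
    case False
    then obtain g0 where g0: "g0 \<in> carrier G" "c \<cdot> g0 = g0 \<cdot> e" by auto
    have cG: "c \<in> carrier G" "e \<in> carrier G" using c e A_in_G edge_elts(2) by auto
    have "?T c e \<subseteq> (\<lambda>z. g0 \<cdot> z) ` {g \<in> carrier G. g \<cdot> e = e \<cdot> g}"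
    proof
      fix g assume "g \<in> ?T c e"
      then have g: "g \<in> carrier G" "c \<cdot> g = g \<cdot> e" by auto
      let ?z = "inv\<^bsub>G\<^esub> g0 \<cdot> g"
      have z: "?z \<in> carrier G" "g0 \<cdot> ?z = g" using g g0 by (auto simp: G.m_assoc[symmetric])
      have "g0 \<cdot> (?z \<cdot> e) = c \<cdot> g"
        using G.m_assoc[OF g0(1) z(1) cG(2)] z(2) g(2) by simp
      also have "\<dots> = c \<cdot> (g0 \<cdot> ?z)" using z by simp
      also have "\<dots> = g0 \<cdot> (e \<cdot> ?z)"
        using G.m_assoc[OF cG(1) g0(1) z(1)] G.m_assoc[OF g0(1) cG(2) z(1)] g0(2) by simp
      finally have "?z \<cdot> e = e \<cdot> ?z" using g0(1) z(1) cG(2) by simp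
      then show "g \<in> (\<lambda>z. g0 \<cdot> z) ` {g \<in> carrier G. g \<cdot> e = e \<cdot> g}"
        using z by (intro image_eqI[of _ _ ?z]) auto
    qed
    then show ?thesis using assms e finite_subset unfolding centralizers_finite_def by blast
  next
    case True
    then show ?thesis by (simp only: finite.emptyI)
  qed
  let ?U = "?B \<union> (\<Union>b \<in> ?B. \<Union>c \<in> ?A. \<Union>e \<in> ?E. (\<lambda>g. \<phi> g b) ` ?T c e)"
  have "finite ?U" using fin finE finT by (intro finite_UnI finite_UN_I[OF fin(1)]
        finite_UN_I[OF fin(2)] finite_UN_I[OF finE] finite_imageI) simp_all
  moreover have "{x \<in> X. \<exists>v \<in> V. \<exists>a \<in> A v. a \<noteq> \<one>\<^bsub>G\<^esub> \<and> \<phi> a x = x} \<subseteq> ?U"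
  proof
    fix x assume "x \<in> {x \<in> X. \<exists>v \<in> V. \<exists>a \<in> A v. a \<noteq> \<one>\<^bsub>G\<^esub> \<and> \<phi> a x = x}"
    then obtain v a where x: "x \<in> X" "v \<in> V" "a \<in> A v" "a \<noteq> \<one>\<^bsub>G\<^esub>" "\<phi> a x = x" by blast
    obtain g where g: "g \<in> carrier G" "x = \<phi> g x0" using transitive[OF x(1)] by blast
    obtain q where "path q" "fst (hd q) = v" "ev q = g" using path_exists[OF g(1) x(2)] .
    then have "controlled v x" using controlled_path g(2) by metis
    then have "x \<in> core v \<or> (\<exists>b \<in> ?B. \<exists>g \<in> carrier G. \<exists>e \<in> edge_elts. x = \<phi> g b \<and> e \<noteq> \<one>\<^bsub>G\<^esub> \<and>
        a \<cdot> g = g \<cdot> e)"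
      unfolding controlled_def using x(3,4,5) by blast
    then consider "x \<in> core v"
      | b g e where "b \<in> ?B" "g \<in> carrier G" "e \<in> edge_elts" "x = \<phi> g b" "e \<noteq> \<one>\<^bsub>G\<^esub>"
        "a \<cdot> g = g \<cdot> e"
      by blast
    then show "x \<in> ?U"
    proof cases
      case 1
      then show ?thesis using x(2) by blast
    next
      case 2
      then have "g \<in> ?T a e" "e \<in> ?E" "a \<in> ?A" using x by auto
      then show ?thesis using 2(1,4) by blast
    qed
  qed
  ultimately show ?thesis by (rule finite_subset[rotated])
qed

end

section \<open>Completing a finite piece of an action\<close>

context rooted_tree_of_groups
begin

text \<open>Taking \<open>k\<close> copies of \<open>X0\<close> allows divisibility to be arranged.
  The last clause says that no new stabilizers appear: a nontrivial element of a vertex group has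
  fixed points only in the copies, over its fixed points in \<open>X\<close>.\<close>

definition is_completion where
  "is_completion X \<phi> X0 k Y \<psi> \<longleftrightarrow>
     finite Y \<and> acts_on G Y \<psi> \<and> (0::nat) < k \<and>
     (\<forall>x \<in> X0. \<forall>i < k. Inl (x, i) \<in> Y) \<and>
     (\<forall>v \<in> V. \<forall>a \<in> A v. \<forall>x \<in> X0. \<forall>i < k. \<phi> a x \<in> X0 \<longrightarrow> \<psi> a (Inl (x, i)) = Inl (\<phi> a x, i)) \<and>
     (\<forall>v \<in> V. \<forall>a \<in> A v. \<forall>y \<in> Y. a \<noteq> \<one>\<^bsub>G\<^esub> \<longrightarrow> \<psi> a y = y \<longrightarrow>
        (\<exists>x i. y = Inl (x, i) \<and> x \<in> X0 \<and> i < k \<and> x \<in> X \<and> \<phi> a x = x))"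

text \<open>
  For every vertex \<open>v\<close> the \<open>A v\<close>-saturation of \<open>k\<close> copies of \<open>X0\<close> is padded by free orbits to an
  \<open>A v\<close>-set \<open>U v\<close> of a size independent of \<open>v\<close>. Off the copies of \<open>X0\<close> the edge groups act freely,
  so that the sets \<open>U v\<close> can be identified compatibly with the edge groups.
\<close>

lemma completion_exists:
  fixes X :: "'x set"
  assumes \<phi>: "acts_on G X \<phi>" and X0: "finite X0" "X0 \<subseteq> X"
    and free: "\<And>v a x. v \<in> V \<Longrightarrow> a \<in> A v \<Longrightarrow> a \<noteq> \<one>\<^bsub>G\<^esub> \<Longrightarrow> x \<in> X \<Longrightarrow> \<phi> a x = x \<Longrightarrow> x \<in> X0"
  shows "\<exists>k (Y :: ('x, 'v, 'e, 'g) piece set) \<psi>. is_completion X \<phi> X0 k Y \<psi>"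
proof -
  \<comment> \<open>A common multiple of the orders of the vertex groups: with this number of
    copies, the number of points to be added at \<open>v\<close> is a multiple of
    \<open>card (A v)\<close>, so whole regular orbits fill the gap.\<close>
  define k where "k = (\<Prod>v \<in> V. card (A v))"
  define B where "B v = (\<lambda>(a, x). \<phi> a x) ` (A v \<times> X0)" for v
  \<comment> \<open>The common size must be divisible by all vertex group orders and be at least
    each \<open>card (B v) * k\<close>; the sum has both properties.\<close>
  define N where "N = (\<Sum>v \<in> V. card (B v) * k)"
  define m where "m v = (N - card (B v) * k) div card (A v)" for v
  define L where "L D = (Inl ` (D \<times> {..<k}) :: ('x, 'v, 'e, 'g) piece set)" for D
  define U where "U v = (L (B v) \<union> Inr ` (A v \<times> {..<m v})
    :: ('x, 'v, 'e, 'g) piece set)" for v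
  define \<chi> where "\<chi> a = map_sum (\<lambda>(x, i::nat). (\<phi> a x, i)) (\<lambda>(g, i::nat). (a \<cdot> g, i))" for a
  \<comment> \<open>The saturation of \<open>X0\<close> under the edge group. Its copies are
    contained in both \<open>U v\<close> and \<open>U (par v)\<close>, where they can be identified
    by the identity.\<close>
  define D where "D v = (\<lambda>(c, x). \<phi> c x) ` (C v \<times> X0)" for v
  have \<chi>_Inl: "\<chi> a (Inl (x, i)) = Inl (\<phi> a x, i)"
    and \<chi>_Inr: "\<chi> a (Inr (g, i)) = Inr (a \<cdot> g, i)" for a x g i
    by (simp_all add: \<chi>_def)
  have card_A: "card (A v) > 0" if "v \<in> V" for v
    using finite_A[OF that] A_one[OF that] by (auto simp: card_gt_0_iff)
  have k: "k > 0" using card_A by (simp add: k_def prod_pos)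
  have dvd_k: "card (A v) dvd k" if "v \<in> V" for v
    using dvd_prodI[OF finite_verts that, of "\<lambda>v. card (A v)"] by (simp add: k_def)
  have finB: "finite (B v)" if "v \<in> V" for v using finite_A[OF that] X0(1) by (simp add: B_def)
  have BX: "B v \<subseteq> X" if v: "v \<in> V" for v
    using acts_onD(1)[OF \<phi> A_in_G[OF v]] X0(2) by (auto simp: B_def)
  have X0B: "X0 \<subseteq> B v" if v: "v \<in> V" for v
  proof
    fix x assume x: "x \<in> X0"
    then have "\<phi> \<one>\<^bsub>G\<^esub> x = x" using acts_onD(2)[OF \<phi>] X0(2) by blast
    then show "x \<in> B v" using A_one[OF v] x by (force simp: B_def)
  qed
  have B_inv: "\<phi> a x \<in> B v" if v: "v \<in> V" and a: "a \<in> A v" and x: "x \<in> B v" for v a x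
  proof -
    obtain b y where yb: "b \<in> A v" "y \<in> X0" "x = \<phi> b y" using x by (auto simp: B_def)
    have "y \<in> X" using yb(2) X0(2) by blast
    from acts_onD(3)[OF \<phi> A_in_G[OF v a] A_in_G[OF v yb(1)] this]
    have "\<phi> a x = \<phi> (a \<cdot> b) y" using yb(3) by simp
    moreover have "a \<cdot> b \<in> A v" using subgroup.m_closed[OF A_subgroup[OF v] a yb(1)] .
    ultimately show ?thesis using yb(2) by (force simp: B_def)
  qed
  have U_cases: "(\<exists>x i. u = Inl (x, i) \<and> x \<in> B v \<and> i < k) \<or> (\<exists>g i. u = Inr (g, i) \<and> g \<in> A v \<and> i < m v)"
    if "u \<in> U v" for u v
    using that by (auto simp: U_def L_def)
  have InlU: "Inl (x, i) \<in> U v \<longleftrightarrow> x \<in> B v \<and> i < k"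
    and InrU: "Inr (g, i) \<in> U v \<longleftrightarrow> g \<in> A v \<and> i < m v" for x g i v
    by (auto simp: U_def L_def)
  have InlL: "Inl (x, i) \<in> L S \<longleftrightarrow> x \<in> S \<and> i < k" and InrL: "Inr y \<notin> L S" for x i y S
    by (auto simp: L_def)
  have finU: "finite (U v)" if "v \<in> V" for v
    using finite_A[OF that] finB[OF that] by (simp add: U_def L_def)
  have cardU: "card (U v) = N" if v: "v \<in> V" for v
  proof -
    have "card (U v) = card (L (B v)) + card (Inr ` (A v \<times> {..<m v})
        :: ('x, 'v, 'e, 'g) piece set)"
      unfolding U_def using finite_A[OF v] finB[OF v] by (intro card_Un_disjoint) (auto simp: L_def disjoint_iff)
    also have "\<dots> = card (B v) * k + card (A v) * m v"
      by (simp add: L_def card_image card_cartesian_product)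
    also have "card (A v) dvd N - card (B v) * k"
      using dvd_k[OF v] by (auto simp: N_def intro!: dvd_diff_nat dvd_sum)
    then have "card (A v) * m v = N - card (B v) * k" by (simp add: m_def)
    also have "card (B v) * k + (N - card (B v) * k) = N"
      using member_le_sum[of v V "\<lambda>v. card (B v) * k"] v finite_verts by (simp add: N_def)
    finally show ?thesis .
  qed
  have \<chi>_act: "acts_on (G\<lparr>carrier := A v\<rparr>) (U v) \<chi>" if v: "v \<in> V" for v
  proof -
    have "\<chi> a u \<in> U v" if "a \<in> A v" "u \<in> U v" for a u
      using U_cases[OF that(2)] B_inv[OF v that(1)] subgroup.m_closed[OF A_subgroup[OF v] that(1)]
      by (elim disjE exE) (simp_all add: \<chi>_Inl \<chi>_Inr InlU InrU)
    moreover have "\<chi> \<one>\<^bsub>G\<^esub> u = u" if "u \<in> U v" for u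
      using U_cases[OF that] BX[OF v] acts_onD(2)[OF \<phi>] A_in_G[OF v]
      by (elim disjE exE) (auto simp: \<chi>_Inl \<chi>_Inr)
    moreover have "\<chi> (a \<cdot> b) u = \<chi> a (\<chi> b u)" if "a \<in> A v" "b \<in> A v" "u \<in> U v" for a b u
      using U_cases[OF that(3)] BX[OF v] acts_onD(3)[OF \<phi>] A_in_G[OF v] that(1,2)
      by (elim disjE exE) (auto simp: \<chi>_Inl \<chi>_Inr G.m_assoc)
    ultimately show ?thesis by (simp add: acts_on_def)
  qed
  have D_inv: "\<phi> c x \<in> D v" if v: "v \<in> V" "v \<noteq> r" and c: "c \<in> C v" and x: "x \<in> D v" for v c x
  proof -
    obtain b y where yb: "b \<in> C v" "y \<in> X0" "x = \<phi> b y" using x by (auto simp: D_def)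
    have G: "c \<in> carrier G" "b \<in> carrier G"
      using subgroup.mem_carrier[OF C_subgroup[OF v]] c yb(1) by blast+
    have "y \<in> X" using yb(2) X0(2) by blast
    from acts_onD(3)[OF \<phi> G this] have "\<phi> c x = \<phi> (c \<cdot> b) y" using yb(3) by simp
    moreover have "c \<cdot> b \<in> C v" using subgroup.m_closed[OF C_subgroup[OF v] c yb(1)] .
    ultimately show ?thesis using yb(2) by (force simp: D_def)
  qed
  have D_B: "D v \<subseteq> B v" "D v \<subseteq> B (par v)" if v: "v \<in> V" "v \<noteq> r" for v
    using C_subset[OF v] by (auto simp: D_def B_def)
  have X0D: "X0 \<subseteq> D v" if v: "v \<in> V" "v \<noteq> r" for v
  proof
    fix x assume x: "x \<in> X0"
    then have "\<phi> \<one>\<^bsub>G\<^esub> x = x" using acts_onD(2)[OF \<phi>] X0(2) by blast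
    then show "x \<in> D v" using subgroup.one_closed[OF C_subgroup[OF v]] x by (force simp: D_def)
  qed
  have \<chi>_free: "u \<in> L X0" if v: "v \<in> V" and a: "a \<in> A v" "a \<noteq> \<one>\<^bsub>G\<^esub>" and u: "u \<in> U v" "\<chi> a u = u" for v a u
    using U_cases[OF u(1)]
  proof (elim disjE exE conjE)
    fix x i assume x: "u = Inl (x, i)" "x \<in> B v" "i < k"
    then have "\<phi> a x = x" using u(2) by (simp add: \<chi>_Inl)
    then have "x \<in> X0" using free[OF v a] BX[OF v] x(2) by blast
    then show ?thesis using x by (simp add: InlL)
  next
    fix g i assume g: "u = Inr (g, i)" "g \<in> A v"
    then have "a \<cdot> g = g" using u(2) by (simp add: \<chi>_Inr)
    then show ?thesis using a A_in_G[OF v] g(2) by simp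
  qed
  \<comment> \<open>Identity on the copies of \<open>D v\<close>. The complements in
    \<open>U v\<close> and \<open>U (par v)\<close> are free \<open>C v\<close>-sets of the same
    size, hence isomorphic.\<close>
  have edge_iso: "\<exists>\<delta>. bij_betw \<delta> (U v) (U (par v)) \<and> (\<forall>c \<in> C v. \<forall>u \<in> U v. \<delta> (\<chi> c u) = \<chi> c (\<delta> u)) \<and>
      (\<forall>u \<in> L X0. \<delta> u = u)"
    if v: "v \<in> V" "v \<noteq> r" for v
  proof -
    let ?p = "par v" and ?C = "G\<lparr>carrier := C v\<rparr>"
    have p: "?p \<in> V" using par[OF v] by simp
    interpret C: group ?C using subgroup.subgroup_is_group[OF C_subgroup[OF v]] G.group_axioms by simp
    note C_sub = C_subset[OF v]
    have LD: "L (D v) \<subseteq> U v" "L (D v) \<subseteq> U ?p" using D_B[OF v] by (auto simp: U_def L_def)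
    have LD_inv: "\<chi> c u \<in> L (D v) \<longleftrightarrow> u \<in> L (D v)" if c: "c \<in> C v" and u: "u \<in> U w" and w: "w \<in> V" for c u w
    proof -
      have cG: "c \<in> carrier G" "inv\<^bsub>G\<^esub> c \<in> C v"
        using subgroup.mem_carrier[OF C_subgroup[OF v] c] subgroup.m_inv_closed[OF C_subgroup[OF v] c] by auto
      show ?thesis
        using U_cases[OF u]
      proof (elim disjE exE conjE)
        fix x i assume x: "u = Inl (x, i)" "x \<in> B w" "i < k"
        then have "\<phi> (inv\<^bsub>G\<^esub> c) (\<phi> c x) = x" using G.acts_on_inv(1)[OF \<phi> cG(1)] BX[OF w] by blast
        then have "\<phi> c x \<in> D v \<longleftrightarrow> x \<in> D v" using D_inv[OF v c, of x] D_inv[OF v cG(2), of "\<phi> c x"] by auto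
        then show ?thesis using x by (simp add: \<chi>_Inl InlL)
      qed (simp add: \<chi>_Inr InrL)
    qed
    have acts: "acts_on ?C (U w - L (D v)) \<chi>" if w: "w \<in> V" "C v \<subseteq> A w" for w
    proof -
      have "c \<in> A w" if "c \<in> C v" for c using that w by blast
      then show ?thesis
        using acts_onD[OF \<chi>_act[OF w(1)]] LD_inv[OF _ _ w(1)] by (simp add: acts_on_def)
    qed
    have frees: "\<forall>c \<in> carrier ?C. \<forall>u \<in> U w - L (D v). \<chi> c u = u \<longrightarrow> c = \<one>\<^bsub>?C\<^esub>"
      if w: "w \<in> V" "C v \<subseteq> A w" for w
    proof (intro ballI impI)
      fix c u assume c: "c \<in> carrier ?C" and u: "u \<in> U w - L (D v)" "\<chi> c u = u"
      have "L X0 \<subseteq> L (D v)" using X0D[OF v] by (auto simp: L_def)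
      then show "c = \<one>\<^bsub>?C\<^esub>" using \<chi>_free[OF w(1), of c u] c u w(2) by auto
    qed
    have "card (U v - L (D v)) = card (U ?p - L (D v))"
      using LD finU v(1) p cardU by (simp add: card_Diff_subset finite_subset)
    then obtain \<delta> where \<delta>: "bij_betw \<delta> (U v - L (D v)) (U ?p - L (D v))"
      "\<forall>c \<in> carrier ?C. \<forall>u \<in> U v - L (D v). \<delta> (\<chi> c u) = \<chi> c (\<delta> u)"
      using C.free_actions_isomorphic[OF _ finite_Diff[OF finU[OF v(1)]] finite_Diff[OF finU[OF p]] _
          acts[OF v(1) C_sub(2)] acts[OF p C_sub(1)] frees[OF v(1) C_sub(2)] frees[OF p C_sub(1)]]
        finite_subset[OF C_sub(2) finite_A[OF v(1)]] by auto
    define \<delta>' where "\<delta>' u = (if u \<in> L (D v) then u else \<delta> u)" for u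
    have "bij_betw \<delta>' (L (D v)) (L (D v))" "bij_betw \<delta>' (U v - L (D v)) (U ?p - L (D v))"
      using bij_betw_cong[of "L (D v)" \<delta>' id "L (D v)"] bij_betw_id
        bij_betw_cong[of "U v - L (D v)" \<delta>' \<delta> "U ?p - L (D v)"] \<delta>(1) by (simp_all add: \<delta>'_def)
    then have "bij_betw \<delta>' (L (D v) \<union> (U v - L (D v))) (L (D v) \<union> (U ?p - L (D v)))"
      by (rule bij_betw_combine) (simp only: Diff_disjoint)
    then have "bij_betw \<delta>' (U v) (U ?p)" using LD by (simp add: Un_absorb1)
    moreover have "\<delta>' (\<chi> c u) = \<chi> c (\<delta>' u)" if "c \<in> C v" "u \<in> U v" for c u
      using \<delta>(2) that LD_inv[OF that v(1)] by (simp add: \<delta>'_def)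
    moreover have "\<delta>' u = u" if "u \<in> L X0" for u
      using that X0D[OF v] by (auto simp: \<delta>'_def L_def)
    ultimately show ?thesis by blast
  qed
  then obtain \<delta> where \<delta>: "\<And>v. v \<in> V \<Longrightarrow> v \<noteq> r \<Longrightarrow> bij_betw (\<delta> v) (U v) (U (par v)) \<and>
      (\<forall>c \<in> C v. \<forall>u \<in> U v. \<delta> v (\<chi> c u) = \<chi> c (\<delta> v u)) \<and> (\<forall>u \<in> L X0. \<delta> v u = u)"
    by metis
  \<comment> \<open>Composing the identifications on the way to the root brings every
    \<open>U v\<close> onto the one set \<open>U r\<close>, always fixing the copies of
    \<open>X0\<close>.\<close>
  obtain \<beta> where \<beta>_r: "\<beta> r = (\<lambda>u. u)" and \<beta>_par: "\<And>v. v \<in> V \<Longrightarrow> v \<noteq> r \<Longrightarrow> \<beta> v = (\<lambda>u. \<beta> (par v) (\<delta> v u))"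
    using tree_recursion[of "\<lambda>u. u" "\<lambda>v f u. f (\<delta> v u)"] by blast
  let ?Y = "U r"
  have \<beta>: "bij_betw (\<beta> v) (U v) ?Y \<and> (\<forall>u \<in> L X0. \<beta> v u = u)" if "v \<in> V" for v
    using that
  proof (induction "rank v" arbitrary: v rule: less_induct)
    case less
    show ?case
    proof (cases "v = r")
      case True
      then show ?thesis using bij_betw_id[of ?Y] by (simp add: \<beta>_r id_def)
    next
      case False
      have p: "bij_betw (\<beta> (par v)) (U (par v)) ?Y" "\<forall>u \<in> L X0. \<beta> (par v) u = u"
        using less.hyps[of "par v"] par[OF less.prems False] by auto
      have "bij_betw (\<beta> (par v) \<circ> \<delta> v) (U v) ?Y"
        using \<delta>[OF less.prems False] p(1) bij_betw_trans by blast
      then show ?thesis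
        using \<beta>_par[OF less.prems False] \<delta>[OF less.prems False] p(2) by (simp add: comp_def)
    qed
  qed
  define \<beta>i where "\<beta>i v = inv_into (U v) (\<beta> v)" for v
  have \<beta>i: "\<beta>i v y \<in> U v" "\<beta> v (\<beta>i v y) = y" if "v \<in> V" "y \<in> ?Y" for v y
    using \<beta>[OF that(1)] that(2) by (auto simp: \<beta>i_def bij_betw_def inv_into_into f_inv_into_f)
  have \<beta>i_\<beta>: "\<beta>i v (\<beta> v u) = u" "\<beta> v u \<in> ?Y" if "v \<in> V" "u \<in> U v" for v u
    using \<beta>[OF that(1)] that(2) bij_betwE[of "\<beta> v" "U v" ?Y] by (auto simp: \<beta>i_def bij_betw_def)
  define \<alpha> where "\<alpha> v a y = \<beta> v (\<chi> a (\<beta>i v y))" for v a y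
  have \<alpha>_act: "acts_on (G\<lparr>carrier := A v\<rparr>) ?Y (\<alpha> v)" if v: "v \<in> V" for v
    using acts_onD[OF \<chi>_act[OF v]] \<beta>i[OF v] \<beta>i_\<beta>[OF v] by (simp add: acts_on_def \<alpha>_def)
  have \<alpha>_agree: "\<alpha> v c y = \<alpha> (par v) c y" if v: "v \<in> V" "v \<noteq> r" and c: "c \<in> C v" and y: "y \<in> ?Y" for v c y
  proof -
    let ?u = "\<beta>i v y"
    have p: "par v \<in> V" using par[OF v] by simp
    have u: "?u \<in> U v" "\<beta> v ?u = y" using \<beta>i[OF v(1) y] by auto
    have \<delta>u: "\<delta> v ?u \<in> U (par v)" using \<delta>[OF v] u(1) bij_betwE by blast
    have "\<beta>i (par v) y = \<delta> v ?u"
      using \<beta>i_\<beta>(1)[OF p \<delta>u] u(2) \<beta>_par[OF v] by simp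
    then show ?thesis
      using \<delta>[OF v] c u(1) \<beta>_par[OF v] by (simp add: \<alpha>_def)
  qed
  obtain \<psi> where \<psi>: "acts_on G ?Y \<psi>" "\<And>v a y. v \<in> V \<Longrightarrow> a \<in> A v \<Longrightarrow> y \<in> ?Y \<Longrightarrow> \<psi> a y = \<alpha> v a y"
    using extend_actions[of ?Y \<alpha>] \<alpha>_act \<alpha>_agree by blast
  have X0Y: "Inl (x, i) \<in> ?Y" if "x \<in> X0" "i < k" for x i
    using X0B[OF root] that by (auto simp: InlU)
  have \<beta>i_X0: "\<beta>i v (Inl (x, i)) = Inl (x, i)" "\<beta> v (Inl (x, i)) = Inl (x, i)"
    if "v \<in> V" "x \<in> X0" "i < k" for v x i
  proof -
    show *: "\<beta> v (Inl (x, i)) = Inl (x, i)" using \<beta>[OF that(1)] that by (simp add: InlL)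
    have "Inl (x, i) \<in> U v" using X0B[OF that(1)] that by (auto simp: InlU)
    then show "\<beta>i v (Inl (x, i)) = Inl (x, i)" using \<beta>i_\<beta>(1)[OF that(1)] * by metis
  qed
  have equivariant: "\<psi> a (Inl (x, i)) = Inl (\<phi> a x, i)"
    if v: "v \<in> V" "a \<in> A v" and x: "x \<in> X0" "\<phi> a x \<in> X0" and i: "i < k" for v a x i
    using \<psi>(2)[OF v X0Y[OF x(1) i]] \<beta>i_X0[OF v(1) x(1) i] \<beta>i_X0(2)[OF v(1) x(2) i]
    by (simp add: \<alpha>_def \<chi>_Inl)
  have nonfree: "\<exists>x i. y = Inl (x, i) \<and> x \<in> X0 \<and> i < k \<and> x \<in> X \<and> \<phi> a x = x"
    if v: "v \<in> V" and a: "a \<in> A v" "a \<noteq> \<one>\<^bsub>G\<^esub>" and y: "y \<in> ?Y" "\<psi> a y = y" for v a y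
  proof -
    have u: "\<beta>i v y \<in> U v" "\<beta> v (\<beta>i v y) = y" using \<beta>i[OF v y(1)] by auto
    have "\<beta> v (\<chi> a (\<beta>i v y)) = y" using \<psi>(2)[OF v a(1) y(1)] y(2) by (simp add: \<alpha>_def)
    then have \<chi>u: "\<chi> a (\<beta>i v y) = \<beta>i v y"
      using \<beta>i_\<beta>(1)[OF v, of "\<chi> a (\<beta>i v y)"] acts_onD(1)[OF \<chi>_act[OF v], of a "\<beta>i v y"] a(1) u(1)
      by simp
    then have "\<beta>i v y \<in> L X0" using \<chi>_free[OF v a u(1)] by simp
    then obtain x i where x: "\<beta>i v y = Inl (x, i)" "x \<in> X0" "i < k" by (auto simp: L_def)
    then have "y = Inl (x, i)" using u(2) \<beta>i_X0(2)[OF v x(2,3)] by simp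
    moreover have "\<phi> a x = x" using \<chi>u x(1) by (simp add: \<chi>_Inl)
    ultimately show ?thesis using x X0(2) by blast
  qed
  have "is_completion X \<phi> X0 k ?Y \<psi>"
    unfolding is_completion_def
    using finU[OF root] \<psi>(1) k X0Y equivariant nonfree by (intro conjI ballI allI impI) blast+
  then show ?thesis by blast
qed

lemma is_completionD:
  assumes "is_completion X \<phi> X0 k Y \<psi>"
  shows "finite Y" and "acts_on G Y \<psi>" and "0 < k"
    and "x \<in> X0 \<Longrightarrow> i < k \<Longrightarrow> Inl (x, i) \<in> Y"
    and "v \<in> V \<Longrightarrow> a \<in> A v \<Longrightarrow> x \<in> X0 \<Longrightarrow> i < k \<Longrightarrow> \<phi> a x \<in> X0 \<Longrightarrow> \<psi> a (Inl (x, i)) = Inl (\<phi> a x, i)"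
    and "v \<in> V \<Longrightarrow> a \<in> A v \<Longrightarrow> y \<in> Y \<Longrightarrow> a \<noteq> \<one>\<^bsub>G\<^esub> \<Longrightarrow> \<psi> a y = y \<Longrightarrow>
      \<exists>x i. y = Inl (x, i) \<and> x \<in> X0 \<and> i < k \<and> x \<in> X \<and> \<phi> a x = x"
  using assms unfolding is_completion_def by simp_all

end

section \<open>Separating finitely generated subgroups in finite quotients\<close>

context rooted_tree_of_groups
begin

section \<open>Trajectories along paths\<close>

primrec visited :: "('v \<times> ('v, 'e, 'g) elt) list \<Rightarrow> ('v, 'e, 'g) elt set" where
  "visited [] = {}"
| "visited (x # q) = insert (ev (x # q)) (visited q)"

lemma finite_visited: "finite (visited q)"
  by (induction q) simp_all

lemma visited_in_G: "path q \<Longrightarrow> g \<in> visited q \<Longrightarrow> g \<in> carrier G"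
proof (induction rule: path_induct)
  case (start a)
  then show ?case using A_in_G[OF root start(1)] by simp
next
  case (step w a q)
  have "ev ((w, a) # q) \<in> carrier G"
    using path_ev_in_G step(1-3) by (simp add: path_ne path_Cons_iff A_in_G[OF adj_in_V(2)])
  then show ?case using step by auto
qed

lemma ev_visited: "q \<noteq> [] \<Longrightarrow> ev q \<in> visited q"
  by (cases q) simp_all

lemma crossings_visited:
  assumes "path q" "(v, w, g) \<in> set (crossings q)" shows "g \<in> visited q"
  using assms
proof (induction rule: path_induct)
  case (step x a q)
  then show ?case
    using ev_visited[OF path_ne[OF step(1)]] by (auto simp: crossings_Cons[OF path_ne[OF step(1)]])
qed simp

lemma visited_subpath:
  assumes "path q" "g \<in> visited q"
  shows "\<exists>q'. path q' \<and> ev q' = g \<and> length q' \<le> length q"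
  using assms
proof (induction rule: path_induct)
  case (start a)
  then show ?case by (intro exI[of _ "[(r, a)]"]) simp
next
  case (step w a q)
  show ?case
  proof (cases "g = ev ((w, a) # q)")
    case True
    then show ?thesis
      using step by (intro exI[of _ "(w, a) # q"]) (simp add: path_Cons_iff path_ne)
  next
    case False
    then obtain q' where "path q'" "ev q' = g" "length q' \<le> length q" using step by auto
    then show ?thesis by (intro exI[of _ q']) simp
  qed
qed

lemma path_appendD: "path (qa @ q) \<Longrightarrow> q \<noteq> [] \<Longrightarrow> path q"
  by (induction qa) (auto simp: path_Cons_iff split: if_splits)

text \<open>The tail of the list is the initial part of the path, so exchanging it for a path with
  the same end and value leaves all later values as they were.\<close>

lemma path_replace:
  assumes "path (qa @ q1)" "path q1" "path q2" "fst (hd q1) = fst (hd q2)" "ev q1 = ev q2"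
  shows "path (qa @ q2)" and "ev (qa @ q2) = ev (qa @ q1)"
    and "visited (qa @ q2) \<subseteq> visited (qa @ q1) \<union> visited q2"
    and "fst (hd (qa @ q2)) = fst (hd (qa @ q1))"
proof -
  have ne: "q1 \<noteq> []" "q2 \<noteq> []" using path_ne assms by auto
  show ev: "ev (qa @ q2) = ev (qa @ q1)" for qa using assms(5) by (induction qa) simp_all
  show "visited (qa @ q2) \<subseteq> visited (qa @ q1) \<union> visited q2"
    using ev by (induction qa) auto
  show hd: "fst (hd (qa @ q2)) = fst (hd (qa @ q1))" for qa
    using assms(4) ne by (cases qa) simp_all
  show "path (qa @ q2)"
    using assms(1)
  proof (induction qa)
    case (Cons x qa)
    have "fst (hd (qa @ q2)) = fst (hd (qa @ q1))" by (rule hd)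
    then show ?case using Cons ne by (cases x) (simp add: path_Cons_iff)
  qed (use assms in simp)
qed

lemma crossings_decomp:
  assumes "path q" "crossings q = cu @ (v2, w2, g2) # (v1, w1, g1) # cv"
  shows "\<exists>qa a2 a1 b qc. q = qa @ (w2, a2) # (w1, a1) # (v1, b) # qc \<and> v2 = w1 \<and>
    g1 = ev ((v1, b) # qc) \<and> g2 = ev ((w1, a1) # (v1, b) # qc)"
  using assms
proof (induction arbitrary: cu rule: path_induct)
  case (step w a q)
  have ne: "q \<noteq> []" using path_ne[OF step(1)] .
  show ?case
  proof (cases cu)
    case Nil
    then have 1: "(v2, w2, g2) = (fst (hd q), w, ev q)" "crossings q = (v1, w1, g1) # cv"
      using step.prems ne by (simp_all add: crossings_Cons)
    obtain x a1 q' where q: "q = (x, a1) # q'" using ne by (cases q) auto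
    have q': "q' \<noteq> []" using 1(2) q by (cases q') auto
    then obtain y b qc where qc: "q' = (y, b) # qc" by (cases q') auto
    show ?thesis
      using 1 q qc by (intro exI[of _ "[]"]) auto
  next
    case (Cons c cu')
    then have "crossings q = cu' @ (v2, w2, g2) # (v1, w1, g1) # cv"
      using step.prems ne by (simp add: crossings_Cons)
    then obtain qa a2 a1 b qc where "q = qa @ (w2, a2) # (w1, a1) # (v1, b) # qc" "v2 = w1"
      "g1 = ev ((v1, b) # qc)" "g2 = ev ((w1, a1) # (v1, b) # qc)"
      using step.IH by blast
    then show ?thesis by (intro exI[of _ "(w, a) # qa"]) auto
  qed
qed simp

lemma length_crossings: "path q \<Longrightarrow> length (crossings q) = length q - 1"
  by (induction rule: path_induct) (auto simp: crossings_Cons path_ne)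

text \<open>Each letter leads from a point of \<open>X0\<close> to a point of \<open>X0\<close>, and
  there the copies imitate \<open>X\<close> by definition of a completion.\<close>

lemma completion_path:
  assumes \<phi>: "acts_on G X \<phi>" and compl: "is_completion X \<phi> X0 k Y \<psi>" and "X0 \<subseteq> X"
    and q: "path q" and x: "x \<in> X0" "i < k" and "\<forall>g \<in> visited q. \<phi> g x \<in> X0"
  shows "\<forall>g \<in> visited q. \<psi> g (Inl (x, i)) = Inl (\<phi> g x, i)"
  using q assms(7)
proof (induction rule: path_induct)
  case (start a)
  then show ?case
    using is_completionD(5)[OF compl root start(1) x] A_in_G[OF root start(1)] by simp
next
  case (step w a q)
  have w: "w \<in> V" using adj_in_V step(2) by blast
  have a: "a \<in> carrier G" using A_in_G[OF w step(3)] .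
  have g: "ev q \<in> carrier G" using path_ev_in_G[OF step(1)] .
  have vis: "ev q \<in> visited q" using ev_visited[OF path_ne[OF step(1)]] .
  have IH: "\<forall>g \<in> visited q. \<psi> g (Inl (x, i)) = Inl (\<phi> g x, i)" using step by simp
  have x_in: "x \<in> X" "\<phi> (ev q) x \<in> X0" "\<phi> (a \<cdot> ev q) x \<in> X0"
    using x assms(3) step.prems vis by auto
  have "\<psi> (a \<cdot> ev q) (Inl (x, i)) = \<psi> a (Inl (\<phi> (ev q) x, i))"
    using acts_onD(3)[OF is_completionD(2)[OF compl] a g is_completionD(4)[OF compl x]] IH vis by simp
  also have "\<dots> = Inl (\<phi> (a \<cdot> ev q) x, i)"
    using is_completionD(5)[OF compl w step(3) x_in(2) x(2)] x_in(3) acts_onD(3)[OF \<phi> a g x_in(1)] by simp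
  finally show ?case using IH by simp
qed

end

section \<open>Balls in the pointed action\<close>

context pointed_action
begin

text \<open>One further letter from any vertex group; the iterates are the balls around
  \<open>S\<close> in the Schreier graph.\<close>

definition nb :: "'x set \<Rightarrow> 'x set" where
  "nb S = S \<union> (\<Union>v \<in> V. \<Union>a \<in> A v. \<phi> a ` S)"

lemma nb_subset: "S \<subseteq> X \<Longrightarrow> nb S \<subseteq> X"
proof
  fix x assume S: "S \<subseteq> X" and "x \<in> nb S"
  then consider "x \<in> S" | v a y where "v \<in> V" "a \<in> A v" "y \<in> S" "x = \<phi> a y"
    unfolding nb_def by blast
  then show "x \<in> X"
    using S \<phi>_in A_in_G by cases auto
qed

lemma finite_nb: "finite S \<Longrightarrow> finite (nb S)"
  unfolding nb_def using finite_verts finite_A by blast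

lemma nb_act: "v \<in> V \<Longrightarrow> a \<in> A v \<Longrightarrow> x \<in> S \<Longrightarrow> \<phi> a x \<in> nb S"
  unfolding nb_def by blast

lemma nb_pow_subset: "S \<subseteq> X \<Longrightarrow> (nb ^^ m) S \<subseteq> X"
  by (induction m) (simp_all add: nb_subset)

lemma finite_nb_pow: "finite S \<Longrightarrow> finite ((nb ^^ m) S)"
  by (induction m) (simp_all add: finite_nb)

lemma nb_pow_mono: "m \<le> n \<Longrightarrow> (nb ^^ m) S \<subseteq> (nb ^^ n) S"
  by (induction rule: dec_induct) (auto simp: nb_def)

lemma nb_pow_path:
  assumes S: "S \<subseteq> X" and x: "x \<in> (nb ^^ m) S" and q: "path q"
  shows "\<forall>g \<in> visited q. \<phi> g x \<in> (nb ^^ (m + length q)) S"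
  using q
proof (induction rule: path_induct)
  case (start a)
  then show ?case using nb_act[OF root start x] A_in_G[OF root start] by simp
next
  case (step w a q)
  have w: "w \<in> V" using adj_in_V step(2) by blast
  have a: "a \<in> carrier G" using A_in_G[OF w step(3)] .
  have g: "ev q \<in> carrier G" using path_ev_in_G[OF step(1)] .
  have vis: "ev q \<in> visited q" using ev_visited[OF path_ne[OF step(1)]] .
  have xX: "x \<in> X" using nb_pow_subset[OF S] x by blast
  have "\<phi> (a \<cdot> ev q) x \<in> (nb ^^ (m + length ((w, a) # q))) S"
    using nb_act[OF w step(3), of "\<phi> (ev q) x"] step(4) vis \<phi>_mult[OF a g xX] by simp
  moreover have "(nb ^^ (m + length q)) S \<subseteq> (nb ^^ (m + length ((w, a) # q))) S"
    by (rule nb_pow_mono) simp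
  ultimately show ?case using step(4) by auto
qed

lemma completion_act_back:
  assumes compl: "is_completion X \<phi> ((nb ^^ M) S) k Y \<psi>"
    and v: "v \<in> V" "a \<in> A v" and z: "z \<in> Y" "\<psi> a z = Inl (x, i)" "i < k"
    and x: "x \<in> (nb ^^ m) S" "Suc m \<le> M"
  shows "z = Inl (\<phi> (inv\<^bsub>G\<^esub> a) x, i)" and "\<phi> (inv\<^bsub>G\<^esub> a) x \<in> (nb ^^ Suc m) S"
proof -
  have a: "a \<in> carrier G" "inv\<^bsub>G\<^esub> a \<in> A v"
    using A_in_G v subgroup.m_inv_closed[OF A_subgroup] by auto
  show ax: "\<phi> (inv\<^bsub>G\<^esub> a) x \<in> (nb ^^ Suc m) S" using nb_act[OF v(1) a(2) x(1)] by simp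
  then have "\<phi> (inv\<^bsub>G\<^esub> a) x \<in> (nb ^^ M) S" "x \<in> (nb ^^ M) S"
    using nb_pow_mono[OF x(2)] nb_pow_mono[of m M] x by auto
  then have "\<psi> (inv\<^bsub>G\<^esub> a) (Inl (x, i)) = Inl (\<phi> (inv\<^bsub>G\<^esub> a) x, i)"
    using is_completionD(5)[OF compl v(1) a(2) _ z(3)] by simp
  then show "z = Inl (\<phi> (inv\<^bsub>G\<^esub> a) x, i)"
    using G.acts_on_inv(1)[OF is_completionD(2)[OF compl] a(1) z(1)] z(2) by simp
qed

text \<open>The letters are undone one at a time, the last one first. Each costs one unit of radius,
  hence the bound on \<open>m + length q\<close>.\<close>

lemma completion_path_back:
  assumes compl: "is_completion X \<phi> ((nb ^^ M) S) k Y \<psi>"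
    and q: "path q" and y: "y \<in> Y"
    and "\<psi> (ev q) y = Inl (x, i)" "i < k" "x \<in> (nb ^^ m) S" "m + length q \<le> M"
  shows "\<exists>x'. y = Inl (x', i) \<and> x' \<in> (nb ^^ (m + length q)) S"
  using q assms(4-7)
proof (induction arbitrary: x m rule: path_induct)
  case (start a)
  then have "\<psi> a y = Inl (x, i)" using A_in_G[OF root start(1)] by simp
  from completion_act_back[OF compl root start(1) y this start(3,4)] start(5) show ?case by simp
next
  case (step w a q)
  have w: "w \<in> V" using adj_in_V step(2) by blast
  have a: "a \<in> carrier G" using A_in_G[OF w step(3)] .
  have g: "ev q \<in> carrier G" using path_ev_in_G[OF step(1)] .
  have z: "\<psi> (ev q) y \<in> Y" using acts_onD(1)[OF is_completionD(2)[OF compl] g y] .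
  have "\<psi> a (\<psi> (ev q) y) = Inl (x, i)"
    using step.prems(1) acts_onD(3)[OF is_completionD(2)[OF compl] a g y] by simp
  from completion_act_back[OF compl w step(3) z this step.prems(2,3)] step.prems(4)
  have "\<psi> (ev q) y = Inl (\<phi> (inv\<^bsub>G\<^esub> a) x, i)" "\<phi> (inv\<^bsub>G\<^esub> a) x \<in> (nb ^^ Suc m) S" by simp_all
  from step.IH[OF this(1) step.prems(2) this(2)] step.prems(4) show ?case by simp
qed

text \<open>What must be kept from \<open>X\<close>: the nonfree points, so that all else can be
  completed freely, and the trajectories of the generating loops, so that these still close up at
  \<open>x0\<close>.\<close>

definition basis :: "'x set" where
  "basis = insert x0 ({x \<in> X. \<exists>v \<in> V. \<exists>a \<in> A v. a \<noteq> \<one>\<^bsub>G\<^esub> \<and> \<phi> a x = x}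
     \<union> (\<Union>q \<in> Q. (\<lambda>g. \<phi> g x0) ` visited q))"

lemma basis_subset: "basis \<subseteq> X"
proof -
  have "\<phi> g x0 \<in> X" if "q \<in> Q" "g \<in> visited q" for q g
    using \<phi>_in[OF visited_in_G x0] Q_loops that by blast
  then show ?thesis using x0 by (auto simp: basis_def)
qed

lemma basis_nonfree: "v \<in> V \<Longrightarrow> a \<in> A v \<Longrightarrow> a \<noteq> \<one>\<^bsub>G\<^esub> \<Longrightarrow> x \<in> X \<Longrightarrow> \<phi> a x = x \<Longrightarrow> x \<in> basis"
  unfolding basis_def by blast

lemma basis_visited: "q \<in> Q \<Longrightarrow> g \<in> visited q \<Longrightarrow> \<phi> g x0 \<in> basis"
  unfolding basis_def by blast

lemma basis_x0: "x0 \<in> basis"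
  unfolding basis_def by blast


lemma finite_basis: "centralizers_finite \<Longrightarrow> finite basis"
  unfolding basis_def using finite_nonfree finite_Q finite_visited by simp

lemma complete_basis:
  assumes "basis \<subseteq> X0" "finite X0" "X0 \<subseteq> X"
  shows "\<exists>k (Y :: ('x, 'v, 'e, 'g) piece set) \<psi>. is_completion X \<phi> X0 k Y \<psi>"
  by (rule completion_exists[OF \<phi> assms(2,3)]) (use basis_nonfree assms(1) in blast)

section \<open>Finite quotients obtained from the pointed action\<close>

lemma fixed_by_generate:
  assumes "acts_on G Y \<psi>" "T \<subseteq> carrier G" "y \<in> Y" "\<forall>t \<in> T. \<psi> t y = y" "h \<in> generate G T"
  shows "\<psi> h y = y"
  using assms(5)
proof (induction rule: generate.induct)
  case (inv h)
  then have "h \<in> carrier G" "\<psi> h y = y" using assms(2,4) by auto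
  then show ?case using G.acts_on_inv(1)[OF assms(1) _ assms(3), of h] by simp
next
  case (eng h1 h2)
  then show ?case
    using acts_onD(3)[OF assms(1) _ _ assms(3)] G.generate_in_carrier[OF assms(2)] by simp
qed (use assms acts_onD in auto)

lemma evs_in_G: "\<forall>q \<in> T. path q \<Longrightarrow> ev ` T \<subseteq> carrier G"
  using path_ev_in_G by blast

text \<open>The piece only has to contain the trajectory of \<open>x0\<close> along a path for
  \<open>g\<close> as well. In its completion, without any twist, the subgroup fixes the copy of
  \<open>x0\<close>, and \<open>g\<close> moves it to the copy of another point of
  \<open>X\<close>.\<close>

lemma separate_element:
  assumes "centralizers_finite" and g: "g \<in> carrier G" "\<phi> g x0 \<noteq> x0"
  shows "\<exists>(P :: nat monoid) \<Phi>. group P \<and> finite (carrier P) \<and> \<Phi> \<in> hom G P \<and>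
    \<Phi> g \<notin> \<Phi> ` generate G (ev ` Q)"
proof -
  obtain q0 where q0: "path q0" "fst (hd q0) = r" "ev q0 = g" using path_exists[OF g(1) root] .
  define X0 where "X0 = basis \<union> (\<lambda>h. \<phi> h x0) ` visited q0"
  have X0X: "X0 \<subseteq> X"
    using basis_subset \<phi>_in[OF visited_in_G[OF q0(1)] x0] unfolding X0_def by blast
  have finX0: "finite X0" using finite_basis[OF assms(1)] finite_visited by (simp add: X0_def)
  have "basis \<subseteq> X0" by (simp add: X0_def)
  then obtain k and Y :: "('x, 'v, 'e, 'g) piece set" and \<psi>
    where compl: "is_completion X \<phi> X0 k Y \<psi>"
    using complete_basis[OF _ finX0 X0X] by blast
  have k: "0 < k" using is_completionD(3)[OF compl] .
  have x0_in: "x0 \<in> X0" using basis_x0 by (simp add: X0_def)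
  have lift: "\<psi> (ev q) (Inl (x0, 0)) = Inl (\<phi> (ev q) x0, 0)"
    if q: "path q" and vis: "\<forall>h \<in> visited q. \<phi> h x0 \<in> X0" for q
    using completion_path[OF \<phi> compl X0X q x0_in k vis] ev_visited[OF path_ne[OF q]] by blast
  let ?y = "Inl (x0, 0)"
  have Q_fix: "\<forall>t \<in> ev ` Q. \<psi> t ?y = ?y"
    using lift Q_loops basis_visited by (simp add: X0_def)
  have g_moves: "\<psi> g ?y \<noteq> ?y"
    using lift[OF q0(1)] q0(3) g(2) by (simp add: X0_def)
  have \<psi>: "acts_on G Y \<psi>" and y: "?y \<in> Y"
    using is_completionD(2)[OF compl] is_completionD(4)[OF compl x0_in k] by auto
  have QG: "ev ` Q \<subseteq> carrier G" using evs_in_G Q_loops by blast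
  obtain P :: "nat monoid" and \<Phi> \<chi> where P: "group P" "finite (carrier P)" "\<Phi> \<in> hom G P"
    and \<chi>: "\<forall>g \<in> carrier G. \<forall>y \<in> Y. \<chi> (\<Phi> g) y = \<psi> g y"
    using G.action_quotient[OF is_completionD(1)[OF compl] \<psi>] by blast
  have "\<Phi> g \<noteq> \<Phi> h" if h: "h \<in> generate G (ev ` Q)" for h
    using fixed_by_generate[OF \<psi> QG y Q_fix h] g_moves \<chi> y g(1)
      G.generate_in_carrier[OF QG h] by metis
  then show ?thesis using P by blast
qed

text \<open>Points outside \<open>Z\<close> have trivial stabilizers in the vertex groups. A
  backtracking pair of crossings encloses a letter that acts on its point like an edge element
  \<open>c\<close>; by freeness it equals \<open>c\<close>, and the three steps around it merge into
  one. The value is unchanged and no new point is visited. What remains in the end is a single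
  letter fixing \<open>y\<close>.\<close>

lemma reduce_path:
  assumes \<psi>: "acts_on G Y \<psi>" and y: "y \<in> Y"
    and free: "\<And>v a z. v \<in> V \<Longrightarrow> a \<in> A v \<Longrightarrow> z \<in> Y \<Longrightarrow> \<psi> a z = z \<Longrightarrow> z \<notin> Z \<Longrightarrow> a = \<one>\<^bsub>G\<^esub>"
    and backtrack: "\<And>q. path q \<Longrightarrow> fst (hd q) = r \<Longrightarrow> length q \<le> n \<Longrightarrow> \<forall>g \<in> visited q. \<psi> g y \<notin> Z \<Longrightarrow>
      ev q = t \<Longrightarrow> crossings q \<noteq> [] \<Longrightarrow>
      \<exists>cu v w g2 g1 cv. crossings q = cu @ (v, w, g2) # (w, v, g1) # cv \<and>
        (\<exists>c \<in> E w v. \<psi> g2 y = \<psi> c (\<psi> g1 y))"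
    and q: "path q" "fst (hd q) = r" "length q \<le> n" "\<forall>g \<in> visited q. \<psi> g y \<notin> Z" "ev q = t"
    and t: "\<psi> t y = y"
  shows "t = \<one>\<^bsub>G\<^esub>"
  using q
proof (induction "length q" arbitrary: q rule: less_induct)
  case less
  show ?case
  proof (cases "crossings q = []")
    case True
    then obtain a where a: "q = [(r, a)]" "a \<in> A r"
      using less.prems(1,2) by (cases q rule: crossings.cases) auto
    have "\<psi> a y = y" "ev q = a" using a t less.prems(5) A_in_G[OF root a(2)] by auto
    moreover have "a = t" using a less.prems(5) A_in_G[OF root a(2)] by simp
    ultimately show ?thesis
      using free[OF root a(2) y] less.prems(4) a(1) by auto
  next
    case False
    obtain cu v w g2 g1 cv c where cr: "crossings q = cu @ (v, w, g2) # (w, v, g1) # cv"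
      and c: "c \<in> E w v" "\<psi> g2 y = \<psi> c (\<psi> g1 y)"
      using backtrack[OF less.prems False] by blast
    obtain qa a2 a1 b qc where q: "q = qa @ (w, a2) # (v, a1) # (w, b) # qc"
      and g: "g1 = ev ((w, b) # qc)" "g2 = ev ((v, a1) # (w, b) # qc)"
      using crossings_decomp[OF less.prems(1) cr] by blast
    let ?q1 = "(w, a2) # (v, a1) # (w, b) # qc" and ?q3 = "(w, b) # qc"
    have q1: "path ?q1" using path_appendD less.prems(1) q by blast
    then have q2: "path ((v, a1) # ?q3)" "path ?q3" and adj: "adj v w" "adj w v"
      and a2: "a2 \<in> A w" and a1: "a1 \<in> A v" and bA: "b \<in> A w"
      by (simp_all add: path_Cons_iff split: if_splits)
    have V: "v \<in> V" "w \<in> V" using adj_in_V[OF adj(1)] by auto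
    have G: "a2 \<in> carrier G" "a1 \<in> carrier G" "b \<in> carrier G" "g1 \<in> carrier G" "c \<in> carrier G"
      using A_in_G V a1 a2 bA path_ev_in_G[OF q2(2)] g(1) E_in_G[OF adj(2) c(1)] by auto
    have evqc: "ev qc \<in> carrier G"
      using q2(2) path_ev_in_G by (cases "qc = []") (auto simp: path_Cons_iff)
    have g1_vis: "g1 \<in> visited q"
      using crossings_visited[OF less.prems(1), of w v g1] cr by simp
    have p: "\<psi> g1 y \<in> Y" "\<psi> g1 y \<notin> Z" using acts_onD(1)[OF \<psi> G(4) y] less.prems(4) g1_vis by auto
    have "\<psi> a1 (\<psi> g1 y) = \<psi> c (\<psi> g1 y)"
      using c(2) g acts_onD(3)[OF \<psi> G(2,4) y] by simp
    then have "\<psi> (inv\<^bsub>G\<^esub> c \<cdot> a1) (\<psi> g1 y) = \<psi> g1 y"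
      using acts_onD(3)[OF \<psi> _ G(2) p(1)] G.acts_on_inv(1)[OF \<psi> G(5) p(1)] G by simp
    moreover have "inv\<^bsub>G\<^esub> c \<cdot> a1 \<in> A v"
      using E_subset(2)[OF adj(2)] subgroup.m_inv_closed[OF E_subgroup[OF adj(2)] c(1)] a1
        subgroup.m_closed[OF A_subgroup[OF V(1)]] by blast
    ultimately have "inv\<^bsub>G\<^esub> c \<cdot> a1 = \<one>\<^bsub>G\<^esub>" using free[OF V(1) _ p(1)] p(2) by blast
    then have "a1 = c" using G by (metis G.inv_equality G.inv_inv G.inv_closed)
    then have a1w: "a1 \<in> A w" using E_subset(1)[OF adj(2)] c(1) by blast
    let ?m = "a2 \<cdot> (a1 \<cdot> b)"
    let ?q2 = "(w, ?m) # qc"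
    have "?m \<in> A w" using subgroup.m_closed[OF A_subgroup[OF V(2)]] a2 a1w bA by simp
    then have pq2: "path ?q2" using q2(2) by (simp add: path_Cons_iff)
    have ev_eq: "ev ?q1 = ev ?q2" using G evqc by (simp add: G.m_assoc)
    have pathq1: "path (qa @ ?q1)" using less.prems(1) q by simp
    note rep = path_replace[OF pathq1 q1 pq2 _ ev_eq]
    have "visited ?q2 \<subseteq> visited ?q1" using ev_eq by auto
    moreover have "visited ?q1 \<subseteq> visited (qa @ ?q1)" by (induction qa) auto
    ultimately have vis: "visited (qa @ ?q2) \<subseteq> visited q" using rep(3) q by auto
    show ?thesis
    proof (rule less.hyps)
      show "length (qa @ ?q2) < length q" "length (qa @ ?q2) \<le> n" using q less.prems(3) by simp_all
      show "path (qa @ ?q2)" using rep(1) by simp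
      show "fst (hd (qa @ ?q2)) = r" using rep(4) less.prems(2) q by simp
      show "\<forall>g \<in> visited (qa @ ?q2). \<psi> g y \<notin> Z" using vis less.prems(4) by blast
      show "ev (qa @ ?q2) = t" using rep(2) less.prems(5) q by simp
    qed
  qed
qed

text \<open>A containment in the conjugate by \<open>p\<close> would make every generator from
  \<open>T\<close> fix the \<open>p\<close>-translate of a point fixed by \<open>Q\<close>. So the
  twisted completion only has to have a point fixed by all of \<open>Q\<close> and none fixed by all
  of \<open>T\<close>.\<close>

lemma separate_into:
  assumes fin: "centralizers_finite" "finite T"
    and T: "\<forall>t \<in> T. path t \<and> fst (hd t) = r"
    and no_fix: "\<not> (\<exists>x \<in> X. \<forall>t \<in> T. \<phi> (ev t) x = x)"
  shows "\<exists>(P :: nat monoid) \<Phi>. group P \<and> finite (carrier P) \<and> \<Phi> \<in> hom G P \<and>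
    \<not> (\<exists>p \<in> carrier P. \<Phi> ` generate G (ev ` T) \<subseteq> p <#\<^bsub>P\<^esub> (\<Phi> ` generate G (ev ` Q)) #>\<^bsub>P\<^esub> inv\<^bsub>P\<^esub> p)"
proof -
  define n where "n = Max (insert 0 (length ` T))"
  have n: "length t \<le> n" if "t \<in> T" for t using that fin(2) by (simp add: n_def)
  \<comment> \<open>The radius needed: one to reach \<open>nb basis\<close>, at most
    \<open>n\<close> letters from there back to a fixed point of \<open>T\<close>, and at most
    \<open>n\<close> letters forward again along each path of \<open>T\<close>.\<close>
  define M where "M = Suc (n + n)"
  define X0 where "X0 = (nb ^^ M) basis"
  have X0X: "X0 \<subseteq> X" using nb_pow_subset[OF basis_subset] by (simp add: X0_def)
  have finX0: "finite X0" using finite_nb_pow[OF finite_basis[OF fin(1)]] by (simp add: X0_def)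
  have basis_X0: "basis \<subseteq> X0" using nb_pow_mono[of 0 M basis] by (simp add: X0_def)
  have nb_X0: "nb basis \<subseteq> X0" using nb_pow_mono[of 1 M basis] by (simp add: X0_def M_def)
  obtain k and Y :: "('x, 'v, 'e, 'g) piece set" and \<psi>
    where compl: "is_completion X \<phi> X0 k Y \<psi>"
    using complete_basis[OF basis_X0 finX0 X0X] by blast
  have finY: "finite Y" and \<psi>: "acts_on G Y \<psi>" and k: "0 < k" using is_completionD(1-3)[OF compl] .
  define copies where "copies S = (Inl ` (S \<times> {..<k})
    :: ('x, 'v, 'e, 'g) piece set)" for S
  \<comment> \<open>Orbits of the edge groups on \<open>Y\<close> are the edges of its quotient
    graph. \<open>Lb\<close> consists of these edges in both orientations, and \<open>up\<close>
    selects one of the two, as \<open>finite_free_action\<close> requires.\<close>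
  define orb where "orb v w y = (\<lambda>c. \<psi> c y) ` E v w" for v w y
  define outer where "outer v w y \<longleftrightarrow> (\<forall>z \<in> orb v w y. z \<notin> copies basis)" for v w y
  define Lb where "Lb = {(v, w, O'). adj v w \<and> O' \<in> orb v w ` Y}"
  define rev where "rev = (\<lambda>(v :: 'v, w :: 'v, O' :: ('x, 'v, 'e, 'g) piece set). (w, v, O'))"
  define up where "up = (\<lambda>(v, w, O' :: ('x, 'v, 'e, 'g) piece set). v \<noteq> r \<and> par v = w)"
  have orb_sym: "orb v w y = orb w v y" if "adj v w" for v w y
    using E_sym[OF that] by (simp add: orb_def)
  have orb_E: "orb v w (\<psi> c y) = orb v w y" if vw: "adj v w" and c: "c \<in> E v w" and y: "y \<in> Y" for v w c y
  proof -
    have cG: "c \<in> carrier G" using E_in_G[OF vw c] .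
    have sub: "orb v w (\<psi> c y) \<subseteq> orb v w y" if "c \<in> E v w" "y \<in> Y" for c y
    proof
      fix z assume "z \<in> orb v w (\<psi> c y)"
      then obtain c' where c': "c' \<in> E v w" "z = \<psi> c' (\<psi> c y)" by (auto simp: orb_def)
      then have "z = \<psi> (c' \<cdot> c) y"
        using acts_onD(3)[OF \<psi> E_in_G[OF vw c'(1)] E_in_G[OF vw that(1)] that(2)] by simp
      then show "z \<in> orb v w y"
        using subgroup.m_closed[OF E_subgroup[OF vw] c'(1) that(1)] by (simp add: orb_def)
    qed
    have "orb v w (\<psi> (inv\<^bsub>G\<^esub> c) (\<psi> c y)) \<subseteq> orb v w (\<psi> c y)"
      using sub[OF subgroup.m_inv_closed[OF E_subgroup[OF vw] c]] acts_onD(1)[OF \<psi> cG y] .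
    then show ?thesis using sub[OF c y] G.acts_on_inv(1)[OF \<psi> cG y] by (simp add: subset_antisym)
  qed
  have orb_self: "y \<in> orb v w y" if "adj v w" "y \<in> Y" for v w y
    using subgroup.one_closed[OF E_subgroup[OF that(1)]] acts_onD(2)[OF \<psi> that(2)]
    by (force simp: orb_def)
  have finLb: "finite Lb"
  proof -
    have "Lb \<subseteq> V \<times> V \<times> (\<Union>v \<in> V. \<Union>w \<in> V. orb v w ` Y)"
      unfolding Lb_def using adj_in_V by blast
    then show ?thesis by (rule finite_subset) (simp add: finite_verts finY)
  qed
  have rev_Lb: "rev l \<in> Lb \<and> rev (rev l) = l \<and> (up (rev l) \<longleftrightarrow> \<not> up l)" if "l \<in> Lb" for l
  proof -
    obtain v w O' where l: "l = (v, w, O')" by (cases l) auto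
    then have vw: "adj v w" "O' \<in> orb v w ` Y" using that by (auto simp: Lb_def)
    have "orb v w = orb w v" using orb_sym[OF vw(1)] by (simp add: fun_eq_iff)
    then show ?thesis
      using vw adj_sym[of v w] adj_oriented[OF vw(1)] by (simp add: l rev_def up_def Lb_def)
  qed
  have "\<exists>(S :: (('v \<times> 'v \<times> ('x, 'v, 'e, 'g) piece set) list \<Rightarrow>
      ('v \<times> 'v \<times> ('x, 'v, 'e, 'g) piece set) list) set) \<rho>. finite S \<and> S \<noteq> {} \<and>
      (\<forall>l \<in> Lb. \<forall>s \<in> S. \<rho> l s \<in> S \<and> \<rho> (rev l) (\<rho> l s) = s) \<and>
      (\<forall>w s. set w \<subseteq> Lb \<longrightarrow> w \<noteq> [] \<longrightarrow> length w \<le> n \<longrightarrow> s \<in> S \<longrightarrow> foldr \<rho> w s = s \<longrightarrow>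
        (\<exists>u l v. w = u @ l # rev l # v))"
    by (rule finite_free_action[of Lb rev up n, OF finLb]) (rule rev_Lb)
  then obtain S :: "(('v \<times> 'v \<times> ('x, 'v, 'e, 'g) piece set) list \<Rightarrow>
      ('v \<times> 'v \<times> ('x, 'v, 'e, 'g) piece set) list) set" and \<rho>
    where S\<rho>: "finite S \<and> S \<noteq> {} \<and>
      (\<forall>l \<in> Lb. \<forall>s \<in> S. \<rho> l s \<in> S \<and> \<rho> (rev l) (\<rho> l s) = s) \<and>
      (\<forall>w s. set w \<subseteq> Lb \<longrightarrow> w \<noteq> [] \<longrightarrow> length w \<le> n \<longrightarrow> s \<in> S \<longrightarrow> foldr \<rho> w s = s \<longrightarrow>
        (\<exists>u l v. w = u @ l # rev l # v))"
    by (elim exE) (rule that)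
  then have S: "finite S" "S \<noteq> {}"
    and \<rho>_in: "\<And>l s. l \<in> Lb \<Longrightarrow> s \<in> S \<Longrightarrow> \<rho> l s \<in> S"
    and \<rho>_rev: "\<And>l s. l \<in> Lb \<Longrightarrow> s \<in> S \<Longrightarrow> \<rho> (rev l) (\<rho> l s) = s"
    and \<rho>_free: "\<And>w s. set w \<subseteq> Lb \<Longrightarrow> w \<noteq> [] \<Longrightarrow> length w \<le> n \<Longrightarrow> s \<in> S \<Longrightarrow> foldr \<rho> w s = s \<Longrightarrow>
      \<exists>u l v. w = u @ l # rev l # v"
    by simp_all
  \<comment> \<open>Edges that meet a copy of \<open>basis\<close> stay untwisted, so that the
    generating loops still fix a point over \<open>?y0\<close>.\<close>
  define \<sigma> where "\<sigma> v w y = (if outer v w y then \<rho> (v, w, orb v w y) else id)" for v w y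
  have Lb_in: "(v, w, orb v w y) \<in> Lb" if "adj v w" "y \<in> Y" for v w y
    using that by (simp add: Lb_def)
  have "\<sigma> v w y s \<in> S" if "adj v w" "y \<in> Y" "s \<in> S" for v w y s
    using \<rho>_in[OF Lb_in] that by (simp add: \<sigma>_def)
  moreover have "\<sigma> w v y (\<sigma> v w y s) = s" if "adj v w" "y \<in> Y" "s \<in> S" for v w y s
    using \<rho>_rev[OF Lb_in[OF that(1,2)] that(3)] orb_sym[OF that(1)]
    by (simp add: \<sigma>_def outer_def rev_def)
  moreover have "\<sigma> v w (\<psi> c y) = \<sigma> v w y" if "adj v w" "y \<in> Y" "c \<in> E v w" for v w y c
    using orb_E[OF that(1,3,2)] by (simp add: \<sigma>_def outer_def)
  ultimately obtain \<Psi> \<theta> where tw: "is_twist Y \<psi> S \<sigma> \<Psi> \<theta>"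
    using twist_exists[OF \<psi>, of S \<sigma>] by blast
  note \<Psi> = is_twistD(1)[OF tw]
  have fst_\<Psi>: "fst (\<Psi> (ev q) (y, s)) = \<psi> (ev q) y" if "path q" "y \<in> Y" "s \<in> S" for q y s
    using is_twistD(5)[OF tw path_ev_in_G[OF that(1)] that(2,3)] .
  have snd_\<Psi>: "snd (\<Psi> (ev q) (y, s)) = foldr (\<lambda>(v, w, g). \<sigma> v w (\<psi> g y)) (crossings q) s"
    if "path q" "fst (hd q) = r" "y \<in> Y" "s \<in> S" for q y s
    using twisted_path[OF \<psi> tw that(1,3,4)] that(2) is_twistD(3)[OF tw] by simp
  obtain s0 where s0: "s0 \<in> S" using S(2) by (metis ex_in_conv)
  let ?y0 = "Inl (x0, 0)"
  have x0_X0: "x0 \<in> X0" using basis_x0 basis_X0 by blast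
  have y0: "?y0 \<in> Y" using is_completionD(4)[OF compl x0_X0 k] .
  have Q_fix: "\<Psi> (ev q) (?y0, s0) = (?y0, s0)" if q: "q \<in> Q" for q
  proof -
    have pq: "path q" "fst (hd q) = r" "\<phi> (ev q) x0 = x0" using Q_loops[OF q] by auto
    have vis: "\<forall>g \<in> visited q. \<psi> g ?y0 = Inl (\<phi> g x0, 0)"
      using completion_path[OF \<phi> compl X0X pq(1) x0_X0 k] basis_visited[OF q] basis_X0 by blast
    have "\<psi> (ev q) ?y0 = ?y0" using vis ev_visited[OF path_ne[OF pq(1)]] pq(3) by simp
    moreover have "\<sigma> v w (\<psi> g ?y0) = id" if "(v, w, g) \<in> set (crossings q)" for v w g
    proof -
      have "g \<in> visited q" using crossings_visited[OF pq(1) that] .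
      then have "\<psi> g ?y0 \<in> copies basis" using vis basis_visited[OF q] k by (simp add: copies_def)
      moreover have "\<psi> g ?y0 \<in> orb v w (\<psi> g ?y0)"
        using orb_self path_crossings[OF pq(1) that] acts_onD(1)[OF \<psi> _ y0] by blast
      ultimately show ?thesis by (auto simp: \<sigma>_def outer_def)
    qed
    then have "foldr (\<lambda>(v, w, g). \<sigma> v w (\<psi> g ?y0)) cs s0 = s0" if "set cs \<subseteq> set (crossings q)" for cs
      using that by (induction cs) auto
    then have "foldr (\<lambda>(v, w, g). \<sigma> v w (\<psi> g ?y0)) (crossings q) s0 = s0" by blast
    ultimately show ?thesis
      using fst_\<Psi>[OF pq(1) y0 s0] snd_\<Psi>[OF pq(1,2) y0 s0] by (simp add: prod_eq_iff)
  qed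
  have T_moves: "\<exists>t \<in> T. \<Psi> (ev t) (y, s) \<noteq> (y, s)" if y: "y \<in> Y" and s: "s \<in> S" for y s
  proof (rule ccontr)
    assume "\<not> (\<exists>t \<in> T. \<Psi> (ev t) (y, s) \<noteq> (y, s))"
    then have fixed: "\<Psi> (ev t) (y, s) = (y, s)" if "t \<in> T" for t using that by blast
    have fixed_y: "\<psi> (ev t) y = y" if "t \<in> T" for t
      using fst_\<Psi>[of t y s] T that y s fixed by simp
    show False
    \<comment> \<open>The test uses \<open>nb basis\<close> because a crossing whose edge meets the
      copies of \<open>basis\<close> has its own point only within one letter of them. Away from
      \<open>nb basis\<close> every crossing is therefore twisted.\<close>
    proof (cases "\<exists>t \<in> T. \<exists>g \<in> visited t. \<psi> g y \<in> copies (nb basis)")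
      case True
      then obtain t g x i where t: "t \<in> T" "g \<in> visited t" and x: "\<psi> g y = Inl (x, i)" "x \<in> nb basis" "i < k"
        by (auto simp: copies_def)
      obtain q where q: "path q" "ev q = g" "length q \<le> length t"
        using visited_subpath[OF _ t(2)] T t(1) by blast
      have "x \<in> (nb ^^ 1) basis" "1 + length q \<le> M" using x(2) q(3) n[OF t(1)] by (simp_all add: M_def)
      with completion_path_back[OF compl[unfolded X0_def] q(1) y, of x i 1] x q(2)
      obtain x' where x': "y = Inl (x', i)" "x' \<in> (nb ^^ (1 + length q)) basis" by auto
      have "1 + length q \<le> Suc n" using q(3) n[OF t(1)] by simp
      from nb_pow_mono[OF this, of basis] x'(2) have x'_n: "x' \<in> (nb ^^ Suc n) basis" by blast
      have "(nb ^^ Suc n) basis \<subseteq> X0" unfolding X0_def by (rule nb_pow_mono) (simp add: M_def)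
      with x'_n have x'_X0: "x' \<in> X0" by blast
      \<comment> \<open>All trajectories of \<open>x'\<close> stay in the piece, where the copies
        imitate \<open>X\<close>; so \<open>x'\<close> is a common fixed point in
        \<open>X\<close>.\<close>
      have "\<phi> (ev t') x' = x'" if t': "t' \<in> T" for t'
      proof -
        have pt: "path t'" using T t' by blast
        have "(nb ^^ (Suc n + length t')) basis \<subseteq> X0"
          unfolding X0_def by (rule nb_pow_mono) (use n[OF t'] in \<open>simp add: M_def\<close>)
        then have "\<forall>g \<in> visited t'. \<phi> g x' \<in> X0"
          using nb_pow_path[OF basis_subset x'_n pt] by blast
        then have "\<psi> (ev t') (Inl (x', i)) = Inl (\<phi> (ev t') x', i)"
          using completion_path[OF \<phi> compl X0X pt x'_X0 x(3)] ev_visited[OF path_ne[OF pt]] by blast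
        then show ?thesis using fixed_y[OF t'] x'(1) by simp
      qed
      then show False using no_fix x'_X0 X0X by blast
    next
      case False
      have free: "a = \<one>\<^bsub>G\<^esub>"
        if va: "v \<in> V" "a \<in> A v" and z: "z \<in> Y" "\<psi> a z = z" "z \<notin> copies (nb basis)" for v a z
      proof (rule ccontr)
        assume a: "a \<noteq> \<one>\<^bsub>G\<^esub>"
        obtain x i where x: "z = Inl (x, i)" "i < k" "x \<in> X" "\<phi> a x = x"
          using is_completionD(6)[OF compl va z(1) a z(2)] by blast
        have "x \<in> nb basis" using basis_nonfree[OF va a x(3,4)] by (simp add: nb_def)
        then show False using z(3) x(1,2) by (simp add: copies_def)
      qed
      \<comment> \<open>Each crossing applies one letter to \<open>S\<close>, and the whole word of
        at most \<open>n\<close> letters fixes \<open>s\<close>. Hence some letter is followed by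
        its reverse, which is the backtracking that \<open>reduce_path\<close> asks for.\<close>
      have "ev t = \<one>\<^bsub>G\<^esub>" if t: "t \<in> T" for t
      proof (rule reduce_path[OF \<psi> y free])
        show "path t" "fst (hd t) = r" using T t by auto
        show "length t \<le> n" using n[OF t] .
        show "\<forall>g \<in> visited t. \<psi> g y \<notin> copies (nb basis)" using False t by blast
        show "ev t = ev t" ..
        show "\<psi> (ev t) y = y" using fixed_y[OF t] .
        fix q assume q: "path q" "fst (hd q) = r" "length q \<le> n" and
          away: "\<forall>g \<in> visited q. \<psi> g y \<notin> copies (nb basis)" and "ev q = ev t" and ne: "crossings q \<noteq> []"
        let ?wd = "map (\<lambda>(v, w, g). (v, w, orb v w (\<psi> g y))) (crossings q)"
        have cross: "adj v w" "\<psi> g y \<in> Y" "outer v w (\<psi> g y)"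
          if vwg: "(v, w, g) \<in> set (crossings q)" for v w g
        proof -
          have g: "g \<in> carrier G" "g \<in> visited q"
            using path_crossings(2)[OF q(1) vwg] crossings_visited[OF q(1) vwg] .
          show vw: "adj v w" using path_crossings(1)[OF q(1) vwg] .
          show gy: "\<psi> g y \<in> Y" using acts_onD(1)[OF \<psi> g(1) y] .
          show "outer v w (\<psi> g y)"
          proof (rule ccontr)
            assume "\<not> outer v w (\<psi> g y)"
            then obtain c b i where c: "c \<in> E v w" "\<psi> c (\<psi> g y) = Inl (b, i)" "b \<in> basis" "i < k"
              by (auto simp: outer_def orb_def copies_def)
            have cG: "c \<in> carrier G" using E_in_G[OF vw c(1)] .
            have cA: "inv\<^bsub>G\<^esub> c \<in> A v"
              using E_subset(1)[OF vw] subgroup.m_inv_closed[OF E_subgroup[OF vw] c(1)] by blast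
            have V: "v \<in> V" using adj_in_V[OF vw] by simp
            have nb: "\<phi> (inv\<^bsub>G\<^esub> c) b \<in> nb basis" using nb_act[OF V cA c(3)] .
            have "\<psi> g y = \<psi> (inv\<^bsub>G\<^esub> c) (Inl (b, i))"
              using G.acts_on_inv(1)[OF \<psi> cG gy] c(2) by simp
            also have "\<dots> = Inl (\<phi> (inv\<^bsub>G\<^esub> c) b, i)"
              using is_completionD(5)[OF compl V cA _ c(4)] c(3) basis_X0 nb nb_X0 by blast
            finally have "\<psi> g y \<in> copies (nb basis)" using nb c(4) by (simp add: copies_def)
            then show False using away g(2) by blast
          qed
        qed
        have "foldr (\<lambda>(v, w, g). \<sigma> v w (\<psi> g y)) cs z = foldr \<rho> (map (\<lambda>(v, w, g). (v, w, orb v w (\<psi> g y))) cs) z"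
          if "set cs \<subseteq> set (crossings q)" for cs z
          using that cross(3) by (induction cs) (auto simp: \<sigma>_def)
        then have "foldr \<rho> ?wd s = snd (\<Psi> (ev q) (y, s))"
          using snd_\<Psi>[OF q(1,2) y s] by simp
        then have wd_s: "foldr \<rho> ?wd s = s" using fixed[OF t] \<open>ev q = ev t\<close> by simp
        have "set ?wd \<subseteq> Lb" using cross(1,2) Lb_in by auto
        moreover have "?wd \<noteq> []" "length ?wd \<le> n" using ne length_crossings[OF q(1)] q(3) by simp_all
        ultimately obtain u l v' where wd: "?wd = u @ l # rev l # v'" using \<rho>_free wd_s s by blast
        then obtain cu c2 c1 cv where cs: "crossings q = cu @ c2 # c1 # cv"
          and c21: "l = (\<lambda>(v, w, g). (v, w, orb v w (\<psi> g y))) c2"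
            "rev l = (\<lambda>(v, w, g). (v, w, orb v w (\<psi> g y))) c1"
          unfolding map_eq_append_conv map_eq_Cons_conv by blast
        obtain v w g2 where c2: "c2 = (v, w, g2)" by (cases c2) auto
        obtain v1 w1 g1 where c1: "c1 = (v1, w1, g1)" by (cases c1) auto
        \<comment> \<open>Reversed labels mean that the same edge is crossed back: the two crossing
          points lie in one orbit of the edge group, which provides the element
          \<open>c\<close>.\<close>
        have eqs: "v1 = w" "w1 = v" "orb w v (\<psi> g1 y) = orb v w (\<psi> g2 y)"
          using c21 by (auto simp: c1 c2 rev_def)
        have "(v, w, g2) \<in> set (crossings q)" using cs c2 by simp
        then have "\<psi> g2 y \<in> orb w v (\<psi> g1 y)" using orb_self cross(1,2) eqs(3) by metis
        then have "\<exists>c \<in> E w v. \<psi> g2 y = \<psi> c (\<psi> g1 y)" by (auto simp: orb_def)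
        then show "\<exists>cu v w g2 g1 cv. crossings q = cu @ (v, w, g2) # (w, v, g1) # cv \<and>
            (\<exists>c \<in> E w v. \<psi> g2 y = \<psi> c (\<psi> g1 y))"
          using cs c1 c2 eqs by blast
      qed
      \<comment> \<open>With all generators trivial, \<open>x0\<close> itself would be a common
        fixed point.\<close>
      then show False using no_fix x0 \<phi>_one by force
    qed
  qed
  have finYS: "finite (Y \<times> S)" using finY S(1) by simp
  obtain P :: "nat monoid" and \<Phi> \<chi> where P: "group P" "finite (carrier P)" "\<Phi> \<in> hom G P"
    and \<chi>_act: "acts_on P (Y \<times> S) \<chi>" and \<chi>: "\<forall>g \<in> carrier G. \<forall>z \<in> Y \<times> S. \<chi> (\<Phi> g) z = \<Psi> g z"
    using G.action_quotient[OF finYS \<Psi>] by blast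
  interpret P: group P by (rule P(1))
  have QG: "ev ` Q \<subseteq> carrier G" and TG: "ev ` T \<subseteq> carrier G" using evs_in_G Q_loops T by blast+
  have z0: "(?y0, s0) \<in> Y \<times> S" using y0 s0 by simp
  have "\<not> \<Phi> ` generate G (ev ` T) \<subseteq> p <#\<^bsub>P\<^esub> (\<Phi> ` generate G (ev ` Q)) #>\<^bsub>P\<^esub> inv\<^bsub>P\<^esub> p"
    if p: "p \<in> carrier P" for p
  proof
    assume sub: "\<Phi> ` generate G (ev ` T) \<subseteq> p <#\<^bsub>P\<^esub> (\<Phi> ` generate G (ev ` Q)) #>\<^bsub>P\<^esub> inv\<^bsub>P\<^esub> p"
    let ?z = "\<chi> p (?y0, s0)"
    have z: "?z \<in> Y \<times> S" using acts_onD(1)[OF \<chi>_act p z0] .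
    have "\<Psi> (ev t) ?z = ?z" if t: "t \<in> T" for t
    proof -
      have "ev t \<in> generate G (ev ` T)" using t by (simp add: generate.incl)
      then have "\<Phi> (ev t) \<in> p <#\<^bsub>P\<^esub> (\<Phi> ` generate G (ev ` Q)) #>\<^bsub>P\<^esub> inv\<^bsub>P\<^esub> p" using sub by blast
      then obtain h where h: "h \<in> generate G (ev ` Q)"
        "\<Phi> (ev t) = p \<otimes>\<^bsub>P\<^esub> \<Phi> h \<otimes>\<^bsub>P\<^esub> inv\<^bsub>P\<^esub> p"
        unfolding r_coset_def l_coset_def by blast
      have hG: "h \<in> carrier G" using G.generate_in_carrier[OF QG h(1)] .
      have \<Phi>h: "\<Phi> h \<in> carrier P" using P(3) hG by (auto simp: hom_def)
      have "\<chi> (\<Phi> h) (?y0, s0) = (?y0, s0)"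
        using \<chi> hG z0 fixed_by_generate[OF \<Psi> QG z0 _ h(1)] Q_fix by simp
      then have "\<chi> (p \<otimes>\<^bsub>P\<^esub> \<Phi> h \<otimes>\<^bsub>P\<^esub> inv\<^bsub>P\<^esub> p) ?z = ?z"
        using acts_onD(3)[OF \<chi>_act] P.acts_on_inv(1)[OF \<chi>_act p z0] p \<Phi>h z z0 by simp
      then show ?thesis using \<chi> TG t z h(2) by force
    qed
    then show False using T_moves[of "fst ?z" "snd ?z"] z by (simp add: mem_Times_iff)
  qed
  then show ?thesis using P by blast
qed

end

section \<open>Consequences of the normalizer condition and the coset action\<close>

context rooted_tree_of_groups
begin

text \<open>The normalizer condition is applied to the cyclic group generated by \<open>c\<close>.
  This group is finite, being contained in \<open>C v\<close>, so its normalizer is finite, and the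
  centralizer of \<open>c\<close> lies in it.\<close>

lemma finite_centralizer:
  assumes nc: "normalizer_condition \<G> (arcs (shape \<G>))"
    and v: "v \<in> V" "v \<noteq> r" and c: "c \<in> C v" "c \<noteq> \<one>\<^bsub>G\<^esub>"
  shows "finite {g \<in> carrier G. g \<cdot> c = c \<cdot> g}"
proof -
  let ?E = "generate G {c}"
  have cG: "c \<in> carrier G" using subgroup.mem_carrier[OF C_subgroup[OF v] c(1)] .
  have sub: "subgroup ?E G" using G.generate_is_subgroup[of "{c}"] cG by simp
  have EC: "?E \<subseteq> C v" using G.generate_subgroup_incl[OF _ C_subgroup[OF v], of "{c}"] c(1) by simp
  have finE: "finite ?E"
    using EC C_subset(2)[OF v] finite_A[OF v(1)] by (meson finite_subset)
  have "c \<in> ?E" by (simp add: generate.incl)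
  then have "?E \<noteq> {\<one>\<^bsub>G\<^esub>}" using c(2) by (metis singletonD)
  then have fin: "finite (rcosets\<^bsub>G\<lparr>carrier := normalizer G ?E\<rparr>\<^esub> ?E)"
    using nc pe[OF v] sub EC unfolding normalizer_condition_def Let_def C_def by blast
  have "normalizer G ?E \<subseteq> carrier G" by (auto simp: normalizer_def stabilizer_def)
  then have "finite (normalizer G ?E)"
    using G.finite_subgroup_of_finite_rcosets[OF finE _ _ _ fin] subgroup.one_closed[OF sub]
      subgroup.subset[OF sub] by blast
  then show ?thesis
    using G.centralizer_subset_normalizer[OF cG] by (rule finite_subset[rotated])
qed

lemma fg_subgroup_loops:
  assumes "fg_subgroup H G"
  obtains Q where "finite Q" "\<forall>q \<in> Q. path q \<and> fst (hd q) = r" "H = generate G (ev ` Q)" "subgroup H G"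
proof -
  obtain S where S: "finite S" "S \<subseteq> carrier G" "H = generate G S" and H: "subgroup H G"
    using assms unfolding fg_subgroup_def by blast
  have "\<forall>s \<in> S. \<exists>q. path q \<and> fst (hd q) = r \<and> ev q = s"
  proof
    fix s assume "s \<in> S"
    then obtain q where "path q" "fst (hd q) = r" "ev q = s"
      using path_exists[OF _ root] S(2) by blast
    then show "\<exists>q. path q \<and> fst (hd q) = r \<and> ev q = s" by blast
  qed
  then obtain f where f: "\<forall>s \<in> S. path (f s) \<and> fst (hd (f s)) = r \<and> ev (f s) = s"
    by (rule bchoice[THEN exE])
  have "ev ` f ` S = (\<lambda>s. s) ` S"
    unfolding image_image by (rule image_cong) (simp_all add: f)
  then have "H = generate G (ev ` f ` S)" using S(3) by simp
  moreover have "finite (f ` S)" "\<forall>q \<in> f ` S. path q \<and> fst (hd q) = r" using S(1) f by auto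
  ultimately show thesis using that H by blast
qed

lemma normalizer_condition_centralizers:
  assumes nc: "normalizer_condition \<G> (arcs (shape \<G>))"
  shows "centralizers_finite"
  unfolding centralizers_finite_def
proof (intro ballI impI)
  fix c assume c: "c \<in> edge_elts" "c \<noteq> \<one>\<^bsub>G\<^esub>"
  then obtain v w where vw: "adj v w" "c \<in> E v w" unfolding edge_elts_def by blast
  then obtain u where "u \<in> V" "u \<noteq> r" "c \<in> C u" unfolding adj_def E_def by (auto split: if_splits)
  then show "finite {g \<in> carrier G. g \<cdot> c = c \<cdot> g}" using finite_centralizer[OF nc _ _ _ c(2)] by blast
qed

lemma coset_action:
  assumes Q: "finite Q" "\<forall>q \<in> Q. path q \<and> fst (hd q) = r" "H = generate G (ev ` Q)" "subgroup H G"
  shows "pointed_action \<G> r par rank pe ((\<lambda>g. g <#\<^bsub>G\<^esub> H) ` carrier G) (\<lambda>g S. g <#\<^bsub>G\<^esub> S) H Q"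
proof -
  have one: "\<one>\<^bsub>G\<^esub> <#\<^bsub>G\<^esub> H = H" using G.lcos_mult_one subgroup.subset[OF Q(4)] .
  show "pointed_action \<G> r par rank pe ((\<lambda>g. g <#\<^bsub>G\<^esub> H) ` carrier G) (\<lambda>g S. g <#\<^bsub>G\<^esub> S) H Q"
  proof unfold_locales
    show "acts_on G ((\<lambda>g. g <#\<^bsub>G\<^esub> H) ` carrier G) (\<lambda>g S. g <#\<^bsub>G\<^esub> S)" by (rule G.acts_on_cosets[OF Q(4)])
    show "H \<in> (\<lambda>g. g <#\<^bsub>G\<^esub> H) ` carrier G" using image_eqI[of H "\<lambda>g. g <#\<^bsub>G\<^esub> H" "\<one>\<^bsub>G\<^esub>"] one by simp
    show "\<exists>g \<in> carrier G. x = g <#\<^bsub>G\<^esub> H" if "x \<in> (\<lambda>g. g <#\<^bsub>G\<^esub> H) ` carrier G" for x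
      using that by blast
    show "finite Q" by (rule Q(1))
    show "path q \<and> fst (hd q) = r \<and> ev q <#\<^bsub>G\<^esub> H = H" if q: "q \<in> Q" for q
    proof -
      have "ev q \<in> H" using q Q(3) by (simp add: generate.incl)
      then show ?thesis using Q(2) q G.l_coset_eq_self_iff[OF Q(4)] path_ev_in_G by blast
    qed
    show "g \<in> generate G (ev ` Q)" if "g \<in> carrier G" "g <#\<^bsub>G\<^esub> H = H" for g
      using that G.l_coset_eq_self_iff[OF Q(4)] Q(3) by blast
  qed
qed

section \<open>Separation from a subgroup and from its conjugates\<close>

lemma separate_from_subgroup:
  assumes nc: "normalizer_condition \<G> (arcs (shape \<G>))"
    and H: "fg_subgroup H G" and g: "g \<in> carrier G" "g \<notin> H"
  shows "\<exists>(P :: nat monoid) \<Phi>. group P \<and> finite (carrier P) \<and> \<Phi> \<in> hom G P \<and> \<Phi> g \<notin> \<Phi> ` H"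
proof -
  obtain Q where Q: "finite Q" "\<forall>q \<in> Q. path q \<and> fst (hd q) = r" "H = generate G (ev ` Q)" "subgroup H G"
    by (rule fg_subgroup_loops[OF H])
  interpret pointed_action \<G> r par rank pe "(\<lambda>g. g <#\<^bsub>G\<^esub> H) ` carrier G" "\<lambda>g S. g <#\<^bsub>G\<^esub> S" H Q
    by (rule coset_action[OF Q])
  have "g <#\<^bsub>G\<^esub> H \<noteq> H" using G.l_coset_eq_self_iff[OF Q(4) g(1)] g(2) by simp
  from separate_element[OF normalizer_condition_centralizers[OF nc] g(1) this] show ?thesis
    unfolding Q(3)[symmetric] .
qed

text \<open>\<open>K\<close> fixes the coset of \<open>g\<close> exactly when it lies in the
  conjugate of \<open>H\<close> by \<open>g\<close>. So \<open>no_conj\<close> says that the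
  generators of \<open>K\<close> have no common fixed point in the coset space.\<close>

lemma separate_from_conjugates:
  assumes nc: "normalizer_condition \<G> (arcs (shape \<G>))"
    and H: "fg_subgroup H G" and K: "fg_subgroup K G"
    and no_conj: "\<not> (\<exists>g \<in> carrier G. K \<subseteq> g <#\<^bsub>G\<^esub> H #>\<^bsub>G\<^esub> inv\<^bsub>G\<^esub> g)"
  shows "\<exists>(P :: nat monoid) \<Phi>. group P \<and> finite (carrier P) \<and> \<Phi> \<in> hom G P \<and>
    \<not> (\<exists>p \<in> carrier P. \<Phi> ` K \<subseteq> p <#\<^bsub>P\<^esub> (\<Phi> ` H) #>\<^bsub>P\<^esub> inv\<^bsub>P\<^esub> p)"
proof -
  obtain Q where Q: "finite Q" "\<forall>q \<in> Q. path q \<and> fst (hd q) = r" "H = generate G (ev ` Q)" "subgroup H G"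
    by (rule fg_subgroup_loops[OF H])
  obtain T where T: "finite T" "\<forall>q \<in> T. path q \<and> fst (hd q) = r" "K = generate G (ev ` T)" "subgroup K G"
    by (rule fg_subgroup_loops[OF K])
  let ?X = "(\<lambda>g. g <#\<^bsub>G\<^esub> H) ` carrier G"
  interpret pointed_action \<G> r par rank pe ?X "\<lambda>g S. g <#\<^bsub>G\<^esub> S" H Q
    by (rule coset_action[OF Q])
  have "\<not> (\<exists>x \<in> ?X. \<forall>t \<in> T. ev t <#\<^bsub>G\<^esub> x = x)"
  proof
    assume "\<exists>x \<in> ?X. \<forall>t \<in> T. ev t <#\<^bsub>G\<^esub> x = x"
    then obtain g where g: "g \<in> carrier G" "\<forall>t \<in> ev ` T. t <#\<^bsub>G\<^esub> (g <#\<^bsub>G\<^esub> H) = g <#\<^bsub>G\<^esub> H" by blast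
    have TG: "ev ` T \<subseteq> carrier G" using evs_in_G T(2) by blast
    have "K \<subseteq> g <#\<^bsub>G\<^esub> H #>\<^bsub>G\<^esub> inv\<^bsub>G\<^esub> g"
    proof
      fix k assume k: "k \<in> K"
      have kG: "k \<in> carrier G" using subgroup.mem_carrier[OF T(4) k] .
      have HG: "H \<subseteq> carrier G" using subgroup.subset[OF Q(4)] .
      have gX: "g <#\<^bsub>G\<^esub> H \<in> ?X" using g(1) by blast
      have "k <#\<^bsub>G\<^esub> (g <#\<^bsub>G\<^esub> H) = g <#\<^bsub>G\<^esub> H"
        using fixed_by_generate[OF \<phi> TG gX g(2)] k T(3) by simp
      then have "inv\<^bsub>G\<^esub> g <#\<^bsub>G\<^esub> (k <#\<^bsub>G\<^esub> (g <#\<^bsub>G\<^esub> H)) = inv\<^bsub>G\<^esub> g <#\<^bsub>G\<^esub> (g <#\<^bsub>G\<^esub> H)" by simp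
      then have "(inv\<^bsub>G\<^esub> g \<cdot> (k \<cdot> g)) <#\<^bsub>G\<^esub> H = H"
        using g(1) kG HG by (simp add: G.lcos_m_assoc G.lcos_mult_one)
      then have "inv\<^bsub>G\<^esub> g \<cdot> k \<cdot> g \<in> H"
        using G.l_coset_eq_self_iff[OF Q(4)] g(1) kG by (simp add: G.m_assoc)
      then show "k \<in> g <#\<^bsub>G\<^esub> H #>\<^bsub>G\<^esub> inv\<^bsub>G\<^esub> g" using G.mem_conjugate_iff[OF Q(4) g(1) kG] by simp
    qed
    then show False using no_conj g(1) by blast
  qed
  from separate_into[OF normalizer_condition_centralizers[OF nc] T(1,2) this] show ?thesis
    unfolding Q(3)[symmetric] T(3)[symmetric] .
qed

text \<open>In a finite quotient the image of the conjugate contains the image of \<open>H\<close>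
  and is no larger, so the two coincide. An \<open>x\<close> in the conjugate but outside
  \<open>H\<close> would be separated from \<open>H\<close> in some such quotient.\<close>

lemma not_properly_conjugate_into:
  assumes nc: "normalizer_condition \<G> (arcs (shape \<G>))"
    and H: "fg_subgroup H G" and d: "d \<in> carrier G" and sub: "H \<subseteq> d <#\<^bsub>G\<^esub> H #>\<^bsub>G\<^esub> inv\<^bsub>G\<^esub> d"
  shows "d <#\<^bsub>G\<^esub> H #>\<^bsub>G\<^esub> inv\<^bsub>G\<^esub> d \<subseteq> H"
proof
  let ?K = "d <#\<^bsub>G\<^esub> H #>\<^bsub>G\<^esub> inv\<^bsub>G\<^esub> d"
  have HG: "H \<subseteq> carrier G" using H subgroup.subset unfolding fg_subgroup_def by blast
  fix x assume x: "x \<in> ?K"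
  then obtain h where h: "h \<in> H" "x = d \<cdot> h \<cdot> inv\<^bsub>G\<^esub> d" unfolding G.conjugate_image by blast
  show "x \<in> H"
  proof (rule ccontr)
    assume x_notin: "x \<notin> H"
    have xG: "x \<in> carrier G" using h d HG by auto
    obtain P :: "nat monoid" and \<Phi> where P: "group P" "finite (carrier P)" "\<Phi> \<in> hom G P"
      and x_sep: "\<Phi> x \<notin> \<Phi> ` H"
      using separate_from_subgroup[OF nc H xG x_notin] by (elim exE conjE) (rule that)
    have \<Phi>_in: "\<Phi> g \<in> carrier P" if "g \<in> carrier G" for g using P(3) that by (auto simp: hom_def)
    have "\<Phi> ` H \<subseteq> carrier P" using \<Phi>_in HG by blast
    then have fin: "finite (\<Phi> ` H)" using P(2) finite_subset by blast
    have "\<Phi> ` ?K = (\<lambda>k. \<Phi> d \<otimes>\<^bsub>P\<^esub> k \<otimes>\<^bsub>P\<^esub> \<Phi> (inv\<^bsub>G\<^esub> d)) ` \<Phi> ` H"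
      unfolding G.conjugate_image image_image
      using hom_mult[OF P(3)] d HG by (intro image_cong) (auto simp: subsetD)
    then have "finite (\<Phi> ` ?K)" "card (\<Phi> ` ?K) \<le> card (\<Phi> ` H)" using fin card_image_le[OF fin] by simp_all
    moreover have "\<Phi> ` H \<subseteq> \<Phi> ` ?K" using sub by blast
    ultimately have "\<Phi> ` H = \<Phi> ` ?K" by (metis card_subset_eq card_mono le_antisym)
    then show False using imageI[OF x, of \<Phi>] x_sep by simp
  qed
qed

theorem conjugacy_separable:
  assumes nc: "normalizer_condition \<G> (arcs (shape \<G>))"
  shows "subgroup_conjugacy_separable G"
  unfolding subgroup_conjugacy_separable_def
proof (intro allI impI)
  fix H K assume HK: "fg_subgroup H G \<and> fg_subgroup K G \<and> \<not> conjugate_subsets G H K"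
  then have H: "fg_subgroup H G" and K: "fg_subgroup K G" and not_conj: "\<not> conjugate_subsets G H K" by auto
  have HG: "H \<subseteq> carrier G" and KG: "K \<subseteq> carrier G"
    using H K subgroup.subset unfolding fg_subgroup_def by blast+
  show "\<exists>(Q :: nat monoid) \<phi>. group Q \<and> finite (carrier Q) \<and> \<phi> \<in> hom G Q \<and>
      \<not> conjugate_subsets Q (\<phi> ` H) (\<phi> ` K)"
  proof (cases "\<exists>g \<in> carrier G. K \<subseteq> g <#\<^bsub>G\<^esub> H #>\<^bsub>G\<^esub> inv\<^bsub>G\<^esub> g")
    case False
    obtain P :: "nat monoid" and \<Phi> where P: "group P" "finite (carrier P)" "\<Phi> \<in> hom G P"
      and sep: "\<not> (\<exists>p \<in> carrier P. \<Phi> ` K \<subseteq> p <#\<^bsub>P\<^esub> (\<Phi> ` H) #>\<^bsub>P\<^esub> inv\<^bsub>P\<^esub> p)"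
      using separate_from_conjugates[OF nc H K False] by (elim exE conjE) (rule that)
    have "\<not> conjugate_subsets P (\<Phi> ` H) (\<Phi> ` K)"
    proof
      assume "conjugate_subsets P (\<Phi> ` H) (\<Phi> ` K)"
      then obtain p where "p \<in> carrier P" "\<Phi> ` K = p <#\<^bsub>P\<^esub> (\<Phi> ` H) #>\<^bsub>P\<^esub> inv\<^bsub>P\<^esub> p"
        unfolding conjugate_subsets_def by (elim bexE) (rule that)
      then show False using sep by (metis order_refl)
    qed
    then show ?thesis using P by blast
  next
    case True
    then obtain a where a: "a \<in> carrier G" "K \<subseteq> a <#\<^bsub>G\<^esub> H #>\<^bsub>G\<^esub> inv\<^bsub>G\<^esub> a" by blast
    \<comment> \<open>Otherwise \<open>K\<close> lies in its own conjugate by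
      \<open>a \<cdot> b\<close>, hence equals it; the conjugate of \<open>H\<close> by
      \<open>a\<close> lies between the two and is therefore \<open>K\<close>.\<close>
    have not_into: "\<not> (\<exists>g \<in> carrier G. H \<subseteq> g <#\<^bsub>G\<^esub> K #>\<^bsub>G\<^esub> inv\<^bsub>G\<^esub> g)"
    proof
      assume "\<exists>g \<in> carrier G. H \<subseteq> g <#\<^bsub>G\<^esub> K #>\<^bsub>G\<^esub> inv\<^bsub>G\<^esub> g"
      then obtain b where b: "b \<in> carrier G" "H \<subseteq> b <#\<^bsub>G\<^esub> K #>\<^bsub>G\<^esub> inv\<^bsub>G\<^esub> b" by blast
      let ?d = "a \<cdot> b"
      have "a <#\<^bsub>G\<^esub> H #>\<^bsub>G\<^esub> inv\<^bsub>G\<^esub> a \<subseteq> a <#\<^bsub>G\<^esub> (b <#\<^bsub>G\<^esub> K #>\<^bsub>G\<^esub> inv\<^bsub>G\<^esub> b) #>\<^bsub>G\<^esub> inv\<^bsub>G\<^esub> a"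
        using b(2) unfolding G.conjugate_image by (rule image_mono)
      also have "\<dots> = ?d <#\<^bsub>G\<^esub> K #>\<^bsub>G\<^esub> inv\<^bsub>G\<^esub> ?d" by (rule G.conjugate_conjugate[OF KG a(1) b(1)])
      finally have sub: "a <#\<^bsub>G\<^esub> H #>\<^bsub>G\<^esub> inv\<^bsub>G\<^esub> a \<subseteq> ?d <#\<^bsub>G\<^esub> K #>\<^bsub>G\<^esub> inv\<^bsub>G\<^esub> ?d" .
      have "?d \<in> carrier G" using a(1) b(1) by simp
      from not_properly_conjugate_into[OF nc K this subset_trans[OF a(2) sub]]
      have "?d <#\<^bsub>G\<^esub> K #>\<^bsub>G\<^esub> inv\<^bsub>G\<^esub> ?d \<subseteq> K" .
      then have "K = a <#\<^bsub>G\<^esub> H #>\<^bsub>G\<^esub> inv\<^bsub>G\<^esub> a" using a(2) sub by (simp add: subset_antisym)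
      then show False using not_conj a(1) unfolding conjugate_subsets_def by blast
    qed
    obtain P :: "nat monoid" and \<Phi> where P: "group P" "finite (carrier P)" "\<Phi> \<in> hom G P"
      and sep: "\<not> (\<exists>p \<in> carrier P. \<Phi> ` H \<subseteq> p <#\<^bsub>P\<^esub> (\<Phi> ` K) #>\<^bsub>P\<^esub> inv\<^bsub>P\<^esub> p)"
      using separate_from_conjugates[OF nc K H not_into] by (elim exE conjE) (rule that)
    have "\<Phi> ` H \<subseteq> carrier P" using P(3) HG by (auto simp: hom_def)
    \<comment> \<open>\<open>sep\<close> is about \<open>H\<close> inside conjugates of
      \<open>K\<close>, so conjugacy in \<open>P\<close> has to be turned around before it can be
      contradicted.\<close>
    then have sym: "conjugate_subsets P (\<Phi> ` K) (\<Phi> ` H)" if "conjugate_subsets P (\<Phi> ` H) (\<Phi> ` K)"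
      using group.conjugate_subsets_sym[OF P(1) that] by simp
    have "\<not> conjugate_subsets P (\<Phi> ` H) (\<Phi> ` K)"
    proof
      assume "conjugate_subsets P (\<Phi> ` H) (\<Phi> ` K)"
      from sym[OF this] obtain p where
        "p \<in> carrier P" "\<Phi> ` H = p <#\<^bsub>P\<^esub> (\<Phi> ` K) #>\<^bsub>P\<^esub> inv\<^bsub>P\<^esub> p"
        unfolding conjugate_subsets_def by (elim bexE) (rule that)
      then show False using sep by (metis order_refl)
    qed
    then show ?thesis using P by blast
  qed
qed

end

theorem theorem1p5:
  fixes \<G> :: "('v, 'e, 'g, 'h) graph_of_groups"
  assumes "graph_of_groups \<G>"
    and "serre_tree (shape \<G>) (edge_inv \<G>)"
    and "finite (verts (shape \<G>))"
    and "finite (arcs (shape \<G>))"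
    and "\<And>v. v \<in> verts (shape \<G>) \<Longrightarrow> finite (carrier (vertex_group \<G> v))"
    and "normalizer_condition \<G> (arcs (shape \<G>))"
  shows "subgroup_conjugacy_separable (fundamental_group \<G> (arcs (shape \<G>)))"
proof -
  interpret bidirected_digraph "shape \<G>" "edge_inv \<G>"
    using assms(2) by (simp add: serre_tree_def)
  have "verts (shape \<G>) \<noteq> {}"
    using assms(2) by (simp add: serre_tree_def connected_def strongly_connected_def)
  then obtain r where r: "r \<in> verts (shape \<G>)" by (metis ex_in_conv)
  obtain par rank pe where ori: "oriented (verts (shape \<G>)) r par rank pe"
    using serre_tree_oriented[OF assms(2,3) r] by (elim exE) (rule that)
  have pe: "par v \<in> verts (shape \<G>) \<and> rank (par v) < rank v \<and>
      pe v \<in> arcs (shape \<G>) \<and> tail (shape \<G>) (pe v) = par v \<and> head (shape \<G>) (pe v) = v"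
    if "v \<in> verts (shape \<G>)" "v \<noteq> r" for v
    using ori that by (simp add: oriented_def)
  have arcs: "\<exists>v \<in> verts (shape \<G>). v \<noteq> r \<and> (e = pe v \<or> e = edge_inv \<G> (pe v))"
    if "e \<in> arcs (shape \<G>)" for e
    using ori that by (simp add: oriented_def)
  have "rooted_tree_of_groups \<G> r par rank pe"
    by (rule rooted_tree_of_groups.intro) (use assms pe arcs r in blast)+
  then show ?thesis
    by (rule rooted_tree_of_groups.conjugacy_separable[OF _ assms(6)])
qed

end
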